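(* Let $n,d,M\ge1$ and let $0\le t_1<\dots<t_M$ be observation times, with $T>t_M$. Assume that $V$ is continuously embedded in $C^1_0(\mathbb{R}^d,\mathbb{R}^d)$ and that its reproducing kernel $K_V$ is $C^2$ in each of its variables. Assume that $q\mapsto\mathcal{K}_q\in\mathcal{M}_{nd}(\mathbb{R})$ is $C^1$ on $\mathbb{R}^{nd}\times\mathbb{R}^{nd}$, that $g_k:\mathbb{R}^{nd}\times\mathbb{R}^{nd}\to\mathbb{R}$ is $C^1$ for any $1\le k\le M$ and that $E:\mathbb{R}^{nd}\times\mathbb{R}^{nd}\to\mathbb{R}$ is $C^1$. Let $C(q,u)=\frac12\langle\mathcal{K}_qu,u\rangle$. Then for any $u,\delta u\in L^2([0,T],\mathbb{R}^{nd})$ and $q_0,\delta q_0\in\mathbb{R}^{nd}\times\mathbb{R}^{nd}$, if $$J(\epsilon)=E(q_{0,\epsilon})+\int_0^TC(q_{t,\epsilon},u_{t,\epsilon})\,dt+\sum_{k=1}^Mg_k(q_{t_k,\epsilon}),$$ where $u_{t,\epsilon}=u_t+\epsilon\,\delta u_t$, $q_{0,\epsilon}=q_0+\epsilon\,\delta q_0$ and $q_{\cdot,\epsilon}$ is the solution of the controlled system with control $u_{\cdot,\epsilon}$ and initial condition $q_{0,\epsilon}$ (and $q=q_{\cdot,0}$), we have $$\lim_{\epsilon\to0}\frac{J(\epsilon)-J(0)}{\epsilon}=\langle\nabla E(q_0),\delta q_0\rangle+\int_0^T\big(\partial_qC(q_s,u_s)\delta q_s+\partial_uC(q_s,u_s)\delta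 u_s\big)ds+\sum_{k=1}^M\langle\nabla g_k(q_{t_k}),\delta q_{t_k}\rangle$$ $$=\langle\nabla E(q_0)+P_0,\delta q_0\rangle+\int_0^T\big\langle\nabla_uC(q_s,u_s)+\partial_uf(q_s,u_s)^TP_s,\delta u_s\big\rangle ds,$$ where $\delta q$ is the absolutely continuous solution on $[0,T]$ of $\dot{\delta q}_t=\partial_qf(q_t,u_t)\delta q_t+\partial_uf(q_t,u_t)\delta u_t$ with initial value $\delta q_0$, and $P_t\in\mathbb{R}^{nd}\times\mathbb{R}^{nd}$ is of bounded variation with $P_T=0$ and $$dP_t=-\partial_qf(q_t,u_t)^TP_t\,dt-\sum_{k=1}^M\nabla g_k(q_{t_k})\otimes\delta_{t_k}.$$
   Context: $V$ is a Hilbert space of vector fields $\mathbb{R}^d\to\mathbb{R}^d$. $C^1_0(\mathbb{R}^d,\mathbb{R}^d)$ is the space of $C^1$ vector fields vanishing at infinity, with norm $|v|_{1,\infty}$ (sup norm of $v$ and its first derivatives); continuous embedding means there is a constant $c_V$ with $|v|_{1,\infty}\le c_V|v|_V$ for all $v\in V$. Then $V$ is a reproducing kernel Hilbert space with matrix-valued kernel $K_V:\mathbb{R}^d\times\mathbb{R}^d\to\mathcal{M}_d(\mathbb{R})$, characterized by: for all $z',\alpha'\in\mathbb{R}^d$, $K_V(\cdot,z')\alpha'\in V$ and $\langle v,K_V(\cdot,z')\alpha'\rangle_V=v(z')^T\alpha'$ for all $v\in V$. For $x=(x_1,\dots,x_n)$, $p=(p_1,\dots,p_n)\in(\mathbb{R}^d)^n=\mathbb{R}^{nd}$,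 $$H_0(x,p)=\tfrac12\sum_{i,j=1}^n p_i^TK_V(x_i,x_j)p_j.$$ For $q=(x,p)\in\mathbb{R}^{nd}\times\mathbb{R}^{nd}$ and $u\in\mathbb{R}^{nd}$, $f(q,u)=(\partial_pH_0(x,p),\,-\partial_xH_0(x,p)+u)^T$. The controlled system with control $u\in L^2([0,T],\mathbb{R}^{nd})$ and initial condition $q_0$ is $q_t=q_0+\int_0^tf(q_s,u_s)\,ds$, $t\in[0,T]$, with solution $q\in C([0,T],\mathbb{R}^{nd}\times\mathbb{R}^{nd})$. $\nabla_uC$ is the gradient of $C$ in $u$, and $\partial_qC,\partial_uC$ are the partial differentials of $C$. $v\otimes\delta_{t}$ denotes the vector-valued Dirac measure at $t$ with value $v$.
   Formalization: The adjoint equation has the extra term −∇_qC(q_t,u_t)dt, without which the second equality fails when 𝒦_q depends on q; and "C² in each of its variables" means that K_V and its first and second derivatives in each variable are jointly continuous in both variables. *)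

theory Defs
  imports "HOL-Analysis.Analysis"
begin

section \<open>Differential calculus\<close>

definition C1 :: "('a::real_normed_vector \<Rightarrow> 'b::real_normed_vector) \<Rightarrow> bool" where
  "C1 f \<longleftrightarrow> (\<exists>f' :: 'a \<Rightarrow> 'a \<Rightarrow>\<^sub>L 'b.
     (\<forall>x. (f has_derivative blinfun_apply (f' x)) (at x)) \<and> continuous_on UNIV f')"

text \<open>Meaningful where \<open>f\<close> is differentiable.\<close>

definition grad :: "('a::euclidean_space \<Rightarrow> real) \<Rightarrow> 'a \<Rightarrow> 'a" where
  "grad f x = (THE D. GDERIV f x :> D)"

text \<open>
  \<open>k\<close> is \<open>C\<^sup>2\<close> in its first variable, the derivatives with respect to that variable being
  continuous as functions of both variables. Nothing is required of the mixed derivatives.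
  For reproducing kernels, continuity in the differentiated variable alone would not suffice to
  make the Hamiltonian vector field below differentiable.
\<close>

definition C2_in_first ::
  "('a::real_normed_vector \<Rightarrow> 'b::real_normed_vector \<Rightarrow> 'c::real_normed_vector) \<Rightarrow> bool" where
  "C2_in_first k \<longleftrightarrow>
     (\<exists>(k' :: 'a \<Rightarrow> 'b \<Rightarrow> 'a \<Rightarrow>\<^sub>L 'c) (k'' :: 'a \<Rightarrow> 'b \<Rightarrow> 'a \<Rightarrow>\<^sub>L 'a \<Rightarrow>\<^sub>L 'c).
        (\<forall>x y. ((\<lambda>x. k x y) has_derivative blinfun_apply (k' x y)) (at x)) \<and>
        (\<forall>x y. ((\<lambda>x. k' x y) has_derivative blinfun_apply (k'' x y)) (at x)) \<and>
        continuous_on UNIV (\<lambda>(x, y). k x y) \<and>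
        continuous_on UNIV (\<lambda>(x, y). k' x y) \<and>
        continuous_on UNIV (\<lambda>(x, y). k'' x y))"

definition C2_in_each_variable ::
  "('a::real_normed_vector \<Rightarrow> 'a \<Rightarrow> 'c::real_normed_vector) \<Rightarrow> bool" where
  "C2_in_each_variable k \<longleftrightarrow> C2_in_first k \<and> C2_in_first (\<lambda>y x. k x y)"


section \<open>Hilbert spaces of vector fields\<close>

text \<open>
  A Hilbert space of vector fields is given by a type \<open>'v\<close> of classes \<open>real_inner\<close> and
  \<open>complete_space\<close> together with the map \<open>ev\<close> sending an element to the field it is.
\<close>

definition space_of_fields ::
  "('v::{real_inner,complete_space} \<Rightarrow> real^'d \<Rightarrow> real^'d) \<Rightarrow> bool" where
  "space_of_fields ev \<longleftrightarrow> inj ev \<and> (\<forall>x. linear (\<lambda>v. ev v x))"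

definition C1_0 :: "(real^'d \<Rightarrow> real^'d) set" where
  "C1_0 = {v. C1 v \<and> (v \<longlongrightarrow> 0) at_infinity}"

text \<open>Extended-real valued, so that a finite upper bound includes boundedness.\<close>

definition norm_1_inf :: "(real^'d \<Rightarrow> real^'d) \<Rightarrow> ereal" where
  "norm_1_inf v = (SUP x. ereal (norm (v x))) + (SUP x. ereal (onorm (frechet_derivative v (at x))))"

definition continuously_embedded_C1_0 ::
  "('v::{real_inner,complete_space} \<Rightarrow> real^'d \<Rightarrow> real^'d) \<Rightarrow> bool" where
  "continuously_embedded_C1_0 ev \<longleftrightarrow>
     range ev \<subseteq> C1_0 \<and> (\<exists>c. \<forall>v. norm_1_inf (ev v) \<le> ereal (c * norm v))"

definition reproducing_kernel ::
  "('v::{real_inner,complete_space} \<Rightarrow> real^'d \<Rightarrow> real^'d) \<Rightarrow> (real^'d \<Rightarrow> real^'d \<Rightarrow> real^'d^'d) \<Rightarrow> bool"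
where
  "reproducing_kernel ev K \<longleftrightarrow>
     (\<forall>z \<alpha>. \<exists>w. ev w = (\<lambda>y. K y z *v \<alpha>) \<and> (\<forall>v. v \<bullet> w = ev v z \<bullet> \<alpha>))"


section \<open>The controlled Hamiltonian system\<close>

type_synonym ('d, 'n) conf = "real^'d^'n"
type_synonym ('d, 'n) state = "(real^'d^'n) \<times> (real^'d^'n)"

definition hamiltonian ::
  "(real^'d \<Rightarrow> real^'d \<Rightarrow> real^'d^'d) \<Rightarrow> ('d::finite, 'n::finite) conf \<Rightarrow> ('d, 'n) conf \<Rightarrow> real" where
  "hamiltonian K x p = 1/2 * (\<Sum>i\<in>UNIV. \<Sum>j\<in>UNIV. (p $ i) \<bullet> (K (x $ i) (x $ j) *v (p $ j)))"

definition dyn ::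
  "(real^'d \<Rightarrow> real^'d \<Rightarrow> real^'d^'d) \<Rightarrow> ('d::finite, 'n::finite) state \<Rightarrow> ('d, 'n) conf \<Rightarrow> ('d, 'n) state" where
  "dyn K q u = (grad (\<lambda>p. hamiltonian K (fst q) p) (snd q),
                - grad (\<lambda>x. hamiltonian K x (snd q)) (fst q) + u)"

definition dyn_q ::
  "(real^'d \<Rightarrow> real^'d \<Rightarrow> real^'d^'d) \<Rightarrow> ('d::finite, 'n::finite) state \<Rightarrow> ('d, 'n) conf \<Rightarrow>
   ('d, 'n) state \<Rightarrow> ('d, 'n) state" where
  "dyn_q K q u = frechet_derivative (\<lambda>q. dyn K q u) (at q)"

definition dyn_u ::
  "(real^'d \<Rightarrow> real^'d \<Rightarrow> real^'d^'d) \<Rightarrow> ('d::finite, 'n::finite) state \<Rightarrow> ('d, 'n) conf \<Rightarrow>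
   ('d, 'n) conf \<Rightarrow> ('d, 'n) state" where
  "dyn_u K q u = frechet_derivative (\<lambda>u. dyn K q u) (at u)"

definition L2 :: "real \<Rightarrow> (real \<Rightarrow> 'a::euclidean_space) \<Rightarrow> bool" where
  "L2 T u \<longleftrightarrow> set_borel_measurable lebesgue {0..T} u \<and>
              set_integrable lebesgue {0..T} (\<lambda>t. (norm (u t))\<^sup>2)"

definition controlled_solution ::
  "(real^'d \<Rightarrow> real^'d \<Rightarrow> real^'d^'d) \<Rightarrow> real \<Rightarrow> (real \<Rightarrow> ('d::finite, 'n::finite) conf) \<Rightarrow> ('d, 'n) state \<Rightarrow>
   (real \<Rightarrow> ('d, 'n) state) \<Rightarrow> bool" where
  "controlled_solution K T u q0 q \<longleftrightarrow> continuous_on {0..T} q \<and>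
     (\<forall>t\<in>{0..T}. q t = q0 + (LINT s:{0..t}|lebesgue. dyn K (q s) (u s)))"

text \<open>Square matrices of size \<open>nd\<close> are represented by the endomorphisms they define.\<close>

definition cost ::
  "(('d::finite, 'n::finite) state \<Rightarrow> ('d, 'n) conf \<Rightarrow>\<^sub>L ('d, 'n) conf) \<Rightarrow> ('d, 'n) state \<Rightarrow> ('d, 'n) conf \<Rightarrow> real" where
  "cost \<K> q u = 1/2 * (blinfun_apply (\<K> q) u \<bullet> u)"

definition cost_q ::
  "(('d::finite, 'n::finite) state \<Rightarrow> ('d, 'n) conf \<Rightarrow>\<^sub>L ('d, 'n) conf) \<Rightarrow> ('d, 'n) state \<Rightarrow> ('d, 'n) conf \<Rightarrow>
   ('d, 'n) state \<Rightarrow> real" where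
  "cost_q \<K> q u = frechet_derivative (\<lambda>q. cost \<K> q u) (at q)"

definition cost_u ::
  "(('d::finite, 'n::finite) state \<Rightarrow> ('d, 'n) conf \<Rightarrow>\<^sub>L ('d, 'n) conf) \<Rightarrow> ('d, 'n) state \<Rightarrow> ('d, 'n) conf \<Rightarrow>
   ('d, 'n) conf \<Rightarrow> real" where
  "cost_u \<K> q u = frechet_derivative (\<lambda>u. cost \<K> q u) (at u)"


section \<open>Absolute continuity, bounded variation and differentials of functions\<close>

definition abs_continuous_on_Icc :: "real \<Rightarrow> real \<Rightarrow> (real \<Rightarrow> 'a::real_normed_vector) \<Rightarrow> bool" where
  "abs_continuous_on_Icc a b f \<longleftrightarrow>
     (\<forall>e>0. \<exists>d>0. \<forall>\<D> S. \<D> division_of S \<longrightarrow> S \<subseteq> {a..b} \<longrightarrow> (\<Sum>k\<in>\<D>. Sup k - Inf k) < d \<longrightarrow>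
        (\<Sum>k\<in>\<D>. norm (f (Sup k) - f (Inf k))) < e)"

definition bounded_variation_on_Icc :: "real \<Rightarrow> real \<Rightarrow> (real \<Rightarrow> 'a::real_normed_vector) \<Rightarrow> bool" where
  "bounded_variation_on_Icc a b f \<longleftrightarrow>
     (\<exists>B. \<forall>(s :: nat \<Rightarrow> real) n. mono s \<longrightarrow> range s \<subseteq> {a..b} \<longrightarrow>
        (\<Sum>i<n. norm (f (s (Suc i)) - f (s i))) \<le> B)"

definition linearized_solution ::
  "(real^'d \<Rightarrow> real^'d \<Rightarrow> real^'d^'d) \<Rightarrow> real \<Rightarrow> (real \<Rightarrow> ('d::finite, 'n::finite) state) \<Rightarrow> (real \<Rightarrow> ('d, 'n) conf) \<Rightarrow>
   (real \<Rightarrow> ('d, 'n) conf) \<Rightarrow> ('d, 'n) state \<Rightarrow> (real \<Rightarrow> ('d, 'n) state) \<Rightarrow> bool" where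
  "linearized_solution K T q u \<delta>u \<delta>q0 \<delta>q \<longleftrightarrow>
     abs_continuous_on_Icc 0 T \<delta>q \<and> \<delta>q 0 = \<delta>q0 \<and>
     (AE t in lebesgue. t \<in> {0..T} \<longrightarrow>
        (\<delta>q has_vector_derivative (dyn_q K (q t) (u t) (\<delta>q t) + dyn_u K (q t) (u t) (\<delta>u t)))
          (at t within {0..T}))"

text \<open>
  \<open>has_differential a b P \<mu>\<close> says that \<open>dP = \<mu>\<close> on \<open>[a,b]\<close> for a function \<open>P\<close> of bounded variation:
  \<open>\<mu>([s,t]) = P(t+) - P(s-)\<close>, with \<open>P(a-) = P(a)\<close> and \<open>P(b+) = P(b)\<close>. A jump of \<open>P\<close> at an end
  point thus counts as an atom of \<open>dP\<close>, and no one-sided continuity of \<open>P\<close> is imposed.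
\<close>

definition has_differential ::
  "real \<Rightarrow> real \<Rightarrow> (real \<Rightarrow> 'a::real_normed_vector) \<Rightarrow> (real set \<Rightarrow> 'a) \<Rightarrow> bool" where
  "has_differential a b P \<mu> \<longleftrightarrow>
     (\<forall>s t. a \<le> s \<longrightarrow> s \<le> t \<longrightarrow> t \<le> b \<longrightarrow>
        \<mu> {s..t} = (if t = b then P b else Lim (at_right t) P)
                 - (if s = a then P a else Lim (at_left s) P))"

definition vector_dirac :: "'a::real_vector \<Rightarrow> real \<Rightarrow> real set \<Rightarrow> 'a" where
  "vector_dirac v t B = indicator B t *\<^sub>R v"

text \<open>
  The term \<open>\<nabla>\<^sub>q C(q,u) dt\<close> is needed for the gradient formula as soon as the cost depends on
  the state.
\<close>

definition adjoint_solution ::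
  "(real^'d \<Rightarrow> real^'d \<Rightarrow> real^'d^'d) \<Rightarrow> real \<Rightarrow> (real \<Rightarrow> ('d::finite, 'n::finite) state) \<Rightarrow> (real \<Rightarrow> ('d, 'n) conf) \<Rightarrow>
   (('d, 'n) state \<Rightarrow> ('d, 'n) conf \<Rightarrow>\<^sub>L ('d, 'n) conf) \<Rightarrow> nat \<Rightarrow> (nat \<Rightarrow> real) \<Rightarrow>
   (nat \<Rightarrow> ('d, 'n) state \<Rightarrow> real) \<Rightarrow> (real \<Rightarrow> ('d, 'n) state) \<Rightarrow> bool" where
  "adjoint_solution K T q u \<K> M t g P \<longleftrightarrow>
     bounded_variation_on_Icc 0 T P \<and> P T = 0 \<and>
     has_differential 0 T P (\<lambda>B.
       - (LINT s:B|lebesgue. adjoint (dyn_q K (q s) (u s)) (P s))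
       - (LINT s:B|lebesgue. grad (\<lambda>q'. cost \<K> q' (u s)) (q s))
       - (\<Sum>k=1..M. vector_dirac (grad (g k) (q (t k))) (t k) B))"

end

theory Submission
  imports Defs
begin

text \<open>
  The field \<open>F(q) = f(q,0)\<close> is differentiable with a derivative that is bounded on bounded sets: the
  mixed derivatives of the kernel exist and are bounded by \<open>c\<^sub>V\<^sup>2\<close> because point derivatives are
  continuous functionals on \<open>V\<close>. Continuity of these mixed derivatives is not used; boundedness
  is enough. Gronwall's inequality gives \<open>|q\<^sub>\<epsilon> - q| = O(\<epsilon>)\<close>; the remainder
  \<open>F(q\<^sub>\<epsilon>) - F(q) - F'(q)(q\<^sub>\<epsilon> - q)\<close>, divided by \<open>\<epsilon>\<close>, is bounded and tends to \<open>0\<close> pointwise, so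
  dominated convergence and Gronwall show \<open>(q\<^sub>\<epsilon> - q)/\<epsilon> \<rightarrow> \<delta>q\<close>, and the first formula follows by
  dominated convergence in the running cost. For the second one, outside a countable set
  \<open>P\<^sub>t\<close> equals the integral over \<open>[t,T]\<close> of \<open>\<partial>\<^sub>qf\<^sup>T P + \<nabla>\<^sub>qC\<close> plus the sum of the \<open>\<nabla>g\<^sub>k(q(t\<^sub>k))\<close> with
  \<open>t\<^sub>k > t\<close>, and Fubini's theorem on the triangle \<open>s \<le> t\<close> gives the duality with \<open>\<delta>q\<close>.
\<close>

section \<open>Absolutely continuous functions, Gronwall inequality and dominated convergence\<close>

text \<open>The shaping obstacle is that \<open>F\<close> is differentiable but not known to be
  \<open>C1\<close>. Measurability of its derivative along a curve therefore has to be proved, and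
  there is no uniform Taylor estimate near the trajectory, which is why the remainder is treated
  pointwise in time. The bounds hold only on balls, so the Lipschitz estimate for the flow rests on
  a continuity argument that keeps the perturbed curves within distance 1 of the unperturbed one. In
  the dynamics the control is an additive term \<open>(0, u)\<close> and is used only as an
  integrable function; its square integrability serves the quadratic cost, whose difference
  quotients are dominated by a multiple of |u|^2 + |\<delta>u|^2. The curves \<delta>q and
  \<open>P\<close> are prescribed by an almost everywhere derivative and by the values of a measure
  on closed intervals. Both are turned into integral identities, the form in which they can be
  paired. In the duality the state part of the derivative of the cost cancels because its gradient
  is a source term of the adjoint equation.\<close>

text \<open>For a fine tagged division, intervals whose tag lies in the exceptional null set are contained in
  an open set of small measure, so absolute continuity controls them; the others are controlled by
  the derivative.\<close>

lemma abs_continuous_has_integral: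
  fixes f :: "real \<Rightarrow> 'a::euclidean_space"
  assumes ac: "abs_continuous_on_Icc a b f" and ab: "a \<le> b"
    and der: "AE t in lebesgue. t \<in> {a..b} \<longrightarrow> (f has_vector_derivative f' t) (at t within {a..b})"
  shows "(f' has_integral (f b - f a)) {a..b}"
proof -
  obtain N where N: "negligible N"
    and der': "\<And>x. x \<in> {a..b} \<Longrightarrow> x \<notin> N \<Longrightarrow> (f has_vector_derivative f' x) (at x within {a..b})"
    using der unfolding eventually_ae_filter_negligible by blast
  \<comment> \<open>With the value 0 on the exceptional set, an interval with tag in
    \<open>N\<close> contributes to the error only the increment of \<open>f\<close>, which is what
    absolute continuity can bound. The change is undone at the end, \<open>N\<close> being
    negligible.\<close>
  define g where "g x = (if x \<in> N then 0 else f' x)" for x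
  have "(g has_integral (f b - f a)) {a..b}"
    unfolding has_integral_real
  proof (intro allI impI)
    fix e :: real assume "e > 0"
    \<comment> \<open>The summand 1 makes the quotient meaningful for \<open>a = b\<close> and the
      inequality \<open>\<eta> * (b - a) < e/2\<close> strict.\<close>
    define \<eta> where "\<eta> = e / 2 / (b - a + 1)"
    have \<eta>: "\<eta> > 0" and \<eta>e: "\<eta> * (b - a) < e/2"
      using \<open>e > 0\<close> ab by (auto simp: \<eta>_def field_simps)
    have "\<exists>d>0. x \<notin> N \<longrightarrow> x \<in> {a..b} \<longrightarrow>
        (\<forall>y\<in>{a..b}. norm (y - x) < d \<longrightarrow> norm (f y - f x - (y - x) *\<^sub>R g x) \<le> \<eta> * norm (y - x))" for x
    proof (cases "x \<notin> N \<and> x \<in> {a..b}")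
      case True
      then have "(f has_derivative (\<lambda>h. h *\<^sub>R g x)) (at x within {a..b})"
        using der' by (simp add: g_def has_vector_derivative_def)
      then show ?thesis using \<eta> unfolding has_derivative_within_alt by blast
    qed (use zero_less_one in blast)
    then obtain d where d: "\<And>x. d x > 0" and
      d': "\<And>x y. x \<notin> N \<Longrightarrow> x \<in> {a..b} \<Longrightarrow> y \<in> {a..b} \<Longrightarrow> norm (y - x) < d x \<Longrightarrow>
        norm (f y - f x - (y - x) *\<^sub>R g x) \<le> \<eta> * norm (y - x)"
      by metis
    obtain \<delta> where \<delta>: "\<delta> > 0" and
      \<delta>': "\<And>\<D> S. \<D> division_of S \<Longrightarrow> S \<subseteq> {a..b} \<Longrightarrow> (\<Sum>k\<in>\<D>. Sup k - Inf k) < \<delta> \<Longrightarrow>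
        (\<Sum>k\<in>\<D>. norm (f (Sup k) - f (Inf k))) < e/2"
      using ac \<open>e > 0\<close> unfolding abs_continuous_on_Icc_def by (meson half_gt_zero)
    have Nnull: "N \<in> null_sets lebesgue" using N by (simp add: negligible_iff_null_sets)
    obtain U where U: "open U" "N \<subseteq> U" "U - N \<in> lmeasurable" "emeasure lebesgue (U - N) < ennreal \<delta>"
      using sets_lebesgue_outer_open[of N \<delta>] Nnull \<delta> by (auto simp: null_sets_def)
    have Um: "U \<in> sets lebesgue" using U(1) by auto
    have "emeasure lebesgue U = emeasure lebesgue (U - N)"
      using emeasure_Diff_null_set[OF Nnull Um] by simp
    then have eU: "emeasure lebesgue U < ennreal \<delta>" using U(4) by simp
    then have Ul: "U \<in> lmeasurable"
      using Um by (intro fmeasurableI) (auto simp: less_top[symmetric] intro: order_less_le_trans)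
    have mU: "measure lebesgue U < \<delta>"
      using eU \<delta> Ul by (simp add: emeasure_eq_measure2 ennreal_less_iff)
    define \<gamma> where "\<gamma> x = (if x \<in> N then U else ball x (d x))" for x
    show "\<exists>\<gamma>. gauge \<gamma> \<and> (\<forall>\<D>. \<D> tagged_division_of {a..b} \<and> \<gamma> fine \<D> \<longrightarrow>
              norm ((\<Sum>(x, k)\<in>\<D>. measure lborel k *\<^sub>R g x) - (f b - f a)) < e)"
    proof (intro exI[of _ \<gamma>] conjI allI impI)
      show "gauge \<gamma>" using U d unfolding gauge_def \<gamma>_def by auto
      fix p assume "p tagged_division_of {a..b} \<and> \<gamma> fine p"
      then have p: "p tagged_division_of {a..b}" and fine: "\<gamma> fine p" by auto
      note pD = tagged_division_ofD[OF p]
      define p1 where "p1 = {xk \<in> p. fst xk \<in> N}"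
      define p2 where "p2 = {xk \<in> p. fst xk \<notin> N}"
      have pun: "p = p1 \<union> p2" "p1 \<inter> p2 = {}" "finite p1" "finite p2"
        using pD(1) by (auto simp: p1_def p2_def)
      define h where "h = (\<lambda>(x,k). measure lborel k *\<^sub>R g x - (f (Sup k) - f (Inf k)))"
      have interval: "\<exists>u v. k = {u..v} \<and> u \<le> v \<and> x \<in> {u..v} \<and> {u..v} \<subseteq> {a..b} \<and> {u..v} \<subseteq> \<gamma> x"
        if xk: "(x,k) \<in> p" for x k
      proof -
        obtain u v where "k = {u..v}" using pD(4)[OF xk] by (auto simp: cbox_interval)
        then show ?thesis
          using pD(2,3)[OF xk] fine xk unfolding fine_def by fastforce
      qed
      have "norm (sum h p2) \<le> (\<Sum>(x,k)\<in>p2. \<eta> * measure lborel k)"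
      proof (rule sum_norm_le)
        fix xk assume xk: "xk \<in> p2"
        obtain x k where [simp]: "xk = (x,k)" by fastforce
        have xN: "x \<notin> N" and xp: "(x,k) \<in> p" using xk by (auto simp: p2_def)
        obtain u v where k: "k = {u..v}" "u \<le> v" "x \<in> {u..v}" "{u..v} \<subseteq> {a..b}" "{u..v} \<subseteq> \<gamma> x"
          using interval[OF xp] by blast
        have sub: "{u..v} \<subseteq> ball x (d x)" using k(5) xN by (simp add: \<gamma>_def)
        have "u \<in> ball x (d x)" "v \<in> ball x (d x)" using sub k(2) by auto
        then have "norm (u - x) < d x" "norm (v - x) < d x"
          by (auto simp: dist_real_def)
        then have 1: "norm (f u - f x - (u - x) *\<^sub>R g x) \<le> \<eta> * (x - u)"
          "norm (f v - f x - (v - x) *\<^sub>R g x) \<le> \<eta> * (v - x)"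
          using d'[of x u] d'[of x v] xN k by auto
        \<comment> \<open>The derivative estimate compares only with the tag, so the increment over
          \<open>{u..v}\<close> is split at \<open>x\<close>. As \<open>x\<close> lies between the
          end points, the two errors add up to \<eta> times the length.\<close>
        have "h xk = (f u - f x - (u - x) *\<^sub>R g x) - (f v - f x - (v - x) *\<^sub>R g x)"
          using k by (simp add: h_def algebra_simps)
        also have "norm \<dots> \<le> \<eta> * (x - u) + \<eta> * (v - x)"
          using 1 by (meson add_mono norm_triangle_ineq4 order_trans)
        finally show "norm (h xk) \<le> (case xk of (x, k) \<Rightarrow> \<eta> * measure lborel k)"
          using k by (simp add: algebra_simps)
      qed
      also have "\<dots> \<le> (\<Sum>(x,k)\<in>p. \<eta> * measure lborel k)"
        using pun \<eta> by (intro sum_mono2) (auto simp: pD(1))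
      also have "\<dots> = \<eta> * (\<Sum>(x,k)\<in>p. measure lborel k)"
        by (simp add: sum_distrib_left case_prod_unfold)
      also have "\<dots> = \<eta> * (b - a)"
        using additive_content_tagged_division[of p a b] p ab by (simp add: cbox_interval)
      finally have h2: "norm (sum h p2) < e/2" using \<eta>e by linarith
      have part: "p1 tagged_partial_division_of {a..b}"
        using tagged_partial_division_subset[of p "{a..b}" p1] p pun(1)
        unfolding tagged_division_of_def by blast
      note td = tagged_partial_division_of_Union_self[OF part]
      note div = division_of_tagged_division[OF td]
      have sub: "\<Union>(snd ` p1) \<subseteq> {a..b}" using pD(3) pun(1) by fastforce
      have subU: "\<Union>(snd ` p1) \<subseteq> U"
      proof (rule Union_least)
        fix k assume "k \<in> snd ` p1"
        then obtain x where x: "(x, k) \<in> p" "x \<in> N" unfolding p1_def by auto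
        show "k \<subseteq> U" using interval[OF x(1)] x(2) by (auto simp: \<gamma>_def)
      qed
      have cont: "Sup k - Inf k = measure lborel k" if "k \<in> snd ` p1" for k
      proof -
        obtain x where "(x, k) \<in> p1" using \<open>k \<in> snd ` p1\<close> by auto
        then have "(x, k) \<in> p" using pun(1) by blast
        then obtain u v where "k = {u..v}" "u \<le> v" using interval by blast
        then show ?thesis by simp
      qed
      have "(\<Sum>k\<in>snd ` p1. Sup k - Inf k) = (\<Sum>k\<in>snd ` p1. measure lborel k)"
        using cont by simp
      also have "\<dots> = measure lebesgue (\<Union>(snd ` p1))"
        unfolding content_division[OF div, symmetric]
      proof (rule sum.cong)
        fix k assume "k \<in> snd ` p1"
        then obtain x where "(x, k) \<in> p1" by auto
        then have "(x, k) \<in> p" using pun(1) by blast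
        then obtain u v where "k = {u..v}" using interval by blast
        then show "measure lborel k = measure lebesgue k" by (simp add: measure_completion)
      qed simp
      also have "\<dots> \<le> measure lebesgue U"
        using subU Ul div by (intro measure_mono_fmeasurable) (auto intro: fmeasurableD lmeasurable_division)
      finally have "(\<Sum>k\<in>snd ` p1. norm (f (Sup k) - f (Inf k))) < e/2"
        using mU by (intro \<delta>'[OF div sub]) simp
      moreover have "(\<Sum>k\<in>snd ` p1. norm (f (Sup k) - f (Inf k))) = (\<Sum>(x,k)\<in>p1. norm (f (Sup k) - f (Inf k)))"
      proof -
        \<comment> \<open>Absolute continuity speaks of a set of intervals, the Riemann sum of
          tagged pairs. Two pairs can share an interval only if it is degenerate, and then the
          increment vanishes. The empty interval gets the value 0 because its \<open>Sup\<close> and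
          \<open>Inf\<close> are arbitrary.\<close>
        let ?d = "\<lambda>k. if k = {} then 0 else norm (f (Sup k) - f (Inf k))"
        have ne: "k \<noteq> {}" if "(x, k) \<in> p1" for x k using pD(2) that pun(1) by blast
        have "(\<Sum>k\<in>snd ` p1. norm (f (Sup k) - f (Inf k))) = (\<Sum>k\<in>snd ` p1. ?d k)"
          using ne by (intro sum.cong) auto
        also have "\<dots> = (\<Sum>(x,k)\<in>p1. ?d k)"
        proof (rule sum.over_tagged_division_lemma[OF td, symmetric])
          fix u v :: real assume "box u v = {}"
          then have "v \<le> u" by (simp add: box_real)
          then show "?d (cbox u v) = 0" by (cases "u = v") auto
        qed
        also have "\<dots> = (\<Sum>(x,k)\<in>p1. norm (f (Sup k) - f (Inf k)))"
          using ne by (intro sum.cong) auto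
        finally show ?thesis .
      qed
      moreover have "norm (sum h p1) \<le> (\<Sum>(x,k)\<in>p1. norm (f (Sup k) - f (Inf k)))"
        by (rule sum_norm_le) (auto simp: h_def g_def p1_def norm_minus_commute)
      ultimately have h1: "norm (sum h p1) < e/2" by simp
      have "(\<Sum>(x, k)\<in>p. measure lborel k *\<^sub>R g x) - (f b - f a) = sum h p"
        using additive_tagged_division_1[OF ab p, of f]
        by (simp add: h_def case_prod_unfold sum_subtractf)
      also have "\<dots> = sum h p1 + sum h p2"
        using pun by (simp add: sum.union_disjoint)
      finally show "norm ((\<Sum>(x, k)\<in>p. measure lborel k *\<^sub>R g x) - (f b - f a)) < e"
        using h1 h2 norm_triangle_ineq[of "sum h p1" "sum h p2"] by simp
    qed
  qed
  then show ?thesis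
    by (rule has_integral_spike[OF N, rotated]) (simp add: g_def)
qed

text \<open>At a point where \<open>exp (- 2 * L * t) * \<phi> t\<close> is maximal, the integral term is at most half of
  the left-hand side.\<close>

lemma gronwall:
  fixes \<phi> :: "real \<Rightarrow> real"
  assumes cont: "continuous_on {0..T} \<phi>" and L: "L > 0"
    and le: "\<And>t. t \<in> {0..T} \<Longrightarrow> \<phi> t \<le> a + L * integral {0..t} \<phi>" and t: "t \<in> {0..T}"
    and a: "a \<ge> 0"
  shows "\<phi> t \<le> 2 * a * exp (2 * L * t)"
proof -
  have ct: "continuous_on {0..T} (\<lambda>t. exp (- 2 * L * t) * \<phi> t)"
    by (intro continuous_intros cont)
  have ne: "{0..T} \<noteq> {}" using t by blast
  obtain s where s: "s \<in> {0..T}" and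
    max: "\<And>r. r \<in> {0..T} \<Longrightarrow> exp (- 2 * L * r) * \<phi> r \<le> exp (- 2 * L * s) * \<phi> s"
    using continuous_attains_sup[OF compact_Icc ne ct] by blast
  define m where "m = exp (- 2 * L * s) * \<phi> s"
  have m: "\<phi> r \<le> m * exp (2 * L * r)" if "r \<in> {0..T}" for r
    using max[OF that] by (simp add: m_def exp_minus field_simps)
  have m0: "\<phi> s = m * exp (2 * L * s)" by (simp add: m_def exp_minus field_simps)
  have "((\<lambda>r. m * exp (2 * L * r) / (2 * L)) has_real_derivative m * exp (2 * L * r)) (at r within {0..s})" for r
    using L by (auto intro!: derivative_eq_intros)
  then have I: "((\<lambda>r. m * exp (2 * L * r)) has_integral
      (m * exp (2 * L * s) / (2 * L) - m * exp (2 * L * 0) / (2 * L))) {0..s}"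
    using s by (intro fundamental_theorem_of_calculus)
      (auto simp: has_real_derivative_iff_has_vector_derivative)
  have "m \<le> 2 * a"
  proof (cases "m \<le> 0")
    case False
    have "integral {0..s} \<phi> \<le> m * exp (2 * L * s) / (2 * L) - m * exp (2 * L * 0) / (2 * L)"
      using s by (intro has_integral_le[OF integrable_integral I] integrable_continuous_real
          continuous_on_subset[OF cont] m) auto
    also have "\<dots> \<le> m * exp (2 * L * s) / (2 * L)" using False L by simp
    finally have "L * integral {0..s} \<phi> \<le> m * exp (2 * L * s) / 2"
      using L by (simp add: field_simps)
    with le[OF s] m0 have "m * exp (2 * L * s) \<le> 2 * a" by linarith
    moreover have "m * 1 \<le> m * exp (2 * L * s)" using False L s by (intro mult_left_mono) auto
    ultimately show ?thesis by linarith
  qed (use a in linarith)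
  then show ?thesis using m[OF t] by (meson exp_ge_zero mult_right_mono order_trans)
qed

text \<open>A limit at 0 is tested on sequences, which brings in the sequential theorem. The
  conditions concern only small \<epsilon> different from 0, since the families in question are
  difference quotients whose bounds need a small parameter.\<close>

lemma dominated_convergence_at:
  fixes f :: "real \<Rightarrow> real \<Rightarrow> 'b::euclidean_space"
  assumes S: "S \<in> sets lebesgue" and \<delta>: "\<delta> > 0"
    and meas: "\<And>\<epsilon>. 0 < \<bar>\<epsilon>\<bar> \<Longrightarrow> \<bar>\<epsilon>\<bar> < \<delta> \<Longrightarrow> f \<epsilon> \<in> borel_measurable (lebesgue_on S)"
    and w: "w integrable_on S"
    and bd: "\<And>\<epsilon> x. 0 < \<bar>\<epsilon>\<bar> \<Longrightarrow> \<bar>\<epsilon>\<bar> < \<delta> \<Longrightarrow> x \<in> S \<Longrightarrow> norm (f \<epsilon> x) \<le> w x"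
    and lim: "\<And>x. x \<in> S \<Longrightarrow> ((\<lambda>\<epsilon>. f \<epsilon> x) \<longlongrightarrow> g x) (at 0)"
  shows "((\<lambda>\<epsilon>. integral S (f \<epsilon>)) \<longlongrightarrow> integral S g) (at 0)"
proof -
  have at: "at 0 = at 0 within ball (0::real) \<delta>"
    using \<delta> by (intro at_within_open[symmetric]) auto
  have "((\<lambda>\<epsilon>. integral S (f \<epsilon>)) \<longlongrightarrow> integral S g) (at 0 within ball 0 \<delta>)"
    unfolding tendsto_at_iff_sequentially comp_def
  proof (intro allI impI)
    fix X :: "nat \<Rightarrow> real" assume X: "\<forall>i. X i \<in> ball 0 \<delta> - {0}" "X \<longlonglongrightarrow> 0"
    have X': "0 < \<bar>X i\<bar>" "\<bar>X i\<bar> < \<delta>" for i using X(1) by (auto simp: dist_real_def)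
    show "(\<lambda>i. integral S (f (X i))) \<longlonglongrightarrow> integral S g"
    proof (rule dominated_convergence(2)[OF _ w])
      show "f (X k) integrable_on S" for k
        using measurable_bounded_by_integrable_imp_integrable[OF meas w _ S] X' bd by blast
      show "(\<lambda>k. f (X k) x) \<longlonglongrightarrow> g x" if "x \<in> S" for x
        using lim[OF that] X unfolding tendsto_at_iff_sequentially comp_def by auto
    qed (use bd X' in blast)
  qed
  then show ?thesis using at by simp
qed

section \<open>Functions of bounded variation and duality\<close>

lemma bounded_variation_imp_bounded:
  assumes "bounded_variation_on_Icc a b f" "a \<le> b"
  shows "bounded (f ` {a..b})"
proof -
  obtain B where B: "\<And>(s::nat \<Rightarrow> real) n. mono s \<Longrightarrow> range s \<subseteq> {a..b} \<Longrightarrow>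
        (\<Sum>i<n. norm (f (s (Suc i)) - f (s i))) \<le> B"
    using assms unfolding bounded_variation_on_Icc_def by blast
  have "dist (f a) y \<le> B" if y: "y \<in> f ` {a..b}" for y
  proof -
    obtain x where x: "x \<in> {a..b}" "y = f x" using y by blast
    \<comment> \<open>The variation bound is applied to the single step from \<open>a\<close> to
      \<open>x\<close>. The sequence then stays at \<open>x\<close> because the definition ranges
      over infinite monotone sequences.\<close>
    let ?s = "\<lambda>i::nat. if i = 0 then a else x"
    have "mono ?s" "range ?s \<subseteq> {a..b}" using x assms(2) by (auto simp: mono_def)
    from B[OF this, of 1] show ?thesis using x(2)
      by (simp add: dist_norm norm_minus_commute)
  qed
  then show ?thesis unfolding bounded_def by blast
qed

lemma bounded_variation_inner:
  fixes f :: "real \<Rightarrow> 'a::real_inner"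
  assumes "bounded_variation_on_Icc a b f"
  shows "bounded_variation_on_Icc a b (\<lambda>x. f x \<bullet> v)"
proof -
  obtain B where B: "\<And>(s::nat \<Rightarrow> real) n. mono s \<Longrightarrow> range s \<subseteq> {a..b} \<Longrightarrow>
        (\<Sum>i<n. norm (f (s (Suc i)) - f (s i))) \<le> B"
    using assms unfolding bounded_variation_on_Icc_def by blast
  show ?thesis unfolding bounded_variation_on_Icc_def
  proof (intro exI[of _ "B * norm v"] allI impI)
    fix s :: "nat \<Rightarrow> real" and n assume s: "mono s" "range s \<subseteq> {a..b}"
    have "(\<Sum>i<n. norm (f (s (Suc i)) \<bullet> v - f (s i) \<bullet> v)) \<le> (\<Sum>i<n. norm (f (s (Suc i)) - f (s i)) * norm v)"
      by (intro sum_mono) (simp add: inner_diff_left[symmetric] Cauchy_Schwarz_ineq2)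
    also have "\<dots> \<le> B * norm v"
      unfolding sum_distrib_right[symmetric] by (intro mult_right_mono B s) auto
    finally show "(\<Sum>i<n. norm (f (s (Suc i)) \<bullet> v - f (s i) \<bullet> v)) \<le> B * norm v" .
  qed
qed

text \<open>Jordan decomposition. The total variation \<open>V\<close> grows from \<open>x\<close>
  to \<open>y\<close> by at least the absolute increment of \<open>f\<close>; this one inequality
  makes both \<open>V\<close> and \<open>V - f\<close> increasing.\<close>

lemma bounded_variation_decomposition:
  fixes f :: "real \<Rightarrow> real"
  assumes "bounded_variation_on_Icc a b f"
  obtains V where "mono_on {a..b} V" "mono_on {a..b} (\<lambda>x. V x - f x)"
proof -
  define A where "A x = {(\<Sum>i<n. \<bar>f (s (Suc i)) - f (s i)\<bar>) | (s::nat \<Rightarrow> real) n. mono s \<and> range s \<subseteq> {a..x}}" for x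
  define V where "V x = Sup (A x)" for x
  obtain B where B: "\<And>(s::nat \<Rightarrow> real) n. mono s \<Longrightarrow> range s \<subseteq> {a..b} \<Longrightarrow>
        (\<Sum>i<n. \<bar>f (s (Suc i)) - f (s i)\<bar>) \<le> B"
    using assms unfolding bounded_variation_on_Icc_def real_norm_def by blast
  have "V x + \<bar>f y - f x\<bar> \<le> V y" if xy: "a \<le> x" "x \<le> y" "y \<le> b" for x y
  proof -
    have "V x \<le> V y - \<bar>f y - f x\<bar>"
      unfolding V_def
    proof (rule cSup_least)
      have "range (\<lambda>i::nat. a) \<subseteq> {a..x}" "mono (\<lambda>i::nat. a)" using xy by (auto simp: mono_def)
      then show "A x \<noteq> {}" unfolding A_def by blast
      fix r assume "r \<in> A x"
      then obtain s :: "nat \<Rightarrow> real" and n where r: "r = (\<Sum>i<n. \<bar>f (s (Suc i)) - f (s i)\<bar>)"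
        and s: "mono s" "range s \<subseteq> {a..x}" unfolding A_def by blast
      \<comment> \<open>The first \<open>n\<close> steps are kept and two more lead through
        \<open>x\<close> to \<open>y\<close>. The step from \<open>s n\<close> to \<open>x\<close>
        can only enlarge the sum; the step from \<open>x\<close> to \<open>y\<close> contributes the
        wanted increment.\<close>
      define s' where "s' i = (if i \<le> n then s i else if i = Suc n then x else y)" for i
      have sx: "s i \<le> x" "a \<le> s i" for i using subsetD[OF s(2), of "s i"] by auto
      have "mono s'"
        using sx xy order_trans[OF sx(1) xy(2)] monoD[OF s(1)] by (auto simp: mono_def s'_def)
      moreover have "range s' \<subseteq> {a..y}" using sx xy order_trans[OF sx(1) xy(2)] by (auto simp: s'_def)
      ultimately have mem: "(\<Sum>i<Suc (Suc n). \<bar>f (s' (Suc i)) - f (s' i)\<bar>) \<in> A y"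
        unfolding A_def by blast
      have bdd: "bdd_above (A y)"
      proof (rule bdd_aboveI[of _ B])
        fix z assume "z \<in> A y"
        then obtain \<sigma> :: "nat \<Rightarrow> real" and m where z: "z = (\<Sum>i<m. \<bar>f (\<sigma> (Suc i)) - f (\<sigma> i)\<bar>)"
          and \<sigma>: "mono \<sigma>" "range \<sigma> \<subseteq> {a..y}" unfolding A_def by blast
        have "{a..y} \<subseteq> {a..b}" using xy by simp
        then show "z \<le> B" unfolding z by (intro B \<sigma> order_trans[OF \<sigma>(2)])
      qed
      have "r + \<bar>f y - f x\<bar> \<le> (\<Sum>i<Suc (Suc n). \<bar>f (s' (Suc i)) - f (s' i)\<bar>)"
        by (simp add: r s'_def)
      also have "\<dots> \<le> Sup (A y)" by (rule cSup_upper[OF mem bdd])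
      finally show "r \<le> Sup (A y) - \<bar>f y - f x\<bar>" by linarith
    qed
    then show ?thesis by linarith
  qed
  note key = this
  show thesis
  proof
    show "mono_on {a..b} V" using key by (force intro!: mono_onI)
    show "mono_on {a..b} (\<lambda>x. V x - f x)"
    proof (rule mono_onI)
      fix x y assume "x \<in> {a..b}" "y \<in> {a..b}" "x \<le> y"
      then show "V x - f x \<le> V y - f y" using key[of x y] by auto
    qed
  qed
qed

text \<open>Monotone functions are Borel measurable with countably many discontinuities, and both
  properties pass to the difference of two of them.\<close>

lemma bounded_variation_real:
  fixes f :: "real \<Rightarrow> real"
  assumes "bounded_variation_on_Icc a b f"
  shows "f \<in> borel_measurable (lebesgue_on {a..b})"
    and "countable {x\<in>{a..b}. \<not> continuous (at x within {a..b}) f}"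
proof -
  obtain V where V: "mono_on {a..b} V" "mono_on {a..b} (\<lambda>x. V x - f x)"
    using bounded_variation_decomposition[OF assms] .
  have f: "f = (\<lambda>x. V x - (V x - f x))" by simp
  have m: "g \<in> borel_measurable (lebesgue_on {a..b})" if "mono_on {a..b} g" for g :: "real \<Rightarrow> real"
  proof (rule borel_measurable_subalgebra[OF _ _ borel_measurable_mono_on_fnc[OF that]])
    show "sets (restrict_space borel {a..b}) \<subseteq> sets (lebesgue_on {a..b})"
      unfolding sets_restrict_space by (intro image_mono) auto
  qed (simp add: space_restrict_space)
  show "f \<in> borel_measurable (lebesgue_on {a..b})"
    by (subst f) (intro borel_measurable_diff m V)
  have "{x\<in>{a..b}. \<not> continuous (at x within {a..b}) f} \<subseteq>
     {x\<in>{a..b}. \<not> continuous (at x within {a..b}) V} \<union>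
     {x\<in>{a..b}. \<not> continuous (at x within {a..b}) (\<lambda>x. V x - f x)}"
    using continuous_diff[of _ V "\<lambda>x. V x - f x"] by auto
  then show "countable {x\<in>{a..b}. \<not> continuous (at x within {a..b}) f}"
    by (rule countable_subset) (intro countable_Un mono_on_ctble_discont V)
qed

lemma bounded_variation_measurable:
  fixes f :: "real \<Rightarrow> 'a::euclidean_space"
  assumes "bounded_variation_on_Icc a b f"
  shows "f \<in> borel_measurable (lebesgue_on {a..b})"
  unfolding borel_measurable_euclidean_space[where f = f]
  using bounded_variation_real(1)[OF bounded_variation_inner[OF assms]] by blast

lemma bounded_variation_countable_discont:
  fixes f :: "real \<Rightarrow> 'a::euclidean_space"
  assumes "bounded_variation_on_Icc a b f"
  shows "countable {x\<in>{a..b}. \<not> continuous (at x within {a..b}) f}"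
proof -
  have "{x\<in>{a..b}. \<not> continuous (at x within {a..b}) f} =
     (\<Union>i\<in>Basis. {x\<in>{a..b}. \<not> continuous (at x within {a..b}) (\<lambda>x. f x \<bullet> i)})"
    by (subst continuous_componentwise) blast
  then show ?thesis
    using bounded_variation_real(2)[OF bounded_variation_inner[OF assms]]
    by (auto intro!: countable_UN simp: countable_finite)
qed

text \<open>\<open>Lim\<close> is meaningful only where the limit exists. At points of continuity
  this replaces the right limits in \<open>has_differential\<close> by values of
  \<open>P\<close>.\<close>

lemma continuous_imp_Lim_at_right:
  fixes f :: "real \<Rightarrow> 'a::t2_space"
  assumes "continuous (at x within {a..b}) f" "a \<le> x" "x < b"
  shows "Lim (at_right x) f = f x"
proof (rule tendsto_Lim)
  have "(f \<longlongrightarrow> f x) (at x within {x..b})"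
    by (rule tendsto_within_subset[OF assms(1)[unfolded continuous_within]]) (simp add: assms)
  then show "(f \<longlongrightarrow> f x) (at_right x)"
    using at_within_Icc_at_right[OF assms(3)] by simp
qed simp

section \<open>Pairings under the integral and integration by parts\<close>

lemma absolutely_integrable_inner_bounded:
  fixes f g :: "real \<Rightarrow> 'a::euclidean_space"
  assumes "f \<in> borel_measurable (lebesgue_on S)" "S \<in> sets lebesgue" "bounded (f ` S)"
    "g absolutely_integrable_on S"
  shows "(\<lambda>x. f x \<bullet> g x) absolutely_integrable_on S" "(\<lambda>x. g x \<bullet> f x) absolutely_integrable_on S"
proof -
  show "(\<lambda>x. f x \<bullet> g x) absolutely_integrable_on S"
    by (rule absolutely_integrable_bounded_measurable_product[OF _ assms])
      (simp add: bilinear_conv_bounded_bilinear bounded_bilinear_inner)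
  then show "(\<lambda>x. g x \<bullet> f x) absolutely_integrable_on S"
    by (subst inner_commute)
qed

lemma absolutely_integrable_inner_continuous:
  fixes f g :: "real \<Rightarrow> 'a::euclidean_space"
  assumes "continuous_on {a..b} f" "g absolutely_integrable_on {a..b}"
  shows "(\<lambda>x. f x \<bullet> g x) absolutely_integrable_on {a..b}" "(\<lambda>x. g x \<bullet> f x) absolutely_integrable_on {a..b}"
proof -
  have 1: "f \<in> borel_measurable (lebesgue_on {a..b})"
    by (rule continuous_imp_measurable_on_sets_lebesgue[OF assms(1)]) simp
  have 2: "bounded (f ` {a..b})"
    by (intro compact_imp_bounded compact_continuous_image assms) simp
  show "(\<lambda>x. f x \<bullet> g x) absolutely_integrable_on {a..b}" "(\<lambda>x. g x \<bullet> f x) absolutely_integrable_on {a..b}"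
    using absolutely_integrable_inner_bounded[OF 1 _ 2 assms(2)] by simp_all
qed

lemma integral_triangle_swap:
  fixes a b :: "real \<Rightarrow> 'a::euclidean_space"
  assumes a: "a absolutely_integrable_on {0..T}" and b: "b absolutely_integrable_on {0..T}"
  shows "integral {0..T} (\<lambda>t. a t \<bullet> integral {0..t} b) = integral {0..T} (\<lambda>s. b s \<bullet> integral {s..T} a)"
proof -
  define M where "M = lebesgue_on {0..T}"
  have S: "{0..T} \<in> sets lebesgue" by simp
  have fin: "finite_measure M" unfolding M_def by (intro finite_measure_lebesgue_on) simp
  interpret finite_measure M by (rule fin)
  interpret pair_sigma_finite M M ..
  have spM: "space M = {0..T}" by (simp add: M_def)
  have ia: "integrable M a" and ib: "integrable M b"
    using absolutely_integrable_imp_integrable[OF a S] absolutely_integrable_imp_integrable[OF b S]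
    by (auto simp: M_def)
  note [measurable] = borel_measurable_integrable[OF ia] borel_measurable_integrable[OF ib]
  have [measurable]: "(\<lambda>x::real. x) \<in> borel_measurable M"
    unfolding M_def by (intro continuous_imp_measurable_on_sets_lebesgue) auto
  \<comment> \<open>The product is cut off to the triangle \<open>s \<le> t\<close>. Its bound
    \<open>norm (a t) * norm (b s)\<close> separates the variables, hence is integrable over the
    square and permits exchanging the integrals.\<close>
  define f where "f t s = (if s \<le> t then a t \<bullet> b s else 0)" for t s
  have fm[measurable]: "(\<lambda>(t,s). f t s) \<in> borel_measurable (M \<Otimes>\<^sub>M M)"
    unfolding f_def by measurable
  have fm1: "(\<lambda>s. f t s) \<in> borel_measurable M" for t
    unfolding f_def by measurable
  have fm2: "(\<lambda>t. f t s) \<in> borel_measurable M" for s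
    unfolding f_def by measurable
  have bd: "norm (f t s) \<le> norm (a t) * norm (b s)" for t s
    by (simp add: f_def Cauchy_Schwarz_ineq2)
  have i1: "integrable M (f t)" for t
  proof (rule Bochner_Integration.integrable_bound[OF _ fm1])
    show "integrable M (\<lambda>s. norm (a t) * norm (b s))" using ib by simp
    show "AE s in M. norm (f t s) \<le> norm (norm (a t) * norm (b s))"
      using bd by (intro AE_I2) (simp add: abs_mult)
  qed
  have i2: "integrable M (\<lambda>t. f t s)" for s
  proof (rule Bochner_Integration.integrable_bound[OF _ fm2])
    show "integrable M (\<lambda>t. norm (a t) * norm (b s))" using ia by simp
    show "AE t in M. norm (f t s) \<le> norm (norm (a t) * norm (b s))"
      using bd by (intro AE_I2) (simp add: abs_mult)
  qed
  have "integrable (M \<Otimes>\<^sub>M M) (\<lambda>(t,s). f t s)"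
  proof (rule Fubini_integrable[OF fm])
    show "integrable M (\<lambda>x. \<integral>y. norm (case (x, y) of (t, s) \<Rightarrow> f t s) \<partial>M)"
    proof (rule Bochner_Integration.integrable_bound[of M "\<lambda>x. norm (a x) * (\<integral>y. norm (b y) \<partial>M)"])
      show "integrable M (\<lambda>x. norm (a x) * (\<integral>y. norm (b y) \<partial>M))" using ia by simp
      show "(\<lambda>x. \<integral>y. norm (case (x, y) of (t, s) \<Rightarrow> f t s) \<partial>M) \<in> borel_measurable M"
        by measurable
      show "AE x in M. norm (\<integral>y. norm (case (x, y) of (t, s) \<Rightarrow> f t s) \<partial>M)
          \<le> norm (norm (a x) * (\<integral>y. norm (b y) \<partial>M))"
      proof (rule AE_I2)
        fix x
        have "(\<integral>y. norm (f x y) \<partial>M) \<le> (\<integral>y. norm (a x) * norm (b y) \<partial>M)"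
          using i1 ib bd by (intro integral_mono) auto
        then show "norm (\<integral>y. norm (case (x, y) of (t, s) \<Rightarrow> f t s) \<partial>M)
          \<le> norm (norm (a x) * (\<integral>y. norm (b y) \<partial>M))"
          by (simp add: abs_mult)
      qed
    qed
    show "AE x in M. integrable M (\<lambda>y. case (x, y) of (t, s) \<Rightarrow> f t s)"
      using i1 by simp
  qed
  then have F: "(\<integral>s. (\<integral>t. f t s \<partial>M) \<partial>M) = (\<integral>t. (\<integral>s. f t s \<partial>M) \<partial>M)" and
    J1: "integrable M (\<lambda>t. \<integral>s. f t s \<partial>M)" and J2: "integrable M (\<lambda>s. \<integral>t. f t s \<partial>M)"
    using Fubini_integral integrable_fst integrable_snd by auto
  have toHK: "(\<integral>t. h t \<partial>M) = integral {0..T} h" if "integrable M h" for h :: "real \<Rightarrow> real"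
    using that unfolding M_def by (intro lebesgue_integral_eq_integral) auto
  have inner1: "(\<integral>s. f t s \<partial>M) = a t \<bullet> integral {0..t} b" if t: "t \<in> {0..T}" for t
  proof -
    have bt: "b integrable_on {0..t}"
      using absolutely_integrable_on_subinterval[OF b, of 0 t] t set_lebesgue_integral_eq_integral(1) by auto
    have "(\<integral>s. f t s \<partial>M) = integral {0..T} (\<lambda>s. if s \<in> {..t} then a t \<bullet> b s else 0)"
      using toHK[OF i1[of t]] by (simp add: f_def[abs_def])
    also have "\<dots> = integral ({..t} \<inter> {0..T}) (\<lambda>s. a t \<bullet> b s)"
      by (rule integral_restrict_Int)
    also have "{..t} \<inter> {0..T} = {0..t}" using t by auto
    also have "integral {0..t} (\<lambda>s. a t \<bullet> b s) = a t \<bullet> integral {0..t} b"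
      using integral_linear[OF bt bounded_linear_inner_right[of "a t"]] by (simp add: o_def)
    finally show ?thesis .
  qed
  have inner2: "(\<integral>t. f t s \<partial>M) = b s \<bullet> integral {s..T} a" if s: "s \<in> {0..T}" for s
  proof -
    have at: "a integrable_on {s..T}"
      using absolutely_integrable_on_subinterval[OF a, of s T] s set_lebesgue_integral_eq_integral(1) by auto
    have "(\<integral>t. f t s \<partial>M) = integral {0..T} (\<lambda>t. if t \<in> {s..} then a t \<bullet> b s else 0)"
      using toHK[OF i2[of s]] by (simp add: f_def[abs_def])
    also have "\<dots> = integral ({s..} \<inter> {0..T}) (\<lambda>t. a t \<bullet> b s)"
      by (rule integral_restrict_Int)
    also have "{s..} \<inter> {0..T} = {s..T}" using s by auto
    also have "integral {s..T} (\<lambda>t. a t \<bullet> b s) = b s \<bullet> integral {s..T} a"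
      using integral_linear[OF at bounded_linear_inner_right[of "b s"]] by (simp add: o_def inner_commute)
    finally show ?thesis .
  qed
  have "integral {0..T} (\<lambda>t. a t \<bullet> integral {0..t} b) = integral {0..T} (\<lambda>t. \<integral>s. f t s \<partial>M)"
    by (intro Henstock_Kurzweil_Integration.integral_cong) (simp add: inner1)
  also have "\<dots> = integral {0..T} (\<lambda>s. \<integral>t. f t s \<partial>M)"
    using F toHK[OF J1] toHK[OF J2] by simp
  also have "\<dots> = integral {0..T} (\<lambda>s. b s \<bullet> integral {s..T} a)"
    by (intro Henstock_Kurzweil_Integration.integral_cong) (simp add: inner2)
  finally show ?thesis .
qed

text \<open>Integration by parts: \<open>x\<close> is a primitive of \<open>b\<close>, and
  \<open>p\<close> a primitive of \<open>- a\<close> that drops by \<open>v k\<close> at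
  \<open>\<tau> k\<close>. The formula for \<open>p\<close> is demanded only off a negligible set,
  so the values of \<open>p\<close> at its jumps are free. The boundary value \<open>p0\<close> is
  kept apart from \<open>p\<close>: it counts an atom at time 0, which the formula for
  \<open>p\<close> at 0 would miss.\<close>

lemma adjoint_duality:
  fixes a b x p :: "real \<Rightarrow> 'a::euclidean_space" and v :: "'k \<Rightarrow> 'a" and \<tau> :: "'k \<Rightarrow> real"
  assumes a: "a absolutely_integrable_on {0..T}" and b: "b absolutely_integrable_on {0..T}"
    and x: "\<And>t. t \<in> {0..T} \<Longrightarrow> x t = x0 + integral {0..t} b"
    and I: "finite I" and \<tau>: "\<And>k. k \<in> I \<Longrightarrow> \<tau> k \<in> {0..T}"
    and p: "\<And>t. t \<in> {0..T} - C \<Longrightarrow> p t = integral {t..T} a + (\<Sum>k\<in>I. if t < \<tau> k then v k else 0)"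
    and C: "negligible C"
    and p0: "p0 = integral {0..T} a + (\<Sum>k\<in>I. v k)"
  shows "integral {0..T} (\<lambda>t. a t \<bullet> x t) + (\<Sum>k\<in>I. v k \<bullet> x (\<tau> k))
     = p0 \<bullet> x0 + integral {0..T} (\<lambda>t. b t \<bullet> p t)"
proof -
  have ai: "a integrable_on {0..T}" and bi: "b integrable_on {0..T}"
    using a b set_lebesgue_integral_eq_integral(1) by auto
  have sub: "b integrable_on {0..t}" if "t \<in> {0..T}" for t
    using integrable_subinterval_real[OF bi, of 0 t] that by auto
  have ib: "(\<lambda>t. a t \<bullet> integral {0..t} b) integrable_on {0..T}"
    using absolutely_integrable_inner_continuous(2)[OF indefinite_integral_continuous_1[OF bi] a]
    by (rule set_lebesgue_integral_eq_integral(1))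
  have ia: "(\<lambda>s. b s \<bullet> integral {s..T} a) integrable_on {0..T}"
    using absolutely_integrable_inner_continuous(2)[OF indefinite_integral_continuous_1'[OF ai] b]
    by (rule set_lebesgue_integral_eq_integral(1))
  have "integral {0..T} (\<lambda>t. a t \<bullet> x t) = integral {0..T} (\<lambda>t. a t \<bullet> x0 + a t \<bullet> integral {0..t} b)"
    by (intro integral_cong) (simp add: x inner_add_right)
  also have "\<dots> = integral {0..T} (\<lambda>t. a t \<bullet> x0) + integral {0..T} (\<lambda>t. a t \<bullet> integral {0..t} b)"
    by (intro integral_add integrable_component ai ib)
  also have "integral {0..T} (\<lambda>t. a t \<bullet> x0) = integral {0..T} a \<bullet> x0"
    using integral_linear[OF ai bounded_linear_inner_left[of x0]] by (simp add: o_def)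
  finally have 1: "integral {0..T} (\<lambda>t. a t \<bullet> x t)
      = integral {0..T} a \<bullet> x0 + integral {0..T} (\<lambda>s. b s \<bullet> integral {s..T} a)"
    by (simp add: integral_triangle_swap[OF a b])
  \<comment> \<open>The formula for \<open>p\<close> has \<open>t < \<tau> k\<close>, while
    \<open>x (\<tau> k)\<close> integrates \<open>b\<close> over the closed interval
    \<open>{0..\<tau> k}\<close>; the two sets differ in one point.\<close>
  have jump: "((\<lambda>t. if t \<in> {..<\<tau> k} then b t \<bullet> v k else 0) has_integral (integral {0..\<tau> k} b \<bullet> v k)) {0..T}"
    if k: "k \<in> I" for k
  proof -
    have "((\<lambda>t. b t \<bullet> v k) has_integral (integral {0..\<tau> k} b \<bullet> v k)) {0..\<tau> k}"
      using has_integral_linear[OF integrable_integral[OF sub[OF \<tau>[OF k]]] bounded_linear_inner_left[of "v k"]]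
      by (simp add: o_def)
    then have "((\<lambda>t. if t \<in> {0..\<tau> k} then b t \<bullet> v k else 0) has_integral (integral {0..\<tau> k} b \<bullet> v k)) {0..T}"
      using \<tau>[OF k] by (subst has_integral_restrict) auto
    then show ?thesis
      by (rule has_integral_spike[of "{\<tau> k}", rotated 2]) auto
  qed
  have "((\<lambda>s. b s \<bullet> integral {s..T} a + (\<Sum>k\<in>I. if s \<in> {..<\<tau> k} then b s \<bullet> v k else 0)) has_integral
      (integral {0..T} (\<lambda>s. b s \<bullet> integral {s..T} a) + (\<Sum>k\<in>I. integral {0..\<tau> k} b \<bullet> v k))) {0..T}"
    by (intro has_integral_add has_integral_sum integrable_integral ia I jump)
  then have "((\<lambda>t. b t \<bullet> p t) has_integral
      (integral {0..T} (\<lambda>s. b s \<bullet> integral {s..T} a) + (\<Sum>k\<in>I. integral {0..\<tau> k} b \<bullet> v k))) {0..T}"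
  proof (rule has_integral_spike[OF C, rotated])
    fix t assume "t \<in> {0..T} - C"
    then show "b t \<bullet> p t = b t \<bullet> integral {t..T} a + (\<Sum>k\<in>I. if t \<in> {..<\<tau> k} then b t \<bullet> v k else 0)"
      by (simp add: p inner_add_right inner_sum_right if_distrib cong: if_cong)
  qed
  then have 2: "integral {0..T} (\<lambda>t. b t \<bullet> p t) =
      integral {0..T} (\<lambda>s. b s \<bullet> integral {s..T} a) + (\<Sum>k\<in>I. integral {0..\<tau> k} b \<bullet> v k)"
    by (rule integral_unique)
  have 3: "(\<Sum>k\<in>I. v k \<bullet> x (\<tau> k)) = (\<Sum>k\<in>I. v k) \<bullet> x0 + (\<Sum>k\<in>I. integral {0..\<tau> k} b \<bullet> v k)"
    unfolding inner_sum_left sum.distrib[symmetric]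
    by (intro sum.cong refl) (simp add: x[OF \<tau>] inner_add_right inner_commute)
  show ?thesis unfolding 1 2 3 p0 by (simp add: inner_add_left)
qed

section \<open>Perturbation of the flow\<close>

definition loc_bounded_deriv :: "('a::real_normed_vector \<Rightarrow> 'b::real_normed_vector) \<Rightarrow> ('a \<Rightarrow> 'a \<Rightarrow>\<^sub>L 'b) \<Rightarrow> bool" where
  "loc_bounded_deriv f f' \<longleftrightarrow> (\<forall>x. (f has_derivative blinfun_apply (f' x)) (at x)) \<and>
     (\<forall>R. \<exists>B. \<forall>x. norm x \<le> R \<longrightarrow> norm (f' x) \<le> B)"

lemma loc_bounded_deriv_has_derivative:
  "loc_bounded_deriv f f' \<Longrightarrow> (f has_derivative blinfun_apply (f' x)) (at x)"
  by (simp add: loc_bounded_deriv_def)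

lemma loc_bounded_deriv_continuous_on: "loc_bounded_deriv f f' \<Longrightarrow> continuous_on S f"
  by (meson continuous_at_imp_continuous_on has_derivative_continuous loc_bounded_deriv_has_derivative)

lemma loc_bounded_deriv_bound:
  assumes "loc_bounded_deriv f f'"
  obtains B where "B > 0" "\<And>x. norm x \<le> R \<Longrightarrow> norm (f' x) \<le> B"
proof -
  obtain B where "\<And>x. norm x \<le> R \<Longrightarrow> norm (f' x) \<le> B"
    using assms unfolding loc_bounded_deriv_def by blast
  then show thesis by (intro that[of "max B 1"]) (auto simp: le_max_iff_disj)
qed

text \<open>Balls are convex, so the mean value inequality turns the bound of the derivative into a
  Lipschitz constant. One \<open>B\<close> serves both purposes because estimates of Taylor
  remainders add the two bounds.\<close>

lemma loc_bounded_deriv_lipschitz: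
  assumes f: "loc_bounded_deriv f f'"
  obtains B where "B > 0" "\<And>x. norm x \<le> R \<Longrightarrow> norm (f' x) \<le> B"
    "\<And>x y. norm x \<le> R \<Longrightarrow> norm y \<le> R \<Longrightarrow> norm (f x - f y) \<le> B * norm (x - y)"
proof -
  obtain B where B: "B > 0" "\<And>x. norm x \<le> R \<Longrightarrow> norm (f' x) \<le> B"
    by (rule loc_bounded_deriv_bound[OF f, of R]) (rule that)
  have "norm (f x - f y) \<le> B * norm (x - y)" if xy: "norm x \<le> R" "norm y \<le> R" for x y
  proof (rule differentiable_bound[of "cball 0 R" f "\<lambda>x. blinfun_apply (f' x)"])
    show "(f has_derivative blinfun_apply (f' x)) (at x within cball 0 R)" for x
      by (rule has_derivative_at_withinI[OF loc_bounded_deriv_has_derivative[OF f]])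
    show "onorm (blinfun_apply (f' x)) \<le> B" if "x \<in> cball 0 R" for x
      using B(2)[of x] that by (simp add: norm_blinfun.rep_eq)
  qed (use xy in auto)
  with B show thesis using that by blast
qed

lemma continuous_on_Icc_norm_bound:
  fixes f :: "real \<Rightarrow> 'a::real_normed_vector"
  assumes "continuous_on {a..b} f"
  obtains R where "\<And>s. s \<in> {a..b} \<Longrightarrow> norm (f s) \<le> R"
proof -
  have "bounded (f ` {a..b})"
    by (intro compact_imp_bounded compact_continuous_image assms) simp
  then show thesis using that unfolding bounded_iff by blast
qed

text \<open>Links derivatives in the parameter, which obey sum and chain rules, with limits of
  quotients, to which dominated convergence applies.\<close>

lemma has_vector_derivative_iff_quotient:
  fixes g :: "real \<Rightarrow> 'a::real_normed_vector"
  shows "(g has_vector_derivative D) (at x) \<longleftrightarrow> ((\<lambda>h. (1 / h) *\<^sub>R (g (x + h) - g x)) \<longlongrightarrow> D) (at 0)"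
proof -
  have "(g has_vector_derivative D) (at x) \<longleftrightarrow>
      ((\<lambda>h. norm (g (x + h) - g x - h *\<^sub>R D) / norm h) \<longlongrightarrow> 0) (at 0)"
    unfolding has_vector_derivative_def has_derivative_at by (simp add: bounded_linear_scaleR_left)
  also have "\<dots> \<longleftrightarrow> ((\<lambda>h. norm ((1 / h) *\<^sub>R (g (x + h) - g x) - D)) \<longlongrightarrow> 0) (at 0)"
  proof (rule filterlim_cong[OF refl refl])
    show "\<forall>\<^sub>F h in at 0. norm (g (x + h) - g x - h *\<^sub>R D) / norm h = norm ((1 / h) *\<^sub>R (g (x + h) - g x) - D)"
      unfolding eventually_at_filter
    proof (intro always_eventually allI impI)
      fix h :: real assume "h \<noteq> 0"
      then have "(1 / h) *\<^sub>R (g (x + h) - g x) - D = (1 / h) *\<^sub>R (g (x + h) - g x - h *\<^sub>R D)"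
        by (simp add: scaleR_diff_right)
      then show "norm (g (x + h) - g x - h *\<^sub>R D) / norm h = norm ((1 / h) *\<^sub>R (g (x + h) - g x) - D)"
        by (simp add: divide_inverse)
    qed
  qed
  also have "\<dots> \<longleftrightarrow> ((\<lambda>h. (1 / h) *\<^sub>R (g (x + h) - g x)) \<longlongrightarrow> D) (at 0)"
    by (simp add: tendsto_norm_zero_iff LIM_zero_iff)
  finally show ?thesis .
qed

lemma has_vector_derivative_line:
  assumes "(F has_derivative F') (at x)"
  shows "((\<lambda>h. F (x + h *\<^sub>R v)) has_vector_derivative F' v) (at 0)"
proof -
  interpret bounded_linear F' using assms by (rule has_derivative_bounded_linear)
  have l: "((\<lambda>h. x + h *\<^sub>R v) has_derivative (\<lambda>h. h *\<^sub>R v)) (at 0)"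
    by (auto intro!: derivative_eq_intros)
  have "((\<lambda>h. F (x + h *\<^sub>R v)) has_derivative (\<lambda>h. F' (h *\<^sub>R v))) (at 0)"
    using has_derivative_compose[OF l, of F F'] assms by simp
  then show ?thesis by (simp add: has_vector_derivative_def scaleR)
qed

text \<open>\<open>F'\<close> may be discontinuous, so composition does not help. The value at
  \<open>s\<close> is the limit of the difference quotients of \<open>F\<close> at
  \<open>q s\<close> in direction \<open>v s\<close>, and for a fixed step size these are continuous
  in \<open>s\<close>.\<close>

lemma derivative_along_measurable:
  fixes F :: "'a::euclidean_space \<Rightarrow> 'b::euclidean_space"
  assumes F: "\<And>x. (F has_derivative blinfun_apply (F' x)) (at x)"
    and q: "continuous_on {a..b} q" and v: "continuous_on {a..b} v"
  shows "(\<lambda>s. blinfun_apply (F' (q s)) (v s)) \<in> borel_measurable (lebesgue_on {a..b::real})"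
proof (rule borel_measurable_LIMSEQ_metric)
  define \<eta> where "\<eta> n = inverse (real (Suc n))" for n
  let ?f = "\<lambda>n s. (1 / \<eta> n) *\<^sub>R (F (q s + \<eta> n *\<^sub>R v s) - F (q s))"
  have FC: "continuous_on UNIV F"
    by (meson F continuous_at_imp_continuous_on has_derivative_continuous)
  show "?f n \<in> borel_measurable (lebesgue_on {a..b})" for n
    by (intro continuous_imp_measurable_on_sets_lebesgue continuous_intros
        continuous_on_compose2[OF FC] q v) auto
  have \<eta>: "filterlim \<eta> (at 0) sequentially"
    unfolding filterlim_at using LIMSEQ_inverse_real_of_nat by (simp add: \<eta>_def[abs_def])
  fix s
  have "((\<lambda>h. (1 / h) *\<^sub>R (F (q s + h *\<^sub>R v s) - F (q s))) \<longlongrightarrow> F' (q s) (v s)) (at 0)"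
    using has_vector_derivative_line[OF F, of "q s" "v s"] by (simp add: has_vector_derivative_iff_quotient)
  then show "(\<lambda>n. ?f n s) \<longlonglongrightarrow> F' (q s) (v s)"
    by (rule filterlim_compose[OF _ \<eta>])
qed

text \<open>The control system stripped of its Hamiltonian origin: a field \<open>F\<close> with the
  forcing \<open>w\<close> and its perturbation \<open>dw\<close>. The equations are in integral
  form because the forcing is merely integrable in time.\<close>

locale perturbed_flow =
  fixes F :: "'a::euclidean_space \<Rightarrow> 'a" and F' :: "'a \<Rightarrow> 'a \<Rightarrow>\<^sub>L 'a"
    and w dw :: "real \<Rightarrow> 'a" and T :: real and q :: "real \<Rightarrow> real \<Rightarrow> 'a" and q0 dq0 :: 'a
    and dq :: "real \<Rightarrow> 'a"
  assumes T: "T \<ge> 0"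
    and F: "loc_bounded_deriv F F'"
    and w: "w absolutely_integrable_on {0..T}" and dw: "dw absolutely_integrable_on {0..T}"
    and q_cont: "\<And>\<epsilon>. continuous_on {0..T} (q \<epsilon>)"
    and q_eq: "\<And>\<epsilon> t. t \<in> {0..T} \<Longrightarrow>
      q \<epsilon> t = q0 + \<epsilon> *\<^sub>R dq0 + integral {0..t} (\<lambda>s. F (q \<epsilon> s) + (w s + \<epsilon> *\<^sub>R dw s))"
    and dq_cont: "continuous_on {0..T} dq"
    and dq_eq: "\<And>t. t \<in> {0..T} \<Longrightarrow>
      dq t = dq0 + integral {0..t} (\<lambda>s. F' (q 0 s) (dq s) + dw s)"
begin

lemma Fq_cont: "continuous_on {0..T} (\<lambda>s. F (q \<epsilon> s))"
  by (rule continuous_on_compose2[OF loc_bounded_deriv_continuous_on[OF F, of UNIV] q_cont]) auto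

lemma sub_abs_integrable:
  fixes f :: "real \<Rightarrow> 'b::euclidean_space"
  assumes "f absolutely_integrable_on {0..T}" "t \<in> {0..T}"
  shows "f absolutely_integrable_on {0..t}"
  using absolutely_integrable_on_subinterval[OF assms(1), of 0 t] assms(2) by auto

lemma sub_integrable:
  fixes f :: "real \<Rightarrow> 'b::euclidean_space"
  assumes "f integrable_on {0..T}" "t \<in> {0..T}"
  shows "f integrable_on {0..t}"
  using integrable_subinterval_real[OF assms(1), of 0 t] assms(2) by auto

lemma integral_mono_upper:
  fixes f :: "real \<Rightarrow> real"
  assumes "f integrable_on {0..T}" "t \<in> {0..T}" "\<And>s. s \<in> {0..T} \<Longrightarrow> 0 \<le> f s"
  shows "integral {0..t} f \<le> integral {0..T} f"
  using assms by (intro integral_subset_le sub_integrable[OF assms(1)]) auto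

lemma dw_int: "dw integrable_on {0..T}"
  using dw by (rule set_lebesgue_integral_eq_integral(1))

lemma w_int: "w integrable_on {0..T}"
  using w by (rule set_lebesgue_integral_eq_integral(1))

lemma norm_dw_int: "(\<lambda>s. norm (dw s)) integrable_on {0..T}"
  using dw by (simp add: absolutely_integrable_on_def)

lemma F'_along_int:
  assumes v: "continuous_on {0..T} v"
  shows "(\<lambda>s. F' (q 0 s) (v s)) absolutely_integrable_on {0..T}"
proof -
  obtain R where R: "\<And>s. s \<in> {0..T} \<Longrightarrow> norm (q 0 s) \<le> R"
    using continuous_on_Icc_norm_bound[OF q_cont[of 0]] by blast
  obtain V where V: "\<And>s. s \<in> {0..T} \<Longrightarrow> norm (v s) \<le> V"
    using continuous_on_Icc_norm_bound[OF v] by blast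
  obtain B where B: "B > 0" "\<And>x. norm x \<le> R \<Longrightarrow> norm (F' x) \<le> B"
    by (rule loc_bounded_deriv_bound[OF F, of R]) (rule that)
  show ?thesis
  proof (rule measurable_bounded_by_integrable_imp_absolutely_integrable)
    show "(\<lambda>s. F' (q 0 s) (v s)) \<in> borel_measurable (lebesgue_on {0..T})"
      by (rule derivative_along_measurable[OF loc_bounded_deriv_has_derivative[OF F] q_cont v])
    show "norm (F' (q 0 s) (v s)) \<le> B * V" if "s \<in> {0..T}" for s
      using norm_blinfun[of "F' (q 0 s)" "v s"] mult_mono[OF B(2)[OF R[OF that]] V[OF that]] B(1)
      by simp
  qed auto
qed

text \<open>The forcing \<open>w\<close> cancels since it does not depend on the state, which leaves
  a difference of \<open>F\<close> for Lipschitz and Taylor estimates.\<close>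

lemma diff_eq:
  assumes t: "t \<in> {0..T}"
  shows "q \<epsilon> t - q 0 t = \<epsilon> *\<^sub>R dq0 + integral {0..t} (\<lambda>s. F (q \<epsilon> s) - F (q 0 s) + \<epsilon> *\<^sub>R dw s)"
proof -
  have i: "(\<lambda>s. F (q \<epsilon> s) + (w s + \<epsilon> *\<^sub>R dw s)) integrable_on {0..t}" for \<epsilon>
    by (intro integrable_add integrable_cmul sub_integrable[OF _ t] w_int dw_int
        integrable_continuous_real Fq_cont)
  have "integral {0..t} (\<lambda>s. F (q \<epsilon> s) + (w s + \<epsilon> *\<^sub>R dw s)) -
      integral {0..t} (\<lambda>s. F (q 0 s) + (w s + 0 *\<^sub>R dw s)) =
      integral {0..t} (\<lambda>s. F (q \<epsilon> s) - F (q 0 s) + \<epsilon> *\<^sub>R dw s)"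
    unfolding Henstock_Kurzweil_Integration.integral_diff[OF i i, symmetric]
    by (intro Henstock_Kurzweil_Integration.integral_cong) simp
  then show ?thesis unfolding q_eq[OF t, of \<epsilon>] q_eq[OF t, of 0] by (simp add: algebra_simps)
qed

text \<open>The Lipschitz constant of \<open>F\<close> is taken on the ball of radius
  \<open>R + 1\<close>, which \<open>q \<epsilon>\<close> might leave. While the distance to
  \<open>q 0\<close> is at most 1, Gronwall's inequality bounds it by
  \<open>C * \<bar>\<epsilon>\<bar>\<close>, which is below 1 for small \<epsilon>; hence the
  distance never reaches 1. The clause \<open>C * \<delta> \<le> 1\<close> lets later estimates work
  in the same ball.\<close>

lemma flow_lipschitz:
  obtains C \<delta> where "C \<ge> 0" "\<delta> > 0"
    "\<And>\<epsilon> t. \<bar>\<epsilon>\<bar> < \<delta> \<Longrightarrow> t \<in> {0..T} \<Longrightarrow> norm (q \<epsilon> t - q 0 t) \<le> C * \<bar>\<epsilon>\<bar>"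
    "C * \<delta> \<le> 1"
proof -
  obtain R where R: "\<And>s. s \<in> {0..T} \<Longrightarrow> norm (q 0 s) \<le> R"
    using continuous_on_Icc_norm_bound[OF q_cont[of 0]] by blast
  obtain L where L: "L > 0" "\<And>x. norm x \<le> R + 1 \<Longrightarrow> norm (F' x) \<le> L"
    "\<And>x y. norm x \<le> R + 1 \<Longrightarrow> norm y \<le> R + 1 \<Longrightarrow> norm (F x - F y) \<le> L * norm (x - y)"
    by (rule loc_bounded_deriv_lipschitz[OF F, of "R + 1"]) (rule that)
  define A where "A = norm dq0 + integral {0..T} (\<lambda>s. norm (dw s))"
  \<comment> \<open>The constant of \<open>gronwall\<close> on \<open>{0..T}\<close> with initial
    term \<open>\<bar>\<epsilon>\<bar> * A\<close>, where \<open>A\<close> measures the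
    perturbations of the initial value and of the forcing.\<close>
  define C where "C = 2 * A * exp (2 * L * T)"
  have A: "A \<ge> 0" unfolding A_def
    by (intro add_nonneg_nonneg Henstock_Kurzweil_Integration.integral_nonneg norm_dw_int) auto
  have C: "C \<ge> 0" "A \<le> C" unfolding C_def using A T L(1) mult_mono[of A "2 * A" 1 "exp (2 * L * T)"] by auto
  define \<phi> where "\<phi> \<epsilon> t = norm (q \<epsilon> t - q 0 t)" for \<epsilon> t
  have \<phi>c: "continuous_on {0..T} (\<phi> \<epsilon>)" for \<epsilon>
    unfolding \<phi>_def by (intro continuous_intros q_cont)
  have local: "\<phi> \<epsilon> \<tau> \<le> C * \<bar>\<epsilon>\<bar>" if \<tau>: "\<tau> \<in> {0..T}" and small: "\<And>s. s \<in> {0..\<tau>} \<Longrightarrow> \<phi> \<epsilon> s \<le> 1" for \<epsilon> \<tau>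
  proof -
    have c\<tau>: "continuous_on {0..\<tau>} (\<phi> \<epsilon>)"
      by (rule continuous_on_subset[OF \<phi>c]) (use \<tau> in auto)
    have "\<phi> \<epsilon> \<tau> \<le> 2 * (\<bar>\<epsilon>\<bar> * A) * exp (2 * L * \<tau>)"
    proof (rule gronwall[OF c\<tau> L(1)])
      fix t assume t': "t \<in> {0..\<tau>}"
      then have t: "t \<in> {0..T}" using \<tau> by auto
      have \<phi>i: "\<phi> \<epsilon> integrable_on {0..t}"
        by (intro sub_integrable[OF _ t] integrable_continuous_real \<phi>c)
      have ni: "(\<lambda>s. norm (dw s)) integrable_on {0..t}"
        by (rule sub_integrable[OF norm_dw_int t])
      have "norm (integral {0..t} (\<lambda>s. F (q \<epsilon> s) - F (q 0 s) + \<epsilon> *\<^sub>R dw s))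
          \<le> integral {0..t} (\<lambda>s. L * \<phi> \<epsilon> s + \<bar>\<epsilon>\<bar> * norm (dw s))"
      proof (rule integral_norm_bound_integral)
        show "(\<lambda>s. F (q \<epsilon> s) - F (q 0 s) + \<epsilon> *\<^sub>R dw s) integrable_on {0..t}"
          by (intro integrable_add integrable_diff integrable_cmul sub_integrable[OF _ t] dw_int
            integrable_continuous_real Fq_cont)
        show "(\<lambda>s. L * \<phi> \<epsilon> s + \<bar>\<epsilon>\<bar> * norm (dw s)) integrable_on {0..t}"
          by (intro integrable_add integrable_on_mult_right \<phi>i ni)
        fix s assume s: "s \<in> {0..t}"
        have "norm (q 0 s) \<le> R + 1" using R[of s] s t by auto
        moreover have "norm (q \<epsilon> s) \<le> R + 1"
          using small[of s] R[of s] s t t' norm_triangle_ineq[of "q \<epsilon> s - q 0 s" "q 0 s"]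
          by (auto simp: \<phi>_def)
        ultimately have "norm (F (q \<epsilon> s) - F (q 0 s)) \<le> L * \<phi> \<epsilon> s"
          unfolding \<phi>_def by (intro L(3))
        then show "norm (F (q \<epsilon> s) - F (q 0 s) + \<epsilon> *\<^sub>R dw s) \<le> L * \<phi> \<epsilon> s + \<bar>\<epsilon>\<bar> * norm (dw s)"
          using norm_triangle_ineq[of "F (q \<epsilon> s) - F (q 0 s)" "\<epsilon> *\<^sub>R dw s"] by simp
      qed
      also have "\<dots> = L * integral {0..t} (\<phi> \<epsilon>) + \<bar>\<epsilon>\<bar> * integral {0..t} (\<lambda>s. norm (dw s))"
        by (subst Henstock_Kurzweil_Integration.integral_add)
          (auto intro!: integrable_on_mult_right \<phi>i ni)
      also have "\<dots> \<le> L * integral {0..t} (\<phi> \<epsilon>) + \<bar>\<epsilon>\<bar> * integral {0..T} (\<lambda>s. norm (dw s))"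
        by (intro add_left_mono mult_left_mono integral_mono_upper[OF norm_dw_int t]) auto
      finally show "\<phi> \<epsilon> t \<le> \<bar>\<epsilon>\<bar> * A + L * integral {0..t} (\<phi> \<epsilon>)"
        unfolding \<phi>_def diff_eq[OF t, of \<epsilon>] A_def
        using norm_triangle_ineq[of "\<epsilon> *\<^sub>R dq0" "integral {0..t} (\<lambda>s. F (q \<epsilon> s) - F (q 0 s) + \<epsilon> *\<^sub>R dw s)"]
        by (simp add: algebra_simps)
    qed (use \<tau> A in auto)
    also have "\<dots> \<le> 2 * (\<bar>\<epsilon>\<bar> * A) * exp (2 * L * T)"
      using A L(1) \<tau> by (intro mult_left_mono) auto
    finally show ?thesis by (simp add: C_def algebra_simps)
  qed
  define \<delta> where "\<delta> = 1 / (C + 1)"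
  have \<delta>: "\<delta> > 0" "C * \<delta> \<le> 1" using C by (auto simp: \<delta>_def)
  have "\<phi> \<epsilon> t \<le> C * \<bar>\<epsilon>\<bar>" if \<epsilon>: "\<bar>\<epsilon>\<bar> < \<delta>" and t: "t \<in> {0..T}" for \<epsilon> t
  proof (rule local[OF t], rule ccontr)
    fix s assume s: "s \<in> {0..t}" and "\<not> \<phi> \<epsilon> s \<le> 1"
    then have s1: "\<phi> \<epsilon> s > 1" by simp
    have C1: "C * \<bar>\<epsilon>\<bar> < 1"
    proof (cases "C = 0")
      case False
      then have "C * \<bar>\<epsilon>\<bar> < C * \<delta>" using \<epsilon> C(1) by simp
      then show ?thesis using \<delta>(2) by simp
    qed simp
    have cs: "continuous_on {0..s} (\<phi> \<epsilon>)"
      by (rule continuous_on_subset[OF \<phi>c]) (use s t in auto)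
    have z: "\<phi> \<epsilon> 0 \<le> 1"
    proof -
      have "\<phi> \<epsilon> 0 = \<bar>\<epsilon>\<bar> * norm dq0" unfolding \<phi>_def using diff_eq[of 0 \<epsilon>] T by simp
      also have "\<dots> \<le> \<bar>\<epsilon>\<bar> * C"
        using Henstock_Kurzweil_Integration.integral_nonneg[OF norm_dw_int] C(2) A_def
        by (intro mult_left_mono) auto
      finally show ?thesis using C1 by (simp add: mult.commute)
    qed
    \<comment> \<open>The times at which the distance equals 1: a compact set, nonempty by the
      intermediate value theorem. Before its least element the distance cannot exceed 1, as it would
      have crossed 1 earlier, so the conditional estimate applies there and yields a value below
      1.\<close>
    let ?Z = "{x \<in> {0..s}. \<phi> \<epsilon> x = 1}"
    have "?Z \<noteq> {}"
      using IVT'[of "\<phi> \<epsilon>" 0 1 s] z s1 s cs by auto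
    moreover have "compact ?Z"
      using continuous_closed_preimage_constant[OF cs, of 1]
      by (metis (no_types, lifting) bounded_closed_interval bounded_subset closed_atLeastAtMost compact_eq_bounded_closed mem_Collect_eq subsetI)
    ultimately obtain x where x: "x \<in> ?Z" and xmin: "\<And>y. y \<in> ?Z \<Longrightarrow> x \<le> y"
      using compact_attains_inf[of ?Z] by blast
    have "\<phi> \<epsilon> x \<le> C * \<bar>\<epsilon>\<bar>"
    proof (rule local)
      show "x \<in> {0..T}" using x s t by auto
      fix y assume y: "y \<in> {0..x}"
      show "\<phi> \<epsilon> y \<le> 1"
      proof (rule ccontr)
        assume y1: "\<not> \<phi> \<epsilon> y \<le> 1"
        have "continuous_on {0..y} (\<phi> \<epsilon>)"
          by (rule continuous_on_subset[OF cs]) (use x y in auto)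
        then obtain z where z: "0 \<le> z" "z \<le> y" "\<phi> \<epsilon> z = 1"
          using IVT'[of "\<phi> \<epsilon>" 0 1 y] z y1 y by auto
        then have "x \<le> z" using xmin[of z] x y by auto
        with z y have "y = z" using y by auto
        then show False using z y1 by simp
      qed
    qed
    then show False using x C1 by simp
  qed
  then show thesis using that[of C \<delta>] C \<delta> unfolding \<phi>_def by blast
qed


lemma flow_differentiable:
  assumes t: "t \<in> {0..T}"
  shows "((\<lambda>\<epsilon>. q \<epsilon> t) has_vector_derivative dq t) (at 0)"
proof -
  obtain C \<delta> where C: "C \<ge> 0" and \<delta>: "\<delta> > 0"
    and lip: "\<And>\<epsilon> t. \<bar>\<epsilon>\<bar> < \<delta> \<Longrightarrow> t \<in> {0..T} \<Longrightarrow> norm (q \<epsilon> t - q 0 t) \<le> C * \<bar>\<epsilon>\<bar>"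
    and C\<delta>: "C * \<delta> \<le> 1"
    by (rule flow_lipschitz) (rule that)
  obtain R where R: "\<And>s. s \<in> {0..T} \<Longrightarrow> norm (q 0 s) \<le> R"
    using continuous_on_Icc_norm_bound[OF q_cont[of 0]] by blast
  obtain L where L: "L > 0" "\<And>x. norm x \<le> R + 1 \<Longrightarrow> norm (F' x) \<le> L"
    "\<And>x y. norm x \<le> R + 1 \<Longrightarrow> norm y \<le> R + 1 \<Longrightarrow> norm (F x - F y) \<le> L * norm (x - y)"
    by (rule loc_bounded_deriv_lipschitz[OF F, of "R + 1"]) (rule that)
  have F'L: "norm (F' (q 0 s) v) \<le> L * norm v" if "s \<in> {0..T}" for s v
    using norm_blinfun[of "F' (q 0 s)" v] mult_right_mono[OF L(2)[of "q 0 s"], of "norm v"] R[OF that]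
    by simp
  \<comment> \<open>\<open>\<rho>\<close> is the Taylor remainder of \<open>F\<close> at
    \<open>q 0 s\<close>, and \<open>r\<close> the first-order error of the flow. The error solves
    the linearised equation with source \<open>\<rho>\<close> and initial value 0, so Gronwall's
    inequality bounds it by the integral of \<open>norm (\<rho> \<epsilon> s)\<close>.\<close>
  define \<rho> where "\<rho> \<epsilon> s = F (q \<epsilon> s) - F (q 0 s) - F' (q 0 s) (q \<epsilon> s - q 0 s)" for \<epsilon> s
  define r where "r \<epsilon> s = q \<epsilon> s - q 0 s - \<epsilon> *\<^sub>R dq s" for \<epsilon> s
  have rc: "continuous_on {0..T} (r \<epsilon>)" for \<epsilon>
    unfolding r_def by (intro continuous_intros q_cont dq_cont)
  have \<rho>ai: "\<rho> \<epsilon> absolutely_integrable_on {0..T}" for \<epsilon>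
    unfolding \<rho>_def
    by (intro set_integral_diff(1) F'_along_int absolutely_integrable_continuous_real Fq_cont
        continuous_intros q_cont)
  have n\<rho>: "(\<lambda>s. norm (\<rho> \<epsilon> s)) integrable_on {0..T}" for \<epsilon>
    using \<rho>ai by (simp add: absolutely_integrable_on_def)
  define I where "I \<epsilon> = integral {0..T} (\<lambda>s. norm (\<rho> \<epsilon> s))" for \<epsilon>
  have rI: "norm (r \<epsilon> t) \<le> 2 * I \<epsilon> * exp (2 * L * t)" for \<epsilon>
  proof (rule gronwall[OF _ L(1) _ t, of "\<lambda>s. norm (r \<epsilon> s)"])
    show "continuous_on {0..T} (\<lambda>s. norm (r \<epsilon> s))" by (intro continuous_intros rc)
    show "0 \<le> I \<epsilon>" unfolding I_def by (intro Henstock_Kurzweil_Integration.integral_nonneg n\<rho>) auto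
    fix t assume t: "t \<in> {0..T}"
    have ni: "(\<lambda>s. norm (\<rho> \<epsilon> s)) integrable_on {0..t}" by (rule sub_integrable[OF n\<rho> t])
    have ri: "(\<lambda>s. norm (r \<epsilon> s)) integrable_on {0..t}"
      by (intro sub_integrable[OF _ t] integrable_continuous_real continuous_intros rc)
    have i1: "(\<lambda>s. F (q \<epsilon> s) - F (q 0 s) + \<epsilon> *\<^sub>R dw s) integrable_on {0..t}"
      by (intro integrable_add integrable_diff integrable_cmul sub_integrable[OF _ t] dw_int
            integrable_continuous_real Fq_cont)
    have i2: "(\<lambda>s. F' (q 0 s) (dq s) + dw s) integrable_on {0..t}"
      by (intro integrable_add sub_integrable[OF _ t] dw_int
          set_lebesgue_integral_eq_integral(1) F'_along_int dq_cont)
    have i3: "(\<lambda>s. \<rho> \<epsilon> s + F' (q 0 s) (r \<epsilon> s)) integrable_on {0..t}"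
      by (intro integrable_add sub_integrable[OF _ t]
          set_lebesgue_integral_eq_integral(1) F'_along_int rc \<rho>ai)
    have "r \<epsilon> t = integral {0..t} (\<lambda>s. F (q \<epsilon> s) - F (q 0 s) + \<epsilon> *\<^sub>R dw s)
        - \<epsilon> *\<^sub>R integral {0..t} (\<lambda>s. F' (q 0 s) (dq s) + dw s)"
      unfolding r_def diff_eq[OF t] dq_eq[OF t] by (simp add: algebra_simps)
    also have "\<dots> = integral {0..t} (\<lambda>s. F (q \<epsilon> s) - F (q 0 s) + \<epsilon> *\<^sub>R dw s
        - \<epsilon> *\<^sub>R (F' (q 0 s) (dq s) + dw s))"
      by (simp only: Henstock_Kurzweil_Integration.integral_cmul[symmetric]
          Henstock_Kurzweil_Integration.integral_diff[OF i1 integrable_cmul[OF i2]])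
    also have "\<dots> = integral {0..t} (\<lambda>s. \<rho> \<epsilon> s + F' (q 0 s) (r \<epsilon> s))"
      by (intro Henstock_Kurzweil_Integration.integral_cong)
        (simp add: \<rho>_def r_def blinfun.diff_right blinfun.scaleR_right scaleR_add_right)
    also have "norm \<dots> \<le> integral {0..t} (\<lambda>s. norm (\<rho> \<epsilon> s) + L * norm (r \<epsilon> s))"
    proof (rule integral_norm_bound_integral[OF i3])
      show "(\<lambda>s. norm (\<rho> \<epsilon> s) + L * norm (r \<epsilon> s)) integrable_on {0..t}"
        by (intro integrable_add integrable_on_mult_right ni ri)
      show "norm (\<rho> \<epsilon> s + F' (q 0 s) (r \<epsilon> s)) \<le> norm (\<rho> \<epsilon> s) + L * norm (r \<epsilon> s)"
        if "s \<in> {0..t}" for s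
        using F'L[of s "r \<epsilon> s"] that t norm_triangle_ineq[of "\<rho> \<epsilon> s" "F' (q 0 s) (r \<epsilon> s)"]
        by auto
    qed
    also have "\<dots> = integral {0..t} (\<lambda>s. norm (\<rho> \<epsilon> s)) + L * integral {0..t} (\<lambda>s. norm (r \<epsilon> s))"
      by (subst Henstock_Kurzweil_Integration.integral_add)
        (auto intro!: integrable_on_mult_right ni ri)
    also have "integral {0..t} (\<lambda>s. norm (\<rho> \<epsilon> s)) \<le> I \<epsilon>"
      unfolding I_def by (intro integral_mono_upper[OF n\<rho> t]) auto
    finally show "norm (r \<epsilon> t) \<le> I \<epsilon> + L * integral {0..t} (\<lambda>s. norm (r \<epsilon> s))" by simp
  qed
  have "((\<lambda>\<epsilon>. integral {0..T} (\<lambda>s. norm (\<rho> \<epsilon> s) / \<bar>\<epsilon>\<bar>)) \<longlongrightarrow> integral {0..T} (\<lambda>s. 0 :: real)) (at 0)"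
  proof (rule dominated_convergence_at[OF _ \<delta>])
    show "(\<lambda>s. norm (\<rho> \<epsilon> s) / \<bar>\<epsilon>\<bar>) \<in> borel_measurable (lebesgue_on {0..T})" for \<epsilon>
      using integrable_imp_measurable[OF n\<rho>] by measurable
    \<comment> \<open>One \<open>L\<close> comes from the increment of \<open>F\<close>, the other
      from its derivative applied to the increment of \<open>q\<close>, and \<open>C\<close> from
      the Lipschitz estimate of the flow.\<close>
    show "(\<lambda>s. 2 * L * C) integrable_on {0..T}"
      by (intro integrable_continuous_real continuous_on_const)
    show "norm (norm (\<rho> \<epsilon> s) / \<bar>\<epsilon>\<bar>) \<le> 2 * L * C"
      if \<epsilon>: "0 < \<bar>\<epsilon>\<bar>" "\<bar>\<epsilon>\<bar> < \<delta>" and s: "s \<in> {0..T}" for \<epsilon> s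
    proof -
      have d: "norm (q \<epsilon> s - q 0 s) \<le> C * \<bar>\<epsilon>\<bar>" by (rule lip[OF \<epsilon>(2) s])
      also have "\<dots> \<le> C * \<delta>" using \<epsilon> C by (intro mult_left_mono) auto
      finally have "norm (q \<epsilon> s) \<le> R + 1"
        using C\<delta> R[OF s] norm_triangle_ineq[of "q \<epsilon> s - q 0 s" "q 0 s"] by simp
      then have "norm (F (q \<epsilon> s) - F (q 0 s)) \<le> L * norm (q \<epsilon> s - q 0 s)"
        using R[OF s] by (intro L(3)) auto
      then have "norm (\<rho> \<epsilon> s) \<le> 2 * L * norm (q \<epsilon> s - q 0 s)"
        unfolding \<rho>_def using F'L[OF s, of "q \<epsilon> s - q 0 s"]
          norm_triangle_ineq4[of "F (q \<epsilon> s) - F (q 0 s)" "F' (q 0 s) (q \<epsilon> s - q 0 s)"] by linarith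
      also have "\<dots> \<le> 2 * L * (C * \<bar>\<epsilon>\<bar>)" using d L(1) by (intro mult_left_mono) auto
      finally show ?thesis using \<epsilon> by (simp add: divide_le_eq mult.assoc)
    qed
    show "((\<lambda>\<epsilon>. norm (\<rho> \<epsilon> s) / \<bar>\<epsilon>\<bar>) \<longlongrightarrow> 0) (at 0)" if s: "s \<in> {0..T}" for s
    proof (rule tendstoI)
      fix e :: real assume e: "e > 0"
      \<comment> \<open>Gives \<open>e' * C < e\<close>, also when \<open>C = 0\<close>. The factor
        \<open>C\<close> converts smallness relative to the displacement of \<open>q\<close> into
        smallness relative to \<epsilon>.\<close>
      define e' where "e' = e / (2 * (C + 1))"
      have e': "e' > 0" "e' * C < e" using e C by (auto simp: e'_def field_simps intro: add_nonneg_pos)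
      obtain d where d: "d > 0" "\<And>y. norm (y - q 0 s) < d \<Longrightarrow>
          norm (F y - F (q 0 s) - F' (q 0 s) (y - q 0 s)) \<le> e' * norm (y - q 0 s)"
        using loc_bounded_deriv_has_derivative[OF F, of "q 0 s"] e'(1)
        unfolding has_derivative_at_alt by blast
      have "dist (norm (\<rho> \<epsilon> s) / \<bar>\<epsilon>\<bar>) 0 < e" if \<epsilon>: "\<epsilon> \<noteq> 0" "\<bar>\<epsilon>\<bar> < \<delta>" "\<bar>\<epsilon>\<bar> < d / (C + 1)" for \<epsilon>
      proof -
        have l: "norm (q \<epsilon> s - q 0 s) \<le> C * \<bar>\<epsilon>\<bar>" by (rule lip[OF \<epsilon>(2) s])
        have "(C + 1) * \<bar>\<epsilon>\<bar> < d" using \<epsilon>(3) C by (simp add: field_simps)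
        then have "norm (q \<epsilon> s - q 0 s) < d" using l by (simp add: algebra_simps)
        from d(2)[OF this] have "norm (\<rho> \<epsilon> s) \<le> e' * norm (q \<epsilon> s - q 0 s)" by (simp add: \<rho>_def)
        also have "\<dots> \<le> e' * (C * \<bar>\<epsilon>\<bar>)" using l e' by (intro mult_left_mono) auto
        also have "\<dots> < e * \<bar>\<epsilon>\<bar>" using e'(2) \<epsilon>(1) by (simp add: mult.assoc[symmetric])
        finally show ?thesis using \<epsilon>(1) by (simp add: divide_less_eq)
      qed
      moreover have "min \<delta> (d / (C + 1)) > 0" using \<delta> d(1) C by simp
      ultimately show "\<forall>\<^sub>F \<epsilon> in at 0. dist (norm (\<rho> \<epsilon> s) / \<bar>\<epsilon>\<bar>) 0 < e"
        unfolding eventually_at by (intro exI[of _ "min \<delta> (d / (C + 1))"]) (auto simp: dist_real_def)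
    qed
  qed auto
  then have "((\<lambda>\<epsilon>. 2 * exp (2 * L * t) * (I \<epsilon> / \<bar>\<epsilon>\<bar>)) \<longlongrightarrow> 0) (at 0)"
    unfolding I_def by (intro tendsto_mult_right_zero) simp
  then have "((\<lambda>\<epsilon>. (1 / \<epsilon>) *\<^sub>R (q (0 + \<epsilon>) t - q 0 t) - dq t) \<longlongrightarrow> 0) (at 0)"
  proof (rule Lim_null_comparison[rotated])
    have "norm ((1 / \<epsilon>) *\<^sub>R (q (0 + \<epsilon>) t - q 0 t) - dq t) \<le> 2 * exp (2 * L * t) * (I \<epsilon> / \<bar>\<epsilon>\<bar>)"
      if "\<epsilon> \<noteq> 0" for \<epsilon>
    proof -
      have "(1 / \<epsilon>) *\<^sub>R (q (0 + \<epsilon>) t - q 0 t) - dq t = (1 / \<epsilon>) *\<^sub>R r \<epsilon> t"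
        using that by (simp add: r_def scaleR_diff_right)
      then show ?thesis using rI[of \<epsilon>] that by (simp add: divide_right_mono field_simps)
    qed
    then show "\<forall>\<^sub>F \<epsilon> in at 0. norm ((1 / \<epsilon>) *\<^sub>R (q (0 + \<epsilon>) t - q 0 t) - dq t)
        \<le> 2 * exp (2 * L * t) * (I \<epsilon> / \<bar>\<epsilon>\<bar>)"
      by (auto simp: eventually_at_filter)
  qed
  then show ?thesis unfolding has_vector_derivative_iff_quotient by (simp add: LIM_zero_iff)
qed

end

section \<open>Functions with locally bounded derivative\<close>

text \<open>The derivative stays anonymous, so that sums, products and compositions can be treated
  by introduction rules. It is a plain function with a bound, which suits derivatives assembled from
  coordinates.\<close>

definition loc_bounded_diff :: "('a::real_normed_vector \<Rightarrow> 'b::real_normed_vector) \<Rightarrow> bool" where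
  "loc_bounded_diff f \<longleftrightarrow> (\<forall>R. \<exists>B\<ge>0. \<forall>x. norm x \<le> R \<longrightarrow>
     (\<exists>D. (f has_derivative D) (at x) \<and> (\<forall>h. norm (D h) \<le> B * norm h)))"

lemma loc_bounded_diff_imp_deriv:
  assumes "loc_bounded_diff f"
  shows "loc_bounded_deriv f (\<lambda>x. Blinfun (frechet_derivative f (at x)))"
proof -
  have d: "(f has_derivative frechet_derivative f (at x)) (at x)" for x
    using assms unfolding loc_bounded_diff_def
    by (metis differentiable_def frechet_derivative_works order_refl)
  then have B: "blinfun_apply (Blinfun (frechet_derivative f (at x))) = frechet_derivative f (at x)" for x
    by (intro bounded_linear_Blinfun_apply has_derivative_bounded_linear)
  have "\<exists>B. \<forall>x. norm x \<le> R \<longrightarrow> norm (Blinfun (frechet_derivative f (at x))) \<le> B" for R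
  proof -
    obtain B where "B \<ge> 0" and B': "\<And>x. norm x \<le> R \<Longrightarrow>
        \<exists>D. (f has_derivative D) (at x) \<and> (\<forall>h. norm (D h) \<le> B * norm h)"
      using assms unfolding loc_bounded_diff_def by blast
    have "norm (Blinfun (frechet_derivative f (at x))) \<le> B" if x: "norm x \<le> R" for x
    proof (rule norm_blinfun_bound[OF \<open>B \<ge> 0\<close>])
      obtain D where D: "(f has_derivative D) (at x)" "\<And>h. norm (D h) \<le> B * norm h"
        using B'[OF x] by blast
      have "frechet_derivative f (at x) = D" using frechet_derivative_at[OF D(1)] by simp
      then show "norm (blinfun_apply (Blinfun (frechet_derivative f (at x))) h) \<le> B * norm h" for h
        using D(2) B[of x] by simp
    qed
    then show ?thesis by blast
  qed
  then show ?thesis unfolding loc_bounded_deriv_def B using d by blast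
qed

lemma loc_bounded_diffI:
  assumes "\<And>x. (f has_derivative f' x) (at x)"
    and "\<And>R. \<exists>B. \<forall>x h. norm x \<le> R \<longrightarrow> norm (f' x h) \<le> B * norm h"
  shows "loc_bounded_diff f"
  unfolding loc_bounded_diff_def
proof
  fix R
  obtain B where B: "\<And>x h. norm x \<le> R \<Longrightarrow> norm (f' x h) \<le> B * norm h"
    using assms(2) by blast
  have "norm (f' x h) \<le> max B 0 * norm h" if "norm x \<le> R" for x h
    using B[OF that, of h] mult_right_mono[of B "max B 0" "norm h"] by simp
  then show "\<exists>B\<ge>0. \<forall>x. norm x \<le> R \<longrightarrow> (\<exists>D. (f has_derivative D) (at x) \<and> (\<forall>h. norm (D h) \<le> B * norm h))"
    using assms(1) by (intro exI[of _ "max B 0"]) auto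
qed

text \<open>The function itself is also bounded on balls, by comparison with its value at 0.
  Products need this bound as a factor, compositions as a radius.\<close>

lemma loc_bounded_diffE:
  assumes "loc_bounded_diff f"
  obtains f' where "\<And>x. (f has_derivative f' x) (at x)"
    and "\<And>R. \<exists>B\<ge>0. \<forall>x. norm x \<le> R \<longrightarrow> norm (f x) \<le> B \<and> (\<forall>h. norm (f' x h) \<le> B * norm h)"
proof -
  define f' where "f' x = Blinfun (frechet_derivative f (at x))" for x
  note f' = loc_bounded_diff_imp_deriv[OF assms, folded f'_def]
  have "\<exists>B\<ge>0. \<forall>x. norm x \<le> R \<longrightarrow> norm (f x) \<le> B \<and> (\<forall>h. norm (blinfun_apply (f' x) h) \<le> B * norm h)" for R
  proof -
    obtain B where B: "B > 0" "\<And>x. norm x \<le> \<bar>R\<bar> \<Longrightarrow> norm (f' x) \<le> B"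
      "\<And>x y. norm x \<le> \<bar>R\<bar> \<Longrightarrow> norm y \<le> \<bar>R\<bar> \<Longrightarrow> norm (f x - f y) \<le> B * norm (x - y)"
      by (rule loc_bounded_deriv_lipschitz[OF f', of "\<bar>R\<bar>"]) (rule that)
    define B' where "B' = max B (norm (f 0) + B * \<bar>R\<bar>)"
    have "norm (f x) \<le> B'" "norm (blinfun_apply (f' x) h) \<le> B' * norm h" if x: "norm x \<le> R" for x h
    proof -
      have xR: "norm x \<le> \<bar>R\<bar>" using x by linarith
      have "norm (f x) \<le> norm (f 0) + norm (f x - f 0)" by (metis norm_triangle_sub)
      also have "norm (f x - f 0) \<le> B * norm (x - 0)" using xR by (intro B(3)) auto
      also have "\<dots> \<le> B * \<bar>R\<bar>" using B(1) xR by (intro mult_left_mono) auto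
      finally show "norm (f x) \<le> B'" by (simp add: B'_def)
      have "norm (blinfun_apply (f' x) h) \<le> norm (f' x) * norm h" by (rule norm_blinfun)
      also have "\<dots> \<le> B' * norm h" using B(2)[OF xR] by (intro mult_right_mono) (auto simp: B'_def)
      finally show "norm (blinfun_apply (f' x) h) \<le> B' * norm h" .
    qed
    then show ?thesis using B(1) by (intro exI[of _ B']) (auto simp: B'_def)
  qed
  then show thesis using that[of "\<lambda>x. blinfun_apply (f' x)"] loc_bounded_deriv_has_derivative[OF f'] by blast
qed

lemma loc_bounded_diff_bounded_linear:
  assumes "bounded_linear f"
  shows "loc_bounded_diff f"
proof (rule loc_bounded_diffI[where f' = "\<lambda>x. f"])
  show "(f has_derivative f) (at x)" for x by (rule bounded_linear_imp_has_derivative[OF assms])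
  show "\<exists>B. \<forall>x h. norm x \<le> R \<longrightarrow> norm (f h) \<le> B * norm h" for R
    using bounded_linear.bounded[OF assms] by (metis mult.commute)
qed

lemma loc_bounded_diff_compose:
  assumes f: "loc_bounded_diff f" and g: "loc_bounded_diff g"
  shows "loc_bounded_diff (\<lambda>x. f (g x))"
proof -
  obtain f' where f': "\<And>x. (f has_derivative f' x) (at x)"
    "\<And>R. \<exists>B\<ge>0. \<forall>x. norm x \<le> R \<longrightarrow> norm (f x) \<le> B \<and> (\<forall>h. norm (f' x h) \<le> B * norm h)"
    by (rule loc_bounded_diffE[OF f]) (rule that)
  obtain g' where g': "\<And>x. (g has_derivative g' x) (at x)"
    "\<And>R. \<exists>B\<ge>0. \<forall>x. norm x \<le> R \<longrightarrow> norm (g x) \<le> B \<and> (\<forall>h. norm (g' x h) \<le> B * norm h)"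
    by (rule loc_bounded_diffE[OF g]) (rule that)
  show ?thesis
  proof (rule loc_bounded_diffI[where f' = "\<lambda>x h. f' (g x) (g' x h)"])
    show "((\<lambda>x. f (g x)) has_derivative (\<lambda>h. f' (g x) (g' x h))) (at x)" for x
      by (rule has_derivative_compose[OF g'(1) f'(1)])
    fix R
    obtain B where B: "B \<ge> 0" "\<And>x. norm x \<le> R \<Longrightarrow> norm (g x) \<le> B \<and> (\<forall>h. norm (g' x h) \<le> B * norm h)"
      using g'(2)[of R] by blast
    \<comment> \<open>The bound \<open>B\<close> of \<open>g\<close> is the radius of the ball on
      which \<open>f\<close> has to be controlled.\<close>
    obtain C where C: "C \<ge> 0" "\<And>x. norm x \<le> B \<Longrightarrow> norm (f x) \<le> C \<and> (\<forall>h. norm (f' x h) \<le> C * norm h)"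
      using f'(2)[of B] by blast
    have "norm (f' (g x) (g' x h)) \<le> C * B * norm h" if "norm x \<le> R" for x h
    proof -
      have "norm (f' (g x) (g' x h)) \<le> C * norm (g' x h)" using B(2)[OF that] C(2)[of "g x"] by blast
      also have "\<dots> \<le> C * (B * norm h)" using B(2)[OF that] C(1) by (intro mult_left_mono) auto
      finally show ?thesis by simp
    qed
    then show "\<exists>B. \<forall>x h. norm x \<le> R \<longrightarrow> norm (f' (g x) (g' x h)) \<le> B * norm h" by blast
  qed
qed

lemma loc_bounded_diff_bilinear:
  assumes p: "bounded_bilinear p" and f: "loc_bounded_diff f" and g: "loc_bounded_diff g"
  shows "loc_bounded_diff (\<lambda>x. p (f x) (g x))"
proof -
  interpret bounded_bilinear p by fact
  obtain f' where f': "\<And>x. (f has_derivative f' x) (at x)"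
    "\<And>R. \<exists>B\<ge>0. \<forall>x. norm x \<le> R \<longrightarrow> norm (f x) \<le> B \<and> (\<forall>h. norm (f' x h) \<le> B * norm h)"
    by (rule loc_bounded_diffE[OF f]) (rule that)
  obtain g' where g': "\<And>x. (g has_derivative g' x) (at x)"
    "\<And>R. \<exists>B\<ge>0. \<forall>x. norm x \<le> R \<longrightarrow> norm (g x) \<le> B \<and> (\<forall>h. norm (g' x h) \<le> B * norm h)"
    by (rule loc_bounded_diffE[OF g]) (rule that)
  obtain K where K: "K \<ge> 0" "\<And>a b. norm (p a b) \<le> norm a * norm b * K"
    using nonneg_bounded by blast
  show ?thesis
  proof (rule loc_bounded_diffI[where f' = "\<lambda>x h. p (f x) (g' x h) + p (f' x h) (g x)"])
    show "((\<lambda>x. p (f x) (g x)) has_derivative (\<lambda>h. p (f x) (g' x h) + p (f' x h) (g x))) (at x)" for x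
      by (rule FDERIV[OF f'(1) g'(1)])
    fix R
    obtain B where B: "B \<ge> 0" "\<And>x. norm x \<le> R \<Longrightarrow> norm (g x) \<le> B \<and> (\<forall>h. norm (g' x h) \<le> B * norm h)"
      using g'(2)[of R] by blast
    obtain C where C: "C \<ge> 0" "\<And>x. norm x \<le> R \<Longrightarrow> norm (f x) \<le> C \<and> (\<forall>h. norm (f' x h) \<le> C * norm h)"
      using f'(2)[of R] by blast
    have "norm (p (f x) (g' x h) + p (f' x h) (g x)) \<le> 2 * C * B * K * norm h" if x: "norm x \<le> R" for x h
    proof -
      have "norm (p (f x) (g' x h)) \<le> C * (B * norm h) * K"
        using B(2)[OF x] C(2)[OF x] B(1) C(1) K(1)
        by (intro order_trans[OF K(2)] mult_right_mono mult_mono) auto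
      moreover have "norm (p (f' x h) (g x)) \<le> (C * norm h) * B * K"
        using B(2)[OF x] C(2)[OF x] B(1) C(1) K(1)
        by (intro order_trans[OF K(2)] mult_right_mono mult_mono) auto
      ultimately show ?thesis
        using norm_triangle_ineq[of "p (f x) (g' x h)" "p (f' x h) (g x)"] by (simp add: algebra_simps)
    qed
    then show "\<exists>B. \<forall>x h. norm x \<le> R \<longrightarrow> norm (p (f x) (g' x h) + p (f' x h) (g x)) \<le> B * norm h"
      by blast
  qed
qed

lemma loc_bounded_diff_const: "loc_bounded_diff (\<lambda>x. c)"
  by (rule loc_bounded_diffI[where f' = "\<lambda>x h. 0"]) (auto intro: exI[of _ 0])

lemma loc_bounded_diff_add:
  assumes f: "loc_bounded_diff f" and g: "loc_bounded_diff g"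
  shows "loc_bounded_diff (\<lambda>x. f x + g x)"
proof -
  obtain f' where f': "\<And>x. (f has_derivative f' x) (at x)"
    "\<And>R. \<exists>B\<ge>0. \<forall>x. norm x \<le> R \<longrightarrow> norm (f x) \<le> B \<and> (\<forall>h. norm (f' x h) \<le> B * norm h)"
    by (rule loc_bounded_diffE[OF f]) (rule that)
  obtain g' where g': "\<And>x. (g has_derivative g' x) (at x)"
    "\<And>R. \<exists>B\<ge>0. \<forall>x. norm x \<le> R \<longrightarrow> norm (g x) \<le> B \<and> (\<forall>h. norm (g' x h) \<le> B * norm h)"
    by (rule loc_bounded_diffE[OF g]) (rule that)
  show ?thesis
  proof (rule loc_bounded_diffI[where f' = "\<lambda>x h. f' x h + g' x h"])
    show "((\<lambda>x. f x + g x) has_derivative (\<lambda>h. f' x h + g' x h)) (at x)" for x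
      by (rule has_derivative_add[OF f'(1) g'(1)])
    fix R
    obtain B where B: "\<And>x h. norm x \<le> R \<Longrightarrow> norm (g' x h) \<le> B * norm h"
      using g'(2)[of R] by blast
    obtain C where C: "\<And>x h. norm x \<le> R \<Longrightarrow> norm (f' x h) \<le> C * norm h"
      using f'(2)[of R] by blast
    have "norm (f' x h + g' x h) \<le> (C + B) * norm h" if "norm x \<le> R" for x h
      using B[OF that, of h] C[OF that, of h] norm_triangle_ineq[of "f' x h" "g' x h"]
      by (simp add: distrib_right)
    then show "\<exists>B. \<forall>x h. norm x \<le> R \<longrightarrow> norm (f' x h + g' x h) \<le> B * norm h" by blast
  qed
qed

lemma loc_bounded_diff_sum:
  "(\<And>i. i \<in> I \<Longrightarrow> loc_bounded_diff (f i)) \<Longrightarrow> loc_bounded_diff (\<lambda>x. \<Sum>i\<in>I. f i x)"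
  by (induction I rule: infinite_finite_induct) (auto intro: loc_bounded_diff_add loc_bounded_diff_const)

lemma loc_bounded_diff_linear_compose:
  "bounded_linear f \<Longrightarrow> loc_bounded_diff g \<Longrightarrow> loc_bounded_diff (\<lambda>x. f (g x))"
  by (rule loc_bounded_diff_compose[OF loc_bounded_diff_bounded_linear])

lemma loc_bounded_diff_Pair:
  assumes "loc_bounded_diff f" "loc_bounded_diff g"
  shows "loc_bounded_diff (\<lambda>x. (f x, g x))"
proof -
  have "loc_bounded_diff (\<lambda>x. (f x, 0) + (0, g x))"
    by (intro loc_bounded_diff_add loc_bounded_diff_linear_compose[OF _ assms(1), of "\<lambda>y. (y, 0)"]
        loc_bounded_diff_linear_compose[OF _ assms(2), of "\<lambda>y. (0, y)"] bounded_linear_Pair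
        bounded_linear_ident bounded_linear_zero)
  then show ?thesis by simp
qed

lemma continuous_bounded_on_cball:
  fixes f :: "'a::{euclidean_space} \<Rightarrow> 'b::real_normed_vector"
  assumes "continuous_on UNIV f"
  obtains B where "\<And>x. norm x \<le> R \<Longrightarrow> norm (f x) \<le> B"
proof -
  have "bounded (f ` cball 0 R)"
    by (intro compact_imp_bounded compact_continuous_image continuous_on_subset[OF assms]) auto
  then obtain B where "\<forall>y\<in>f ` cball 0 R. norm y \<le> B" unfolding bounded_iff by blast
  then show thesis using that[of B] by simp
qed

text \<open>Only one of the two partial derivatives is jointly continuous here; the other one is merely
  bounded. This is what survives for the mixed derivatives of a reproducing kernel.\<close>

lemma has_derivative_partials:
  fixes G :: "'a::real_normed_vector \<Rightarrow> 'b::real_normed_vector \<Rightarrow> 'c::real_normed_vector"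
  assumes g1: "\<And>x y. ((\<lambda>x. G x y) has_derivative blinfun_apply (g1 x y)) (at x)"
    and c1: "continuous_on UNIV (\<lambda>(x, y). g1 x y)"
    and g2: "((\<lambda>y. G x y) has_derivative g2) (at y)"
  shows "((\<lambda>z. G (fst z) (snd z)) has_derivative (\<lambda>h. g1 x y (fst h) + g2 (snd h))) (at (x, y))"
proof -
  have c1': "continuous (at (x, y)) (\<lambda>z. g1 (fst z) (snd z))" for x y
    using c1 by (simp add: continuous_on_eq_continuous_at split_beta')
  have "((\<lambda>(y, x). G x y) has_derivative (\<lambda>(ty, tx). g2 ty + g1 x y tx)) (at (y, x) within UNIV \<times> UNIV)"
  proof (rule has_derivative_partialsI[where f = "\<lambda>y x. G x y" and fy = "\<lambda>y x. g1 x y" and x = y and y = x])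
    show "((\<lambda>ya. G x ya) has_derivative g2) (at y within UNIV)" by (simp add: g2)
    show "((\<lambda>x. G x y) has_derivative blinfun_apply (g1 x y)) (at x within UNIV)" for x y by (simp add: g1)
    have "isCont (\<lambda>w. (\<lambda>z. g1 (fst z) (snd z)) (snd w, fst w)) (y, x)"
      by (rule isCont_o2[where f = "\<lambda>w. (snd w, fst w)"]) (auto intro!: continuous_intros c1')
    then show "continuous (at (y, x) within UNIV \<times> UNIV) (\<lambda>(y, x). g1 x y)"
      by (simp add: split_beta')
  qed auto
  then have D: "((\<lambda>w. G (snd w) (fst w)) has_derivative (\<lambda>h. g2 (fst h) + g1 x y (snd h))) (at (y, x))"
    by (simp add: split_beta')
  have sw: "((\<lambda>z. (snd z, fst z)) has_derivative (\<lambda>z. (snd z, fst z))) (at (x, y))"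
    by (intro bounded_linear_imp_has_derivative bounded_linear_Pair bounded_linear_fst bounded_linear_snd)
  show ?thesis
    using has_derivative_compose[OF sw, of "\<lambda>w. G (snd w) (fst w)" "\<lambda>h. g2 (fst h) + g1 x y (snd h)"] D
    by (simp add: add.commute)
qed

text \<open>Compactness of closed balls bounds the continuous partial derivative \<open>g1\<close>;
  the other one may be discontinuous and therefore brings its own bound \<open>b2\<close>.\<close>

lemma loc_bounded_diff_partials:
  fixes G :: "'a::euclidean_space \<Rightarrow> 'b::euclidean_space \<Rightarrow> 'c::real_normed_vector"
  assumes g1: "\<And>x y. ((\<lambda>x. G x y) has_derivative blinfun_apply (g1 x y)) (at x)"
    and c1: "continuous_on UNIV (\<lambda>(x, y). g1 x y)"
    and g2: "\<And>x y. ((\<lambda>y. G x y) has_derivative g2 x y) (at y)"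
    and b2: "\<And>R. \<exists>B. \<forall>x y h. norm x \<le> R \<longrightarrow> norm y \<le> R \<longrightarrow> norm (g2 x y h) \<le> B * norm h"
  shows "loc_bounded_diff (\<lambda>z. G (fst z) (snd z))"
proof (rule loc_bounded_diffI[where f' = "\<lambda>z h. g1 (fst z) (snd z) (fst h) + g2 (fst z) (snd z) (snd h)"])
  show "((\<lambda>z. G (fst z) (snd z)) has_derivative
      (\<lambda>h. g1 (fst z) (snd z) (fst h) + g2 (fst z) (snd z) (snd h))) (at z)" for z
    using has_derivative_partials[OF g1 c1 g2, of "fst z" "snd z"] by simp
next
  fix R
  obtain B1 where B1: "\<And>z. norm z \<le> R \<Longrightarrow> norm (case z of (x, y) \<Rightarrow> g1 x y) \<le> B1"
    using continuous_bounded_on_cball[OF c1] by blast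
  obtain B2 where B2: "\<And>x y h. norm x \<le> R \<Longrightarrow> norm y \<le> R \<Longrightarrow> norm (g2 x y h) \<le> B2 * norm h"
    using b2 by blast
  have "norm (g1 (fst z) (snd z) (fst h) + g2 (fst z) (snd z) (snd h)) \<le> (\<bar>B1\<bar> + \<bar>B2\<bar>) * norm h"
    if z: "norm z \<le> R" for z h
  proof -
    obtain x y where xy: "z = (x, y)" by fastforce
    obtain h1 h2 where h: "h = (h1, h2)" by fastforce
    have n: "norm x \<le> R" "norm y \<le> R" using z norm_fst_le[of x y] norm_snd_le[of y x] by (auto simp: xy)
    have hn: "norm h1 \<le> norm h" "norm h2 \<le> norm h" using norm_fst_le[of h1 h2] norm_snd_le[of h2 h1] by (auto simp: h)
    have "norm (g1 x y h1) \<le> \<bar>B1\<bar> * norm h"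
      using norm_blinfun[of "g1 x y" h1] B1[OF z] hn
      by (intro order_trans[OF norm_blinfun] mult_mono) (auto simp: xy)
    moreover have "norm (g2 x y h2) \<le> \<bar>B2\<bar> * norm h"
      using hn by (intro order_trans[OF B2[OF n]] mult_mono) auto
    ultimately show ?thesis
      using norm_triangle_ineq[of "g1 x y h1" "g2 x y h2"] by (simp add: xy h distrib_right)
  qed
  then show "\<exists>B. \<forall>z h. norm z \<le> R \<longrightarrow>
     norm (g1 (fst z) (snd z) (fst h) + g2 (fst z) (snd z) (snd h)) \<le> B * norm h" by blast
qed

text \<open>Variational argument: the quadratic functional \<open>Q\<close> is bounded below, its
  minimising sequences converge by completeness, and stationarity of the minimiser says that it
  represents \<open>f\<close>.\<close>

lemma riesz_representation:
  fixes f :: "'v::{real_inner,complete_space} \<Rightarrow> real"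
  assumes "bounded_linear f"
  shows "\<exists>w. \<forall>v. f v = v \<bullet> w"
proof -
  interpret bounded_linear f by fact
  obtain B where B: "B \<ge> 0" "\<And>v. \<bar>f v\<bar> \<le> norm v * B"
    using nonneg_bounded by auto
  define Q where "Q v = v \<bullet> v - 2 * f v" for v
  have "Q v \<ge> - B\<^sup>2" for v
  proof -
    have "Q v \<ge> (norm v)\<^sup>2 - 2 * (norm v * B)"
      using B(2)[of v] by (simp add: Q_def power2_norm_eq_inner)
    moreover have "(norm v)\<^sup>2 - 2 * (norm v * B) = (norm v - B)\<^sup>2 - B\<^sup>2"
      by (simp add: power2_eq_square algebra_simps)
    ultimately show ?thesis using zero_le_power2[of "norm v - B"] by linarith
  qed
  then have bdd: "bdd_below (range Q)" by (auto intro!: bdd_belowI)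
  define m where "m = Inf (range Q)"
  have m: "m \<le> Q v" for v unfolding m_def by (intro cInf_lower bdd) auto
  have "\<exists>v. Q v < m + inverse (real (Suc n))" for n
    using cInf_lessD[of "range Q" "m + inverse (real (Suc n))"] by (auto simp: m_def)
  then obtain v where v: "\<And>n. Q (v n) < m + inverse (real (Suc n))" by metis
  \<comment> \<open>Parallelogram identity; the linear terms of \<open>Q\<close> cancel. As the
    midpoint has \<open>Q\<close> at least \<open>m\<close>, two near-minimisers are close to each
    other.\<close>
  have par: "(norm (a - b))\<^sup>2 = 2 * Q a + 2 * Q b - 4 * Q ((1/2) *\<^sub>R (a + b))" for a b
    by (simp add: Q_def power2_norm_eq_inner inner_diff_left inner_diff_right inner_add_left
        inner_add_right inner_commute add scaleR algebra_simps)
  have close: "(norm (v i - v j))\<^sup>2 \<le> 4 * inverse (real (Suc n))" if "i \<ge> n" "j \<ge> n" for i j n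
  proof -
    have "inverse (real (Suc i)) \<le> inverse (real (Suc n))" "inverse (real (Suc j)) \<le> inverse (real (Suc n))"
      using that by (auto intro!: le_imp_inverse_le)
    then show ?thesis
      using par[of "v i" "v j"] v[of i] v[of j] m[of "(1/2) *\<^sub>R (v i + v j)"] by linarith
  qed
  have "Cauchy v"
  proof (rule metric_CauchyI)
    fix e :: real assume e: "e > 0"
    then obtain n where n: "inverse (real (Suc n)) < e\<^sup>2 / 4"
      using reals_Archimedean[of "e\<^sup>2 / 4"] by auto
    have "dist (v i) (v j) < e" if "i \<ge> n" "j \<ge> n" for i j
    proof -
      have "(norm (v i - v j))\<^sup>2 < e\<^sup>2" using close[OF that] n by linarith
      then show ?thesis using e by (simp add: dist_norm power2_less_imp_less)
    qed
    then show "\<exists>M. \<forall>i\<ge>M. \<forall>j\<ge>M. dist (v i) (v j) < e" by blast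
  qed
  then obtain w where w: "v \<longlonglongrightarrow> w" using Cauchy_convergent convergent_def by blast
  have "(\<lambda>n. Q (v n)) \<longlonglongrightarrow> Q w"
    unfolding Q_def by (intro tendsto_intros tendsto w)
  moreover have "(\<lambda>n. m + inverse (real (Suc n))) \<longlonglongrightarrow> m + 0"
    by (intro tendsto_intros LIMSEQ_inverse_real_of_nat)
  ultimately have Qw: "Q w \<le> m"
    using v by (intro LIMSEQ_le[of "\<lambda>n. Q (v n)" "Q w" "\<lambda>n. m + inverse (real (Suc n))" m]) (auto intro: less_imp_le)
  have "f x = x \<bullet> w" for x
  proof (rule ccontr)
    assume ne: "f x \<noteq> x \<bullet> w"
    define c where "c = f x - x \<bullet> w"
    have "x \<noteq> 0" using ne by (auto simp: zero)
    then have xx: "x \<bullet> x > 0" by simp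
    \<comment> \<open>The step along \<open>x\<close> that minimises \<open>Q\<close>; it would
      lower the value by \<open>c * c / (x \<bullet> x)\<close>, contradicting minimality of
      \<open>w\<close>.\<close>
    define s where "s = c / (x \<bullet> x)"
    have "Q (w + s *\<^sub>R x) = Q w + s * (s * (x \<bullet> x)) - 2 * s * c"
      by (simp add: Q_def c_def inner_add_left inner_add_right inner_commute add scaleR algebra_simps)
    also have "s * (x \<bullet> x) = c" using xx by (simp add: s_def)
    finally have "Q (w + s *\<^sub>R x) = Q w - c * c / (x \<bullet> x)" by (simp add: s_def)
    moreover have "c * c / (x \<bullet> x) > 0" using ne xx by (auto simp: c_def zero_less_mult_iff intro!: divide_pos_pos)
    ultimately show False using m[of "w + s *\<^sub>R x"] Qw by linarith
  qed
  then show ?thesis by blast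
qed

section \<open>Reproducing kernels and the Hamiltonian vector field\<close>

text \<open>Point derivatives are continuous functionals on \<open>V\<close>: the operator norm of
  the derivative is one summand of the \<open>C1\<close> norm. Linearity in \<open>v\<close> comes
  from uniqueness of derivatives.\<close>

lemma embedded_derivative:
  assumes sp: "space_of_fields ev" and emb: "continuously_embedded_C1_0 ev"
  obtains D c where "c \<ge> 0" "\<And>v x. (ev v has_derivative D v x) (at x)"
    "\<And>v x h. norm (D v x h) \<le> c * norm v * norm h" "\<And>x h. linear (\<lambda>v. D v x h)"
proof -
  obtain c where c: "\<And>v. norm_1_inf (ev v) \<le> ereal (c * norm v)"
    using emb unfolding continuously_embedded_C1_0_def by blast
  define D where "D v x = frechet_derivative (ev v) (at x)" for v x
  have D: "(ev v has_derivative D v x) (at x)" for v x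
  proof -
    have "ev v \<in> C1_0" using emb by (auto simp: continuously_embedded_C1_0_def)
    then have "ev v differentiable (at x)" unfolding C1_0_def C1_def differentiable_def by blast
    then show ?thesis unfolding D_def by (simp add: frechet_derivative_works[symmetric])
  qed
  have bd: "norm (D v x h) \<le> \<bar>c\<bar> * norm v * norm h" for v x h
  proof -
    \<comment> \<open>Nonnegativity of the supremum of the field is needed to drop it from the
      extended-real sum; any one point shows it.\<close>
    have "0 \<le> ereal (norm (ev v 0))" by simp
    also have "\<dots> \<le> (SUP x. ereal (norm (ev v x)))" by (rule SUP_upper) simp
    finally have "0 \<le> (SUP x. ereal (norm (ev v x)))" .
    moreover have "ereal (onorm (D v x)) \<le> (SUP x. ereal (onorm (D v x)))" by (rule SUP_upper) simp
    ultimately have "ereal (onorm (D v x)) \<le> norm_1_inf (ev v)"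
      unfolding norm_1_inf_def D_def[symmetric] by (rule add_increasing)
    then have "ereal (onorm (D v x)) \<le> ereal (c * norm v)" using c order_trans by blast
    then have "onorm (D v x) \<le> \<bar>c\<bar> * norm v"
      using mult_right_mono[OF abs_ge_self[of c] norm_ge_zero[of v]] by simp
    then show ?thesis
      using onorm[OF has_derivative_bounded_linear[OF D[of v x]], of h]
      by (meson mult_right_mono norm_ge_zero order_trans)
  qed
  have lin: "linear (\<lambda>v. ev v x)" for x using sp by (simp add: space_of_fields_def)
  have "linear (\<lambda>v. D v x h)" for x h
  proof (rule linearI)
    fix v w :: 'a and r :: real
    have "ev (v + w) = (\<lambda>y. ev v y + ev w y)" using linear_add[OF lin] by auto
    then have "(ev (v + w) has_derivative (\<lambda>h. D v x h + D w x h)) (at x)"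
      using has_derivative_add[OF D[of v x] D[of w x]] by simp
    then show "D (v + w) x h = D v x h + D w x h"
      using has_derivative_unique[OF D[of "v + w" x]] by metis
    have "ev (r *\<^sub>R v) = (\<lambda>y. r *\<^sub>R ev v y)" using linear_scale[OF lin] by auto
    then have "(ev (r *\<^sub>R v) has_derivative (\<lambda>h. r *\<^sub>R D v x h)) (at x)"
      using has_derivative_scaleR_right[OF D[of v x]] by simp
    then show "D (r *\<^sub>R v) x h = r *\<^sub>R D v x h"
      using has_derivative_unique[OF D[of "r *\<^sub>R v" x]] by metis
  qed
  then show thesis using that[of "\<bar>c\<bar>" D] D bd by simp
qed

text \<open>\<open>k y b\<close> is the element of \<open>V\<close> whose field is the
  \<open>b\<close>-th column of \<open>K\<close> with second argument \<open>y\<close>. Matrix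
  entries thus become evaluations of elements of \<open>V\<close>.\<close>

lemma kernel_entry:
  fixes K :: "real^'d \<Rightarrow> real^'d \<Rightarrow> real^'d^'d"
  assumes "reproducing_kernel ev K"
  obtains k where "\<And>y b v. v \<bullet> k y b = ev v y $ b" "\<And>x y a b. K x y $ a $ b = ev (k y b) x $ a"
proof -
  have "\<exists>w. (\<forall>v. v \<bullet> w = ev v y $ b) \<and> (\<forall>x a. K x y $ a $ b = ev w x $ a)" for y b
  proof -
    obtain w where w: "ev w = (\<lambda>z. K z y *v axis b 1)" "\<And>v. v \<bullet> w = ev v y \<bullet> axis b 1"
      using assms unfolding reproducing_kernel_def by blast
    have "(\<forall>v. v \<bullet> w = ev v y $ b) \<and> (\<forall>x a. K x y $ a $ b = ev w x $ a)"
      using w by (simp add: inner_axis matrix_vector_mult_basis column_def)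
    then show ?thesis by blast
  qed
  then show thesis using that by metis
qed

text \<open>Corresponding entries on both sides are inner products of the same two elements,
  \<open>k x a\<close> and \<open>k y b\<close>.\<close>

lemma kernel_transpose:
  assumes "reproducing_kernel ev K"
  shows "K x y = transpose (K y x)"
proof -
  obtain k where "\<And>y b v. v \<bullet> k y b = ev v y $ b" "\<And>x y a b. K x y $ a $ b = ev (k y b) x $ a"
    using kernel_entry[OF assms] by blast
  then show ?thesis by (simp add: vec_eq_iff transpose_def) (metis inner_commute)
qed

text \<open>The mixed derivative exists because, by the Riesz theorem, the functional
  \<open>v \<mapsto> (Dv(x) \<eta>)\<^sub>a\<close> is represented by an element of \<open>V\<close>, which is again a differentiable field.\<close>

lemma kernel_mixed_derivative:
  fixes K :: "real^'d \<Rightarrow> real^'d \<Rightarrow> real^'d^'d" and ev :: "'v::{real_inner,complete_space} \<Rightarrow> real^'d \<Rightarrow> real^'d"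
  assumes sp: "space_of_fields ev" and emb: "continuously_embedded_C1_0 ev"
    and rk: "reproducing_kernel ev K"
    and K1: "\<And>x y. ((\<lambda>x. K x y) has_derivative blinfun_apply (K1 x y)) (at x)"
  obtains C where "\<And>x y a b \<eta>. \<exists>D. ((\<lambda>y. K1 x y \<eta> $ a $ b) has_derivative D) (at y) \<and>
     (\<forall>h. \<bar>D h\<bar> \<le> C * norm \<eta> * norm h)"
proof -
  obtain k where k: "\<And>y b v. v \<bullet> k y b = ev v y $ b" "\<And>x y a b. K x y $ a $ b = ev (k y b) x $ a"
    using kernel_entry[OF rk] by blast
  obtain D c where c: "c \<ge> 0" and D: "\<And>v x. (ev v has_derivative D v x) (at x)"
    and bd: "\<And>v x h. norm (D v x h) \<le> c * norm v * norm h" and lin: "\<And>x h. linear (\<lambda>v. D v x h)"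
    by (rule embedded_derivative[OF sp emb]) (rule that)
  have "\<exists>D'. ((\<lambda>y. K1 x y \<eta> $ a $ b) has_derivative D') (at y) \<and>
     (\<forall>h. \<bar>D' h\<bar> \<le> c * c * norm \<eta> * norm h)" for x y a b \<eta>
  proof -
    have "bounded_linear (\<lambda>v. D v x \<eta> $ a)"
    proof (rule bounded_linear_intro)
      show "D (v + w) x \<eta> $ a = D v x \<eta> $ a + D w x \<eta> $ a" for v w
        by (simp add: linear_add[OF lin])
      show "D (r *\<^sub>R v) x \<eta> $ a = r *\<^sub>R (D v x \<eta> $ a)" for v r
        by (simp add: linear_scale[OF lin])
      show "norm (D v x \<eta> $ a) \<le> norm v * (c * norm \<eta>)" for v
        using component_le_norm_cart[of "D v x \<eta>" a] bd[of v x \<eta>] by (simp add: algebra_simps)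
    qed
    then obtain w where w: "\<And>v. D v x \<eta> $ a = v \<bullet> w" using riesz_representation by blast
    have wn: "norm w \<le> c * norm \<eta>"
    proof (cases "w = 0")
      case False
      have "norm w * norm w = D w x \<eta> $ a" by (simp add: w power2_norm_eq_inner[symmetric] power2_eq_square)
      also have "\<dots> \<le> c * norm w * norm \<eta>"
        using component_le_norm_cart[of "D w x \<eta>" a] bd[of w x \<eta>] by simp
      finally show ?thesis using False by (simp add: algebra_simps)
    qed (use c in simp)
    \<comment> \<open>For fixed \<open>x\<close>, \<open>\<eta>\<close> and \<open>a\<close> a
      single representer \<open>w\<close> serves all \<open>y\<close>: as a function of
      \<open>y\<close> the entry is a component of the field \<open>ev w\<close>, so its derivative
      is \<open>D w\<close>.\<close>
    have "K1 x y \<eta> $ a $ b = ev w y $ b" for y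
    proof -
      have "((\<lambda>x. K x y $ a $ b) has_derivative (\<lambda>\<eta>. K1 x y \<eta> $ a $ b)) (at x)"
        by (intro bounded_linear.has_derivative[OF bounded_linear_vec_nth] K1)
      moreover have "((\<lambda>x. K x y $ a $ b) has_derivative (\<lambda>\<eta>. D (k y b) x \<eta> $ a)) (at x)"
        unfolding k(2) by (intro bounded_linear.has_derivative[OF bounded_linear_vec_nth] D)
      ultimately have "K1 x y \<eta> $ a $ b = D (k y b) x \<eta> $ a"
        using has_derivative_unique by metis
      then show ?thesis by (simp add: w k(1)[symmetric] inner_commute)
    qed
    then have "((\<lambda>y. K1 x y \<eta> $ a $ b) has_derivative (\<lambda>h. D w y h $ b)) (at y)"
      using bounded_linear.has_derivative[OF bounded_linear_vec_nth D] by simp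
    moreover have "\<bar>D w y h $ b\<bar> \<le> c * c * norm \<eta> * norm h" for h
    proof -
      have "\<bar>D w y h $ b\<bar> \<le> c * norm w * norm h"
        using component_le_norm_cart[of "D w y h" b] bd[of w y h] by simp
      also have "\<dots> \<le> c * (c * norm \<eta>) * norm h"
        using wn c by (intro mult_right_mono mult_left_mono) auto
      finally show ?thesis by (simp add: mult.assoc)
    qed
    ultimately show ?thesis by blast
  qed
  then show thesis by (rule that)
qed

lemma bounded_bilinear_matrix_vector: "bounded_bilinear (\<lambda>(A::real^'n^'m) v. A *v v)"
  unfolding bilinear_conv_bounded_bilinear[symmetric] bilinear_def
  by (auto intro!: linearI simp: matrix_vector_mult_add_rdistrib matrix_vector_right_distrib
      scaleR_matrix_vector_assoc matrix_vector_mult_scaleR)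

lemma bounded_linear_transpose: "bounded_linear (transpose :: real^'n^'m \<Rightarrow> real^'m^'n)"
  unfolding linear_conv_bounded_linear[symmetric]
  by (rule linearI) (simp_all add: transpose_def vec_eq_iff)

lemma inner_axis_axis_matrix: "(A :: real^'n^'m) \<bullet> axis a (axis b 1) = A $ a $ b"
  by (simp add: inner_axis)

text \<open>Symmetry supplies the derivative in the second variable as a transpose of the one in the
  first. The derivative \<open>K1\<close> is treated in a fixed direction \<open>\<eta>\<close>,
  which suffices because the coordinates of the Hamiltonian field involve fixed basis
  directions.\<close>

lemma kernel_loc_bounded_diff:
  fixes K :: "real^'d \<Rightarrow> real^'d \<Rightarrow> real^'d^'d" and ev :: "'v::{real_inner,complete_space} \<Rightarrow> real^'d \<Rightarrow> real^'d"
  assumes sp: "space_of_fields ev" and emb: "continuously_embedded_C1_0 ev"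
    and rk: "reproducing_kernel ev K" and C2: "C2_in_first K"
  obtains K1 where "\<And>x y. ((\<lambda>z. K (fst z) (snd z)) has_derivative
      (\<lambda>h. K1 x y (fst h) + transpose (K1 y x (snd h)))) (at (x, y))"
    "loc_bounded_diff (\<lambda>z. K (fst z) (snd z))"
    "\<And>\<eta>. loc_bounded_diff (\<lambda>z. K1 (fst z) (snd z) \<eta>)"
proof -
  obtain K1 K2 where K1: "\<And>x y. ((\<lambda>x. K x y) has_derivative blinfun_apply (K1 x y)) (at x)"
    and K2: "\<And>x y. ((\<lambda>x. K1 x y) has_derivative blinfun_apply (K2 x y)) (at x)"
    and c1: "continuous_on UNIV (\<lambda>(x, y). K1 x y)" and c2: "continuous_on UNIV (\<lambda>(x, y). K2 x y)"
    using C2 unfolding C2_in_first_def by blast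
  have Ky: "((\<lambda>y. K x y) has_derivative (\<lambda>h. transpose (K1 y x h))) (at y)" for x y
    unfolding kernel_transpose[OF rk, of x] by (intro bounded_linear.has_derivative[OF bounded_linear_transpose] K1)
  have c1_bound: "\<exists>B. \<forall>x y. norm x \<le> R \<longrightarrow> norm y \<le> R \<longrightarrow> norm (K1 x y) \<le> B" for R
  proof -
    \<comment> \<open>Two points of norm at most \<open>R\<close> form a pair of norm at most
      \<open>2 * R\<close>.\<close>
    obtain B where B: "\<And>z. norm z \<le> 2 * R \<Longrightarrow> norm (case z of (x, y) \<Rightarrow> K1 x y) \<le> B"
      by (rule continuous_bounded_on_cball[OF c1, of "2 * R"]) (rule that)
    have "norm (K1 x y) \<le> B" if "norm x \<le> R" "norm y \<le> R" for x y
      using B[of "(x, y)"] norm_Pair_le[of x y] that by simp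
    then show ?thesis by blast
  qed
  obtain T where T: "\<And>A :: real^'d^'d. norm (transpose A) \<le> norm A * T" "T \<ge> 0"
    using bounded_linear.nonneg_bounded[OF bounded_linear_transpose] by blast
  have diffK: "loc_bounded_diff (\<lambda>z. K (fst z) (snd z))"
  proof (rule loc_bounded_diff_partials[OF K1 c1 Ky])
    fix R
    obtain B where B: "\<And>x y. norm x \<le> R \<Longrightarrow> norm y \<le> R \<Longrightarrow> norm (K1 x y) \<le> B"
      using c1_bound by blast
    have "norm (transpose (K1 y x h)) \<le> B * T * norm h" if "norm x \<le> R" "norm y \<le> R" for x y h
    proof -
      have "norm (K1 y x h) \<le> B * norm h"
        using norm_blinfun[of "K1 y x" h] mult_right_mono[OF B[OF that(2,1)], of "norm h"] by simp
      then show ?thesis using T(1)[of "K1 y x h"] mult_right_mono[of "norm (K1 y x h)" "B * norm h" T] T(2)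
        by (simp add: algebra_simps)
    qed
    then show "\<exists>B. \<forall>x y h. norm x \<le> R \<longrightarrow> norm y \<le> R \<longrightarrow> norm (transpose (K1 y x h)) \<le> B * norm h"
      by blast
  qed
  obtain C where C: "\<And>x y a b \<eta>. \<exists>D. ((\<lambda>y. K1 x y \<eta> $ a $ b) has_derivative D) (at y) \<and>
     (\<forall>h. \<bar>D h\<bar> \<le> C * norm \<eta> * norm h)"
    by (rule kernel_mixed_derivative[OF sp emb rk K1]) (rule that)
  have diffK1: "loc_bounded_diff (\<lambda>z. K1 (fst z) (snd z) \<eta>)" for \<eta>
  proof -
    define D where "D x y a b = frechet_derivative (\<lambda>y. K1 x y \<eta> $ a $ b) (at y)" for x y a b
    have D: "((\<lambda>y. K1 x y \<eta> $ a $ b) has_derivative D x y a b) (at y)"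
      "\<bar>D x y a b h\<bar> \<le> C * norm \<eta> * norm h" for x y a b h
    proof -
      obtain D0 where D0: "((\<lambda>y. K1 x y \<eta> $ a $ b) has_derivative D0) (at y)"
        "\<And>h. \<bar>D0 h\<bar> \<le> C * norm \<eta> * norm h"
        using C by blast
      have "D0 = D x y a b" unfolding D_def by (rule frechet_derivative_at[OF D0(1)])
      then show "((\<lambda>y. K1 x y \<eta> $ a $ b) has_derivative D x y a b) (at y)"
        "\<bar>D x y a b h\<bar> \<le> C * norm \<eta> * norm h" using D0 by auto
    qed
    \<comment> \<open>The mixed derivative is available entry by entry, since functionals on
      \<open>V\<close> are scalar; the matrix-valued derivative is reassembled here.\<close>
    define D' where "D' x y h = (\<chi> a b. D x y a b h)" for x y h
    \<comment> \<open>Evaluation at \<open>\<eta>\<close> as a bounded linear map: composed with the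
      second derivative \<open>K2\<close> it gives a continuous operator-valued first partial
      derivative.\<close>
    define ap where "ap = Blinfun (\<lambda>f :: (real^'d) \<Rightarrow>\<^sub>L (real^'d^'d). f \<eta>)"
    have ap: "blinfun_apply ap f = f \<eta>" for f
      unfolding ap_def by (subst bounded_linear_Blinfun_apply) (auto intro: blinfun.bounded_linear_left)
    show ?thesis
    proof (rule loc_bounded_diff_partials[where ?g1.0 = "\<lambda>x y. ap o\<^sub>L K2 x y" and ?g2.0 = D'])
      show "((\<lambda>x. K1 x y \<eta>) has_derivative blinfun_apply (ap o\<^sub>L K2 x y)) (at x)" for x y
      proof -
        have "blinfun_apply (ap o\<^sub>L K2 x y) = (\<lambda>h. K2 x y h \<eta>)" by (rule ext) (simp add: ap)
        then show ?thesis
          using bounded_linear.has_derivative[OF blinfun.bounded_linear_left K2[of y x], of \<eta>] by simp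
      qed
      show "continuous_on UNIV (\<lambda>(x, y). ap o\<^sub>L K2 x y)"
        using c2 by (auto simp: split_beta' intro!: continuous_intros)
      show "((\<lambda>y. K1 x y \<eta>) has_derivative D' x y) (at y)" for x y
        by (rule has_derivative_componentwise_within[THEN iffD2])
          (auto simp: Basis_vec_def inner_axis_axis_matrix D'_def intro!: D(1))
      have "norm (D' x y h) \<le> (\<Sum>i\<in>(Basis :: (real^'d^'d) set). C * norm \<eta>) * norm h" for x y h
      proof -
        have "norm (D' x y h) \<le> (\<Sum>i\<in>Basis. \<bar>D' x y h \<bullet> i\<bar>)" by (rule norm_le_l1)
        also have "\<dots> \<le> (\<Sum>i\<in>(Basis :: (real^'d^'d) set). C * norm \<eta> * norm h)"
          by (intro sum_mono) (auto simp: Basis_vec_def inner_axis_axis_matrix D'_def intro!: D(2))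
        finally show ?thesis by (simp add: sum_distrib_right)
      qed
      then show "\<exists>B. \<forall>x y h. norm x \<le> R \<longrightarrow> norm y \<le> R \<longrightarrow> norm (D' x y h) \<le> B * norm h" for R
        by blast
    qed
  qed
  show thesis
    by (rule that[of "\<lambda>x y. blinfun_apply (K1 x y)"]) (intro has_derivative_partials[OF K1 c1 Ky] diffK diffK1)+
qed

text \<open>Replaces the definite description by a finite sum of directional derivatives, to which
  the closure rules for \<open>loc_bounded_diff\<close> apply.\<close>

lemma grad_eq_sum:
  assumes "(f has_derivative f') (at x)"
  shows "grad f x = (\<Sum>b\<in>Basis. f' b *\<^sub>R b)"
proof -
  interpret bounded_linear f' using assms by (rule has_derivative_bounded_linear)
  have eq: "f' h = h \<bullet> (\<Sum>b\<in>Basis. f' b *\<^sub>R b)" for h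
  proof -
    have "f' h = f' (\<Sum>b\<in>Basis. (h \<bullet> b) *\<^sub>R b)" by (simp add: euclidean_representation)
    also have "\<dots> = h \<bullet> (\<Sum>b\<in>Basis. f' b *\<^sub>R b)"
      by (simp add: sum scaleR inner_sum_right mult.commute)
    finally show ?thesis .
  qed
  then have f': "f' = (\<lambda>h. h \<bullet> (\<Sum>b\<in>Basis. f' b *\<^sub>R b))" by (rule ext)
  show ?thesis unfolding grad_def
  proof (rule the_equality)
    show "GDERIV f x :> (\<Sum>b\<in>Basis. f' b *\<^sub>R b)"
      using assms f' by (simp add: gderiv_def)
    fix D assume "GDERIV f x :> D"
    then have "(\<lambda>h. h \<bullet> D) = f'" unfolding gderiv_def by (rule has_derivative_unique[OF _ assms])
    then have "h \<bullet> D = h \<bullet> (\<Sum>b\<in>Basis. f' b *\<^sub>R b)" for h using eq by metis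
    then show "D = (\<Sum>b\<in>Basis. f' b *\<^sub>R b)" by (intro vector_eq_ldot[THEN iffD1]) blast
  qed
qed

lemma grad_inner:
  assumes "(f has_derivative f') (at x)"
  shows "grad f x \<bullet> h = f' h"
proof -
  interpret bounded_linear f' using assms by (rule has_derivative_bounded_linear)
  have "f' h = f' (\<Sum>b\<in>Basis. (h \<bullet> b) *\<^sub>R b)" by (simp add: euclidean_representation)
  also have "\<dots> = h \<bullet> grad f x"
    unfolding grad_eq_sum[OF assms] by (simp add: sum scaleR inner_sum_right mult.commute)
  also have "\<dots> = grad f x \<bullet> h" by (rule inner_commute)
  finally show ?thesis by simp
qed

lemma dyn_loc_bounded_diff:
  fixes K :: "real^'d \<Rightarrow> real^'d \<Rightarrow> real^'d^'d" and ev :: "'v::{real_inner,complete_space} \<Rightarrow> real^'d \<Rightarrow> real^'d"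
  assumes sp: "space_of_fields ev" and emb: "continuously_embedded_C1_0 ev"
    and rk: "reproducing_kernel ev K" and C2: "C2_in_each_variable K"
  shows "loc_bounded_diff (\<lambda>q :: ('d, 'n::finite) state. dyn K q 0)"
proof -
  obtain K1 where K1: "\<And>x y. ((\<lambda>z. K (fst z) (snd z)) has_derivative
      (\<lambda>h. K1 x y (fst h) + transpose (K1 y x (snd h)))) (at (x, y))"
    and lK: "loc_bounded_diff (\<lambda>z. K (fst z) (snd z))"
    and lK1: "\<And>\<eta>. loc_bounded_diff (\<lambda>z. K1 (fst z) (snd z) \<eta>)"
    by (rule kernel_loc_bounded_diff[OF sp emb rk C2[unfolded C2_in_each_variable_def, THEN conjunct1]])
      (rule that)
  \<comment> \<open>\<open>Hp q b\<close> and \<open>Hx q b\<close> are the derivatives of the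
    Hamiltonian in momentum and position in the direction \<open>b\<close>. With \<open>b\<close>
    ranging over the basis they are, up to sign, the coordinates of the field.\<close>
  define Hp where "Hp q b = 1/2 * (\<Sum>i\<in>UNIV. \<Sum>j\<in>UNIV.
      (snd q $ i) \<bullet> (K (fst q $ i) (fst q $ j) *v (b $ j)) + (b $ i) \<bullet> (K (fst q $ i) (fst q $ j) *v (snd q $ j)))"
    for q :: "('d, 'n) state" and b
  define Hx where "Hx q b = 1/2 * (\<Sum>i\<in>UNIV. \<Sum>j\<in>UNIV. (snd q $ i) \<bullet>
      ((K1 (fst q $ i) (fst q $ j) (b $ i) + transpose (K1 (fst q $ j) (fst q $ i) (b $ j))) *v (snd q $ j)))"
    for q :: "('d, 'n) state" and b
  have nth: "((\<lambda>x. x $ i) has_derivative (\<lambda>h. h $ i)) (at x)" for i and x :: "('d, 'n) conf"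
    by (intro bounded_linear_imp_has_derivative bounded_linear_vec_nth)
  have dp: "((\<lambda>p. hamiltonian K x p) has_derivative Hp (x, p)) (at p)" for x p :: "('d, 'n) conf"
  proof -
    have "((\<lambda>p. p $ i \<bullet> (K (x $ i) (x $ j) *v (p $ j))) has_derivative
        (\<lambda>h. (p $ i) \<bullet> (K (x $ i) (x $ j) *v (h $ j)) + (h $ i) \<bullet> (K (x $ i) (x $ j) *v (p $ j)))) (at p)" for i j
      by (intro has_derivative_inner nth bounded_linear.has_derivative[OF matrix_vector_mul_bounded_linear])
    then show ?thesis unfolding hamiltonian_def Hp_def fst_conv snd_conv
      by (intro has_derivative_mult_right has_derivative_sum)
  qed
  have dx: "((\<lambda>x. hamiltonian K x p) has_derivative Hx (x, p)) (at x)" for x p :: "('d, 'n) conf"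
  proof -
    \<comment> \<open>Both arguments of the kernel move with \<open>x\<close>, even together when
      \<open>i = j\<close>, so the derivative of \<open>K\<close> as a function of the pair is
      used.\<close>
    have "((\<lambda>x. K (x $ i) (x $ j)) has_derivative
        (\<lambda>h. K1 (x $ i) (x $ j) (h $ i) + transpose (K1 (x $ j) (x $ i) (h $ j)))) (at x)" for i j
      using has_derivative_compose[OF has_derivative_Pair[OF nth nth] K1, of i j x] by simp
    then have "((\<lambda>x. p $ i \<bullet> (K (x $ i) (x $ j) *v (p $ j))) has_derivative
        (\<lambda>h. (p $ i) \<bullet> ((K1 (x $ i) (x $ j) (h $ i) + transpose (K1 (x $ j) (x $ i) (h $ j))) *v (p $ j)))) (at x)" for i j
      by (intro bounded_linear.has_derivative[OF bounded_linear_inner_right]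
          bounded_linear.has_derivative[OF bounded_bilinear.bounded_linear_left[OF bounded_bilinear_matrix_vector]])
    then show ?thesis unfolding hamiltonian_def Hx_def fst_conv snd_conv
      by (intro has_derivative_mult_right has_derivative_sum)
  qed
  have lx: "loc_bounded_diff (\<lambda>q :: ('d, 'n) state. fst q $ i)" for i
    by (intro loc_bounded_diff_bounded_linear bounded_linear_compose[OF bounded_linear_vec_nth bounded_linear_fst])
  have lp: "loc_bounded_diff (\<lambda>q :: ('d, 'n) state. snd q $ i)" for i
    by (intro loc_bounded_diff_bounded_linear bounded_linear_compose[OF bounded_linear_vec_nth bounded_linear_snd])
  have lKij: "loc_bounded_diff (\<lambda>q :: ('d, 'n) state. K (fst q $ i) (fst q $ j))" for i j
    using loc_bounded_diff_compose[OF lK loc_bounded_diff_Pair[OF lx lx]] by simp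
  have lK1ij: "loc_bounded_diff (\<lambda>q :: ('d, 'n) state. K1 (fst q $ i) (fst q $ j) \<eta>)" for i j \<eta>
    using loc_bounded_diff_compose[OF lK1 loc_bounded_diff_Pair[OF lx lx]] by simp
  note bil = loc_bounded_diff_bilinear[OF bounded_bilinear_inner] loc_bounded_diff_bilinear[OF bounded_bilinear_matrix_vector]
  have lHp: "loc_bounded_diff (\<lambda>q. Hp q b)" for b
    unfolding Hp_def
    by (intro loc_bounded_diff_linear_compose[OF bounded_linear_mult_right] loc_bounded_diff_sum
        loc_bounded_diff_add bil lp lKij loc_bounded_diff_const)
  have lHx: "loc_bounded_diff (\<lambda>q. Hx q b)" for b
    unfolding Hx_def
    by (intro loc_bounded_diff_linear_compose[OF bounded_linear_mult_right] loc_bounded_diff_sum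
        loc_bounded_diff_linear_compose[OF bounded_linear_transpose]
        loc_bounded_diff_add bil lp lK1ij loc_bounded_diff_const)
  have "dyn K q 0 = (\<Sum>b\<in>Basis. Hp q b *\<^sub>R b, - (\<Sum>b\<in>Basis. Hx q b *\<^sub>R b))" for q :: "('d, 'n) state"
    using grad_eq_sum[OF dp, of "fst q" "snd q"] grad_eq_sum[OF dx, of "snd q" "fst q"]
    by (simp add: dyn_def)
  then show ?thesis
    by (auto intro!: loc_bounded_diff_Pair loc_bounded_diff_sum
        loc_bounded_diff_linear_compose[OF bounded_linear_minus[OF bounded_linear_ident]]
        loc_bounded_diff_linear_compose[OF bounded_linear_scaleR_left] lHp lHx)
qed

lemma dyn_control_affine: "dyn K q u = dyn K q 0 + (0, u)"
  by (simp add: dyn_def)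

section \<open>The running cost\<close>

lemma C1_imp_loc_bounded_deriv:
  fixes f :: "'a::euclidean_space \<Rightarrow> 'b::real_normed_vector"
  assumes "C1 f"
  obtains f' where "loc_bounded_deriv f f'" "continuous_on UNIV f'"
proof -
  obtain f' where f': "\<And>x. (f has_derivative blinfun_apply (f' x)) (at x)" "continuous_on UNIV f'"
    using assms unfolding C1_def by blast
  have "\<exists>B. \<forall>x. norm x \<le> R \<longrightarrow> norm (f' x) \<le> B" for R
    by (rule continuous_bounded_on_cball[OF f'(2), of R]) blast
  then show thesis using f' by (intro that[of f']) (auto simp: loc_bounded_deriv_def)
qed

lemma has_vector_derivative_compose_derivative:
  assumes f: "(f has_derivative f') (at (Q t))" and Q: "(Q has_vector_derivative d) (at t)"
  shows "((\<lambda>t. f (Q t)) has_vector_derivative f' d) (at t)"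
proof -
  interpret bounded_linear f' using f by (rule has_derivative_bounded_linear)
  show ?thesis
    using has_derivative_compose[OF Q[unfolded has_vector_derivative_def] f]
    by (simp add: has_vector_derivative_def scaleR)
qed

section \<open>Square integrable controls\<close>

lemma L2_measurable:
  assumes "L2 T u"
  shows "u \<in> borel_measurable (lebesgue_on {0..T})"
proof -
  have "(\<lambda>x. indicator {0..T} x *\<^sub>R u x) \<in> borel_measurable lebesgue"
    using assms by (simp add: L2_def set_borel_measurable_def)
  then show ?thesis by (subst borel_measurable_restrict_space_iff) auto
qed

lemma L2_square_integrable:
  assumes "L2 T u"
  shows "(\<lambda>s. (norm (u s))\<^sup>2) integrable_on {0..T}"
  using assms by (intro set_lebesgue_integral_eq_integral(1)) (simp add: L2_def)

text \<open>On an interval of finite length the bound \<open>1 + (norm (u s))\<^sup>2\<close> is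
  integrable.\<close>

lemma L2_absolutely_integrable:
  assumes "L2 T u"
  shows "u absolutely_integrable_on {0..T}"
proof (rule measurable_bounded_by_integrable_imp_absolutely_integrable[OF L2_measurable[OF assms]])
  show "(\<lambda>s. 1 + (norm (u s))\<^sup>2) integrable_on {0..T}"
    by (intro integrable_add L2_square_integrable[OF assms] integrable_continuous_real continuous_on_const)
  show "norm (u s) \<le> 1 + (norm (u s))\<^sup>2" for s
    using zero_le_power2[of "norm (u s) - 1 / 2"] by (simp add: power2_eq_square algebra_simps)
qed simp

section \<open>Derivatives and quadratic growth of the cost\<close>

lemma cost_has_derivative_q:
  assumes "(\<K> has_derivative \<K>') (at q)"
  shows "((\<lambda>q. cost \<K> q u) has_derivative (\<lambda>h. 1/2 * (blinfun_apply (\<K>' h) u \<bullet> u))) (at q)"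
  unfolding cost_def
  by (intro has_derivative_mult_right bounded_linear.has_derivative[OF bounded_linear_inner_left]
      bounded_linear.has_derivative[OF blinfun.bounded_linear_left] assms)

lemma cost_has_derivative_u:
  "((\<lambda>u. cost \<K> q u) has_derivative
     (\<lambda>v. 1/2 * (blinfun_apply (\<K> q) u \<bullet> v + blinfun_apply (\<K> q) v \<bullet> u))) (at u)"
  unfolding cost_def
  by (intro has_derivative_mult_right has_derivative_inner has_derivative_ident
      bounded_linear_imp_has_derivative[OF blinfun.bounded_linear_right])

lemma cost_has_vector_derivative:
  assumes \<K>: "(\<K> has_derivative \<K>') (at (Q 0))" and Q: "(Q has_vector_derivative dq) (at 0)"
  shows "((\<lambda>\<epsilon>. cost \<K> (Q \<epsilon>) (u + \<epsilon> *\<^sub>R v)) has_vector_derivative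
     1/2 * (blinfun_apply (\<K>' dq) u \<bullet> u)
      + 1/2 * (blinfun_apply (\<K> (Q 0)) u \<bullet> v + blinfun_apply (\<K> (Q 0)) v \<bullet> u)) (at 0)"
proof -
  have k: "((\<lambda>\<epsilon>. \<K> (Q \<epsilon>)) has_vector_derivative \<K>' dq) (at 0)"
    by (rule has_vector_derivative_compose_derivative[OF \<K> Q])
  have w: "((\<lambda>\<epsilon>. u + \<epsilon> *\<^sub>R v) has_derivative (\<lambda>h. h *\<^sub>R v)) (at 0)"
    by (auto intro!: derivative_eq_intros)
  have "((\<lambda>\<epsilon>. 1/2 * (blinfun_apply (\<K> (Q \<epsilon>)) (u + \<epsilon> *\<^sub>R v) \<bullet> (u + \<epsilon> *\<^sub>R v))) has_derivative
     (\<lambda>h. 1/2 * (blinfun_apply (\<K> (Q 0)) (u + 0 *\<^sub>R v) \<bullet> (h *\<^sub>R v) +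
        (blinfun_apply (\<K> (Q 0)) (h *\<^sub>R v) + blinfun_apply (h *\<^sub>R \<K>' dq) (u + 0 *\<^sub>R v)) \<bullet> (u + 0 *\<^sub>R v)))) (at 0)"
    by (intro has_derivative_mult_right has_derivative_inner blinfun.FDERIV w
        k[unfolded has_vector_derivative_def])
  then show ?thesis
    unfolding has_vector_derivative_def cost_def
    by (rule has_derivative_eq_rhs)
      (auto simp: blinfun.bilinear_simps inner_simps algebra_simps)
qed

context
  fixes \<K> :: "('d::finite, 'n::finite) state \<Rightarrow> ('d, 'n) conf \<Rightarrow>\<^sub>L ('d, 'n) conf" and \<K>'
  assumes \<K>: "loc_bounded_deriv \<K> \<K>'" and \<K>'_cont: "continuous_on UNIV \<K>'"
begin

lemma cost_measurable:
  fixes q :: "real \<Rightarrow> ('d::finite, 'n::finite) state"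
  assumes "q \<in> borel_measurable M" "u \<in> borel_measurable M"
  shows "(\<lambda>s. cost \<K> (q s) (u s)) \<in> borel_measurable M"
proof (rule borel_measurable_continuous_Pair[OF assms])
  show "continuous_on UNIV (\<lambda>x. cost \<K> (fst x) (snd x))"
    unfolding cost_def
    by (intro continuous_intros continuous_on_compose2[OF loc_bounded_deriv_continuous_on[OF \<K>, of UNIV]]) auto
qed

lemma cost_bound: "\<bar>cost \<K> q u\<bar> \<le> norm (\<K> q) * (norm u)\<^sup>2"
proof -
  have "\<bar>blinfun_apply (\<K> q) u \<bullet> u\<bar> \<le> norm (\<K> q) * norm u * norm u"
    by (intro order_trans[OF Cauchy_Schwarz_ineq2] mult_right_mono norm_blinfun) auto
  moreover have "0 \<le> norm (\<K> q) * norm u * norm u" by simp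
  ultimately show ?thesis unfolding cost_def power2_eq_square abs_mult by simp
qed

text \<open>Provides the dominating function for the difference quotients: after division by
  \<open>\<bar>\<epsilon>\<bar>\<close> the bound no longer depends on \<epsilon> and is integrable
  for square integrable controls.\<close>

lemma cost_difference_bound:
  assumes l: "norm (\<K> q' - \<K> q) \<le> l * \<bar>\<epsilon>\<bar>" and k: "norm (\<K> q) \<le> k" and \<epsilon>: "\<bar>\<epsilon>\<bar> \<le> 1" and l0: "l \<ge> 0"
  shows "\<bar>cost \<K> q' (u + \<epsilon> *\<^sub>R v) - cost \<K> q u\<bar> \<le> \<bar>\<epsilon>\<bar> * ((l + k) * ((norm u)\<^sup>2 + (norm v)\<^sup>2))"
proof -
  define w where "w = u + \<epsilon> *\<^sub>R v"
  define A where "A = blinfun_apply (\<K> q' - \<K> q) w \<bullet> w"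
  define S where "S = (norm u)\<^sup>2 + (norm v)\<^sup>2"
  have k0: "k \<ge> 0" using k norm_ge_zero order_trans by blast
  have uv: "2 * (norm u * norm v) \<le> S"
    using zero_le_power2[of "norm u - norm v"] unfolding S_def by (simp add: power2_eq_square algebra_simps)
  have ev: "norm (\<epsilon> *\<^sub>R v) \<le> norm v" using \<epsilon> mult_right_mono[OF \<epsilon> norm_ge_zero[of v]] by simp
  have "norm w \<le> norm u + norm v"
    unfolding w_def using norm_triangle_ineq[of u "\<epsilon> *\<^sub>R v"] ev by linarith
  then have "norm w * norm w \<le> (norm u + norm v) * (norm u + norm v)" by (intro mult_mono) auto
  then have w2: "norm w * norm w \<le> 2 * S" using uv by (simp add: S_def power2_eq_square algebra_simps)
  have "\<bar>A\<bar> \<le> norm (\<K> q' - \<K> q) * norm w * norm w"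
    unfolding A_def by (intro order_trans[OF Cauchy_Schwarz_ineq2] mult_right_mono norm_blinfun) auto
  also have "\<dots> = norm (\<K> q' - \<K> q) * (norm w * norm w)" by simp
  also have "\<dots> \<le> (l * \<bar>\<epsilon>\<bar>) * (2 * S)"
    by (rule mult_mono[OF l w2]) (use l0 in auto)
  finally have A: "\<bar>A\<bar> \<le> 2 * (\<bar>\<epsilon>\<bar> * (l * S))" by (simp add: algebra_simps)
  have b: "\<bar>blinfun_apply (\<K> q) x \<bullet> y\<bar> \<le> k * (norm x * norm y)" for x y
  proof -
    have "\<bar>blinfun_apply (\<K> q) x \<bullet> y\<bar> \<le> norm (\<K> q) * norm x * norm y"
      by (intro order_trans[OF Cauchy_Schwarz_ineq2] mult_right_mono norm_blinfun) auto
    also have "\<dots> \<le> k * norm x * norm y" using k by (intro mult_right_mono) auto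
    finally show ?thesis by simp
  qed
  \<comment> \<open>\<open>A\<close> collects the change of the matrix, \<open>Z\<close> that of the
    control at the old matrix. Writing \<open>w\<close> in the second term absorbs the contribution
    of order \<open>\<epsilon>\<^sup>2\<close>; the two terms stay separate because the matrix need
    not be symmetric.\<close>
  define Z where "Z = blinfun_apply (\<K> q) u \<bullet> v + blinfun_apply (\<K> q) v \<bullet> w"
  have "\<bar>Z\<bar> \<le> k * (norm u * norm v) + k * (norm v * norm w)"
    unfolding Z_def using b[of u v] b[of v w] by linarith
  also have "\<dots> \<le> k * (norm u * norm v) + k * (norm v * (norm u + norm v))"
    using \<open>norm w \<le> norm u + norm v\<close> k0 by (intro add_left_mono mult_left_mono) auto
  also have "\<dots> = k * (2 * (norm u * norm v) + (norm v)\<^sup>2)" by (simp add: power2_eq_square algebra_simps)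
  also have "\<dots> \<le> k * (2 * S)"
  proof (rule mult_left_mono[OF _ k0])
    have "(norm v)\<^sup>2 \<le> S" by (simp add: S_def)
    then show "2 * (norm u * norm v) + (norm v)\<^sup>2 \<le> 2 * S" using uv by linarith
  qed
  finally have "\<bar>\<epsilon>\<bar> * \<bar>Z\<bar> \<le> \<bar>\<epsilon>\<bar> * (k * (2 * S))" by (intro mult_left_mono) auto
  then have Z: "\<bar>\<epsilon>\<bar> * \<bar>Z\<bar> \<le> 2 * (\<bar>\<epsilon>\<bar> * (k * S))" by (simp add: algebra_simps)
  have "cost \<K> q' w - cost \<K> q u = 1/2 * (A + \<epsilon> * Z)"
    unfolding cost_def A_def Z_def w_def
    by (simp add: blinfun.bilinear_simps inner_simps algebra_simps)
  then have "\<bar>cost \<K> q' w - cost \<K> q u\<bar> = 1/2 * \<bar>A + \<epsilon> * Z\<bar>" by (simp only: abs_mult)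
  moreover have "\<bar>A + \<epsilon> * Z\<bar> \<le> \<bar>A\<bar> + \<bar>\<epsilon>\<bar> * \<bar>Z\<bar>"
    using abs_triangle_ineq[of A "\<epsilon> * Z"] by (simp only: abs_mult)
  moreover have "x \<le> c + d" if "x = 1/2 * y" "y \<le> a + b" "a \<le> 2 * c" "b \<le> 2 * d" for x y a b c d :: real
    using that by linarith
  ultimately have "\<bar>cost \<K> q' w - cost \<K> q u\<bar> \<le> \<bar>\<epsilon>\<bar> * (l * S) + \<bar>\<epsilon>\<bar> * (k * S)"
    using A Z by blast
  then show ?thesis by (simp add: w_def S_def algebra_simps)
qed

lemma cost_absolutely_integrable:
  fixes q :: "real \<Rightarrow> ('d::finite, 'n::finite) state"
  assumes q: "continuous_on {0..T} q" and u: "L2 T u" and v: "L2 T v"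
  shows "(\<lambda>s. cost \<K> (q s) (u s + \<epsilon> *\<^sub>R v s)) absolutely_integrable_on {0..T}"
proof -
  obtain R where R: "\<And>s. s \<in> {0..T} \<Longrightarrow> norm (q s) \<le> R"
    using continuous_on_Icc_norm_bound[OF q] by blast
  obtain k where k: "\<And>x. norm x \<le> R \<Longrightarrow> norm (\<K> x) \<le> k"
    using continuous_bounded_on_cball[OF loc_bounded_deriv_continuous_on[OF \<K>]] by blast
  show ?thesis
  proof (rule measurable_bounded_by_integrable_imp_absolutely_integrable)
    show "(\<lambda>s. cost \<K> (q s) (u s + \<epsilon> *\<^sub>R v s)) \<in> borel_measurable (lebesgue_on {0..T})"
      by (intro cost_measurable borel_measurable_add borel_measurable_scaleR borel_measurable_const
          continuous_imp_measurable_on_sets_lebesgue[OF q] L2_measurable[OF u] L2_measurable[OF v]) simp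
    show "(\<lambda>s. k * (2 * (norm (u s))\<^sup>2 + 2 * \<epsilon>\<^sup>2 * (norm (v s))\<^sup>2)) integrable_on {0..T}"
      by (intro integrable_on_mult_right integrable_add L2_square_integrable u v)
    fix s assume s: "s \<in> {0..T}"
    have "norm (u s + \<epsilon> *\<^sub>R v s) \<le> norm (u s) + \<bar>\<epsilon>\<bar> * norm (v s)"
      using norm_triangle_ineq[of "u s" "\<epsilon> *\<^sub>R v s"] by simp
    then have "(norm (u s + \<epsilon> *\<^sub>R v s))\<^sup>2 \<le> (norm (u s) + \<bar>\<epsilon>\<bar> * norm (v s))\<^sup>2"
      by (intro power_mono) auto
    also have "\<dots> \<le> 2 * (norm (u s))\<^sup>2 + 2 * \<epsilon>\<^sup>2 * (norm (v s))\<^sup>2"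
      using zero_le_power2[of "norm (u s) - \<bar>\<epsilon>\<bar> * norm (v s)"]
      by (simp add: power2_sum power2_diff power_mult_distrib)
    finally have "(norm (u s + \<epsilon> *\<^sub>R v s))\<^sup>2 \<le> 2 * (norm (u s))\<^sup>2 + 2 * \<epsilon>\<^sup>2 * (norm (v s))\<^sup>2" .
    moreover have "norm (\<K> (q s)) \<le> k" by (rule k[OF R[OF s]])
    ultimately have "norm (\<K> (q s)) * (norm (u s + \<epsilon> *\<^sub>R v s))\<^sup>2
        \<le> k * (2 * (norm (u s))\<^sup>2 + 2 * \<epsilon>\<^sup>2 * (norm (v s))\<^sup>2)"
      by (intro mult_mono) (auto intro: order_trans[OF norm_ge_zero])
    then show "norm (cost \<K> (q s) (u s + \<epsilon> *\<^sub>R v s)) \<le> k * (2 * (norm (u s))\<^sup>2 + 2 * \<epsilon>\<^sup>2 * (norm (v s))\<^sup>2)"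
      using cost_bound[of "q s" "u s + \<epsilon> *\<^sub>R v s"] by simp
  qed simp
qed

lemma cost_integral_derivative:
  fixes q :: "real \<Rightarrow> real \<Rightarrow> ('d::finite, 'n::finite) state"
  assumes q: "\<And>\<epsilon>. continuous_on {0..T} (q \<epsilon>)" and u: "L2 T u" and v: "L2 T v"
    and C: "C \<ge> 0" "\<delta> > 0" "C * \<delta> \<le> 1"
      "\<And>\<epsilon> t. \<bar>\<epsilon>\<bar> < \<delta> \<Longrightarrow> t \<in> {0..T} \<Longrightarrow> norm (q \<epsilon> t - q 0 t) \<le> C * \<bar>\<epsilon>\<bar>"
    and dq: "\<And>t. t \<in> {0..T} \<Longrightarrow> ((\<lambda>\<epsilon>. q \<epsilon> t) has_vector_derivative dq t) (at 0)"
  shows "((\<lambda>\<epsilon>. integral {0..T} (\<lambda>s. cost \<K> (q \<epsilon> s) (u s + \<epsilon> *\<^sub>R v s))) has_vector_derivative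
      integral {0..T} (\<lambda>s. cost_q \<K> (q 0 s) (u s) (dq s) + cost_u \<K> (q 0 s) (u s) (v s))) (at 0)"
proof -
  let ?c = "\<lambda>\<epsilon> s. cost \<K> (q \<epsilon> s) (u s + \<epsilon> *\<^sub>R v s)"
  let ?d = "\<lambda>s. cost_q \<K> (q 0 s) (u s) (dq s) + cost_u \<K> (q 0 s) (u s) (v s)"
  obtain R where R: "\<And>s. s \<in> {0..T} \<Longrightarrow> norm (q 0 s) \<le> R"
    using continuous_on_Icc_norm_bound[OF q[of 0]] by blast
  obtain k where k: "\<And>x. norm x \<le> R \<Longrightarrow> norm (\<K> x) \<le> k"
    using continuous_bounded_on_cball[OF loc_bounded_deriv_continuous_on[OF \<K>]] by blast
  obtain L where L: "L > 0" "\<And>x. norm x \<le> R + 1 \<Longrightarrow> norm (\<K>' x) \<le> L"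
    "\<And>x y. norm x \<le> R + 1 \<Longrightarrow> norm y \<le> R + 1 \<Longrightarrow> norm (\<K> x - \<K> y) \<le> L * norm (x - y)"
    by (rule loc_bounded_deriv_lipschitz[OF \<K>, of "R + 1"]) (rule that)
  have ci: "?c \<epsilon> integrable_on {0..T}" for \<epsilon>
    by (intro set_lebesgue_integral_eq_integral(1) cost_absolutely_integrable q u v)
  have "((\<lambda>\<epsilon>. integral {0..T} (\<lambda>s. (1 / \<epsilon>) *\<^sub>R (?c (0 + \<epsilon>) s - ?c 0 s))) \<longlongrightarrow> integral {0..T} ?d) (at 0)"
  \<comment> \<open>Below \<delta> the curves stay in the ball where \<open>L\<close> is valid;
    below 1 the bound of \<open>cost_difference_bound\<close> holds.\<close>
  proof (rule dominated_convergence_at[where \<delta> = "min \<delta> 1"])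
    show "(\<lambda>s. (1 / \<epsilon>) *\<^sub>R (?c (0 + \<epsilon>) s - ?c 0 s)) \<in> borel_measurable (lebesgue_on {0..T})" for \<epsilon>
      by (intro borel_measurable_scaleR borel_measurable_const borel_measurable_diff
          integrable_imp_measurable ci)
    show "(\<lambda>s. (L * C + k) * ((norm (u s))\<^sup>2 + (norm (v s))\<^sup>2)) integrable_on {0..T}"
      by (intro integrable_on_mult_right integrable_add L2_square_integrable u v)
    show "norm ((1 / \<epsilon>) *\<^sub>R (?c (0 + \<epsilon>) s - ?c 0 s)) \<le> (L * C + k) * ((norm (u s))\<^sup>2 + (norm (v s))\<^sup>2)"
      if \<epsilon>: "0 < \<bar>\<epsilon>\<bar>" "\<bar>\<epsilon>\<bar> < min \<delta> 1" and s: "s \<in> {0..T}" for \<epsilon> s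
    proof -
      have d: "norm (q \<epsilon> s - q 0 s) \<le> C * \<bar>\<epsilon>\<bar>" using \<epsilon> by (intro C(4) s) auto
      also have "\<dots> \<le> C * \<delta>" using \<epsilon> C by (intro mult_left_mono) auto
      finally have "norm (q \<epsilon> s) \<le> R + 1"
        using C(3) R[OF s] norm_triangle_ineq[of "q \<epsilon> s - q 0 s" "q 0 s"] by simp
      then have "norm (\<K> (q \<epsilon> s) - \<K> (q 0 s)) \<le> L * norm (q \<epsilon> s - q 0 s)"
        using R[OF s] by (intro L(3)) auto
      also have "\<dots> \<le> L * C * \<bar>\<epsilon>\<bar>" using d L(1) by (simp add: mult.assoc)
      finally have "\<bar>?c \<epsilon> s - cost \<K> (q 0 s) (u s)\<bar> \<le> \<bar>\<epsilon>\<bar> * ((L * C + k) * ((norm (u s))\<^sup>2 + (norm (v s))\<^sup>2))"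
        using \<epsilon> k[OF R[OF s]] L(1) C(1) by (intro cost_difference_bound) auto
      then show ?thesis using \<epsilon> by (simp add: divide_le_eq mult.commute)
    qed
    show "((\<lambda>\<epsilon>. (1 / \<epsilon>) *\<^sub>R (?c (0 + \<epsilon>) s - ?c 0 s)) \<longlongrightarrow> ?d s) (at 0)" if s: "s \<in> {0..T}" for s
    proof -
      note d = loc_bounded_deriv_has_derivative[OF \<K>, of "q 0 s"]
      have "cost_q \<K> (q 0 s) (u s) = (\<lambda>h. 1/2 * (blinfun_apply (\<K>' (q 0 s) h) (u s) \<bullet> u s))"
        unfolding cost_q_def by (rule frechet_derivative_at[symmetric, OF cost_has_derivative_q[OF d]])
      moreover have "cost_u \<K> (q 0 s) (u s) = (\<lambda>v. 1/2 * (\<K> (q 0 s) (u s) \<bullet> v + \<K> (q 0 s) v \<bullet> u s))"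
        unfolding cost_u_def by (rule frechet_derivative_at[symmetric, OF cost_has_derivative_u])
      ultimately show ?thesis
        using cost_has_vector_derivative[OF d dq[OF s], of "u s" "v s"]
        unfolding has_vector_derivative_iff_quotient by simp
    qed
  qed (use C in auto)
  moreover have "integral {0..T} (\<lambda>s. (1 / \<epsilon>) *\<^sub>R (?c (0 + \<epsilon>) s - ?c 0 s))
      = (1 / \<epsilon>) *\<^sub>R (integral {0..T} (?c (0 + \<epsilon>)) - integral {0..T} (?c 0))" for \<epsilon>
    by (simp only: Henstock_Kurzweil_Integration.integral_cmul
        Henstock_Kurzweil_Integration.integral_diff[OF ci ci])
  ultimately show ?thesis unfolding has_vector_derivative_iff_quotient by (simp only:)
qed

text \<open>Each coordinate of the gradient is a quadratic form in \<open>u s\<close> whose matrix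
  is bounded along the trajectory, so square integrability of the control yields exactly
  integrability.\<close>

lemma cost_grad_q_absolutely_integrable:
  fixes q :: "real \<Rightarrow> ('d::finite, 'n::finite) state"
  assumes q: "continuous_on {0..T} q" and u: "L2 T u"
  shows "(\<lambda>s. grad (\<lambda>q'. cost \<K> q' (u s)) (q s)) absolutely_integrable_on {0..T}"
proof -
  have g: "grad (\<lambda>q'. cost \<K> q' (u s)) (q s) =
      (\<Sum>b\<in>Basis. (1/2 * (blinfun_apply (\<K>' (q s) b) (u s) \<bullet> u s)) *\<^sub>R b)" for s
    by (intro grad_eq_sum cost_has_derivative_q loc_bounded_deriv_has_derivative[OF \<K>])
  obtain R where R: "\<And>s. s \<in> {0..T} \<Longrightarrow> norm (q s) \<le> R"
    using continuous_on_Icc_norm_bound[OF q] by blast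
  obtain k where k: "\<And>x. norm x \<le> R \<Longrightarrow> norm (\<K>' x) \<le> k"
    using continuous_bounded_on_cball[OF \<K>'_cont] by blast
  have "(\<lambda>s. 1/2 * (blinfun_apply (\<K>' (q s) b) (u s) \<bullet> u s)) absolutely_integrable_on {0..T}"
    if "b \<in> Basis" for b
  proof (rule measurable_bounded_by_integrable_imp_absolutely_integrable)
    have c: "continuous_on UNIV (\<lambda>x. 1/2 * (blinfun_apply (\<K>' (fst x) b) (snd x) \<bullet> snd x))"
      by (intro continuous_intros continuous_on_compose2[OF \<K>'_cont]) auto
    show "(\<lambda>s. 1/2 * (blinfun_apply (\<K>' (q s) b) (u s) \<bullet> u s)) \<in> borel_measurable (lebesgue_on {0..T})"
      by (intro borel_measurable_continuous_Pair[OF _ _ c] continuous_imp_measurable_on_sets_lebesgue[OF q]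
          L2_measurable[OF u]) simp
    show "(\<lambda>s. k * (norm (u s))\<^sup>2) integrable_on {0..T}"
      by (intro integrable_on_mult_right L2_square_integrable u)
    fix s assume s: "s \<in> {0..T}"
    have "norm (\<K>' (q s) b) \<le> norm (\<K>' (q s)) * norm b" by (rule norm_blinfun)
    then have n: "norm (\<K>' (q s) b) \<le> k" using k[OF R[OF s]] that by simp
    have "\<bar>blinfun_apply (\<K>' (q s) b) (u s) \<bullet> u s\<bar> \<le> norm (\<K>' (q s) b) * norm (u s) * norm (u s)"
      by (intro order_trans[OF Cauchy_Schwarz_ineq2] mult_right_mono norm_blinfun) auto
    also have "\<dots> \<le> k * norm (u s) * norm (u s)" using n by (intro mult_right_mono) auto
    finally show "norm (1/2 * (blinfun_apply (\<K>' (q s) b) (u s) \<bullet> u s)) \<le> k * (norm (u s))\<^sup>2"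
      by (simp add: power2_eq_square)
  qed simp
  then show ?thesis unfolding g
    by (intro absolutely_integrable_sum absolutely_integrable_scaleR_right) auto
qed

text \<open>Polarisation: the derivative in the control is the cross term of the quadratic form, a
  combination of three costs already known to be integrable.\<close>

lemma cost_u_absolutely_integrable:
  fixes q :: "real \<Rightarrow> ('d::finite, 'n::finite) state"
  assumes q: "continuous_on {0..T} q" and u: "L2 T u" and v: "L2 T v"
  shows "(\<lambda>s. cost_u \<K> (q s) (u s) (v s)) absolutely_integrable_on {0..T}"
proof -
  have e: "cost_u \<K> (q s) (u s) (v s) = 1/2 * (\<K> (q s) (u s) \<bullet> v s + \<K> (q s) (v s) \<bullet> u s)" for s
    unfolding cost_u_def by (simp add: frechet_derivative_at[symmetric, OF cost_has_derivative_u])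
  have "cost_u \<K> (q s) (u s) (v s) =
      cost \<K> (q s) (u s + 1 *\<^sub>R v s) - cost \<K> (q s) (u s + 0 *\<^sub>R v s) - cost \<K> (q s) (v s + 0 *\<^sub>R v s)" for s
    unfolding e cost_def by (simp add: blinfun.bilinear_simps inner_simps algebra_simps)
  then show ?thesis
    by (simp only:) (intro set_integral_diff(1) cost_absolutely_integrable q u v)
qed

end

section \<open>The gradient formula\<close>

lemma abs_continuous_on_Icc_subset:
  "abs_continuous_on_Icc a b f \<Longrightarrow> {c..d} \<subseteq> {a..b} \<Longrightarrow> abs_continuous_on_Icc c d f"
  unfolding abs_continuous_on_Icc_def by (meson order_trans)

text \<open>On \<open>{0..t}\<close> the differential is the right limit of \<open>P\<close> at
  \<open>t\<close> minus \<open>P 0\<close>, and the right limit is \<open>P t\<close> at a point of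
  continuity. Taking \<open>t = T\<close> and \<open>P T = 0\<close> determines \<open>P 0\<close>,
  with every atom counted, even one at 0.\<close>

lemma bounded_variation_differential_representation:
  fixes P a :: "real \<Rightarrow> 'a::euclidean_space"
  assumes bv: "bounded_variation_on_Icc 0 T P" and PT: "P T = 0" and T: "0 < T"
    and hd: "has_differential 0 T P \<mu>"
    and a: "a integrable_on {0..T}" and I: "finite I" and \<tau>: "\<And>k. k \<in> I \<Longrightarrow> \<tau> k \<in> {0..T}"
    and \<mu>: "\<And>t. t \<in> {0..T} \<Longrightarrow>
      \<mu> {0..t} = - integral {0..t} a - (\<Sum>k\<in>I. vector_dirac (v k) (\<tau> k) {0..t})"
  obtains C where "negligible C" "P 0 = integral {0..T} a + (\<Sum>k\<in>I. v k)"
    "\<And>t. t \<in> {0..T} - C \<Longrightarrow> P t = integral {t..T} a + (\<Sum>k\<in>I. if t < \<tau> k then v k else 0)"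
proof -
  \<comment> \<open>\<open>T\<close> is put into the exceptional set because
    \<open>has_differential\<close> uses \<open>P T\<close> itself there instead of a right
    limit.\<close>
  define C where "C = insert T {x\<in>{0..T}. \<not> continuous (at x within {0..T}) P}"
  have "negligible C"
    unfolding C_def negligible_iff_null_sets
    by (intro countable_imp_null_set_lborel[THEN null_sets_completionI] countable_insert
        bounded_variation_countable_discont[OF bv])
  have "\<mu> {0..T} = P T - P 0"
    using hd T unfolding has_differential_def by auto
  moreover have "(\<Sum>k\<in>I. vector_dirac (v k) (\<tau> k) {0..T}) = (\<Sum>k\<in>I. v k)"
    using \<tau> by (intro sum.cong) (auto simp: vector_dirac_def)
  ultimately have "- P 0 = - (integral {0..T} a + (\<Sum>k\<in>I. v k))"
    using \<mu>[of T] T PT by simp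
  then have P0: "P 0 = integral {0..T} a + (\<Sum>k\<in>I. v k)" by (simp only: neg_equal_iff_equal)
  have "P t = integral {t..T} a + (\<Sum>k\<in>I. if t < \<tau> k then v k else 0)" if t: "t \<in> {0..T} - C" for t
  proof -
    have tT: "0 \<le> t" "t < T" and ct: "continuous (at t within {0..T}) P"
      using t by (auto simp: C_def)
    have "P t = Lim (at_right t) P"
      using continuous_imp_Lim_at_right[OF ct tT] by simp
    also have "\<dots> = P 0 + \<mu> {0..t}"
    proof -
      have "\<mu> {0..t} = Lim (at_right t) P - P 0"
        using hd[unfolded has_differential_def, rule_format, of 0 t] tT by simp
      then show ?thesis by simp
    qed
    also have "\<mu> {0..t} = - integral {0..t} a - (\<Sum>k\<in>I. vector_dirac (v k) (\<tau> k) {0..t})"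
      using tT by (intro \<mu>) auto
    finally have "P t = (integral {0..T} a - integral {0..t} a)
        + ((\<Sum>k\<in>I. v k) - (\<Sum>k\<in>I. vector_dirac (v k) (\<tau> k) {0..t}))"
      by (simp add: P0)
    also have "integral {0..T} a - integral {0..t} a = integral {t..T} a"
      using Henstock_Kurzweil_Integration.integral_combine[of 0 t T a] tT a by (simp add: algebra_simps)
    \<comment> \<open>The closed interval \<open>{0..t}\<close> already counts an atom at
      \<open>t\<close>, so the remaining ones satisfy the strict inequality.\<close>
    also have "(\<Sum>k\<in>I. v k) - (\<Sum>k\<in>I. vector_dirac (v k) (\<tau> k) {0..t})
        = (\<Sum>k\<in>I. if t < \<tau> k then v k else 0)"
      unfolding sum_subtractf[symmetric]
      using \<tau> by (intro sum.cong) (auto simp: vector_dirac_def indicator_def)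
    finally show ?thesis .
  qed
  then show thesis using that \<open>negligible C\<close> P0 by blast
qed

text \<open>The adjoint equation leaves the values of \<open>P\<close> at its interior jumps open;
  they enter only under the integral. Outside it only \<open>P 0\<close> appears, which is
  determined because \<open>has_differential\<close> takes it as the left limit at 0.\<close>

theorem theorem3:
  fixes ev :: "'v::{real_inner,complete_space} \<Rightarrow> real^'d \<Rightarrow> real^'d"
    and K :: "real^'d \<Rightarrow> real^'d \<Rightarrow> real^'d^'d"
    and \<K> :: "('d::finite, 'n::finite) state \<Rightarrow> ('d, 'n) conf \<Rightarrow>\<^sub>L ('d, 'n) conf"
    and g :: "nat \<Rightarrow> ('d, 'n) state \<Rightarrow> real"
    and E :: "('d, 'n) state \<Rightarrow> real"
    and M :: nat and t :: "nat \<Rightarrow> real" and T :: real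
    and u \<delta>u :: "real \<Rightarrow> ('d, 'n) conf"
    and q0 \<delta>q0 :: "('d, 'n) state"
    and q :: "real \<Rightarrow> real \<Rightarrow> ('d, 'n) state"
    and \<delta>q P :: "real \<Rightarrow> ('d, 'n) state"
    and J :: "real \<Rightarrow> real"
  assumes "M \<ge> 1" and "0 \<le> t 1" and "strict_mono_on {1..M} t" and "t M < T"
    and "space_of_fields ev" and "continuously_embedded_C1_0 ev"
    and "reproducing_kernel ev K" and "C2_in_each_variable K"
    and "C1 \<K>" and "\<And>k. k \<in> {1..M} \<Longrightarrow> C1 (g k)" and "C1 E"
    and "L2 T u" and "L2 T \<delta>u"
    and "\<And>\<epsilon>. controlled_solution K T (\<lambda>s. u s + \<epsilon> *\<^sub>R \<delta>u s) (q0 + \<epsilon> *\<^sub>R \<delta>q0) (q \<epsilon>)"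
    and "\<And>\<epsilon>. J \<epsilon> = E (q0 + \<epsilon> *\<^sub>R \<delta>q0)
            + (LINT s:{0..T}|lebesgue. cost \<K> (q \<epsilon> s) (u s + \<epsilon> *\<^sub>R \<delta>u s))
            + (\<Sum>k=1..M. g k (q \<epsilon> (t k)))"
    and "linearized_solution K T (q 0) u \<delta>u \<delta>q0 \<delta>q"
    and "adjoint_solution K T (q 0) u \<K> M t g P"
  shows "((\<lambda>\<epsilon>. (J \<epsilon> - J 0) / \<epsilon>) \<longlongrightarrow>
            grad E q0 \<bullet> \<delta>q0
            + (LINT s:{0..T}|lebesgue.
                 cost_q \<K> (q 0 s) (u s) (\<delta>q s) + cost_u \<K> (q 0 s) (u s) (\<delta>u s))
            + (\<Sum>k=1..M. grad (g k) (q 0 (t k)) \<bullet> \<delta>q (t k))) (at 0)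
       \<and> grad E q0 \<bullet> \<delta>q0
            + (LINT s:{0..T}|lebesgue.
                 cost_q \<K> (q 0 s) (u s) (\<delta>q s) + cost_u \<K> (q 0 s) (u s) (\<delta>u s))
            + (\<Sum>k=1..M. grad (g k) (q 0 (t k)) \<bullet> \<delta>q (t k))
         = (grad E q0 + P 0) \<bullet> \<delta>q0
            + (LINT s:{0..T}|lebesgue.
                 (grad (\<lambda>u'. cost \<K> (q 0 s) u') (u s)
                  + adjoint (dyn_u K (q 0 s) (u s)) (P s)) \<bullet> \<delta>u s)"
proof -
  have tk: "t k \<in> {0..T}" if "k \<in> {1..M}" for k
  proof -
    have "t 1 \<le> t k" "t k \<le> t M"
      using assms(1,3) that strict_mono_on_leD[OF assms(3)] by auto
    then show ?thesis using assms(2,4) by simp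
  qed
  have Tpos: "0 < T" using tk[of M] assms(1,4) by auto
  define F where "F x = dyn K x 0" for x :: "('d, 'n) state"
  define F' where "F' x = Blinfun (frechet_derivative F (at x))" for x
  have F: "loc_bounded_deriv F F'"
    unfolding F'_def F_def
    by (intro loc_bounded_diff_imp_deriv dyn_loc_bounded_diff[OF assms(5-8)])
  have dyn: "dyn K x w = F x + (0, w)" for x :: "('d, 'n) state" and w
    unfolding F_def by (rule dyn_control_affine)
  have dq: "dyn_q K x w = blinfun_apply (F' x)" for x :: "('d, 'n) state" and w
    unfolding dyn_q_def dyn
    by (intro frechet_derivative_at[symmetric] has_derivative_eq_rhs[OF has_derivative_add[OF
        loc_bounded_deriv_has_derivative[OF F] has_derivative_const]]) simp
  have du: "dyn_u K x w = (\<lambda>v. (0, v))" for x :: "('d, 'n) state" and w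
    unfolding dyn_u_def dyn
    by (intro frechet_derivative_at[symmetric] has_derivative_eq_rhs[OF has_derivative_add[OF
        has_derivative_const has_derivative_Pair[OF has_derivative_const has_derivative_ident]]])
      simp
  have lin0: "bounded_linear (\<lambda>v :: ('d, 'n) conf. (0 :: ('d, 'n) conf, v))"
    by (intro bounded_linear_Pair bounded_linear_zero bounded_linear_ident)
  \<comment> \<open>The control as a forcing term: it acts on the momentum component only.\<close>
  define w where "w s = (0 :: ('d, 'n) conf, u s)" for s
  define dw where "dw s = (0 :: ('d, 'n) conf, \<delta>u s)" for s
  have w: "w absolutely_integrable_on {0..T}" and dw: "dw absolutely_integrable_on {0..T}"
    using absolutely_integrable_linear[OF L2_absolutely_integrable lin0] assms(12,13)
    unfolding w_def dw_def o_def by blast+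
  have qc: "continuous_on {0..T} (q \<epsilon>)" for \<epsilon>
    using assms(14)[of \<epsilon>] by (simp add: controlled_solution_def)
  have Fq: "continuous_on {0..T} (\<lambda>s. F (q \<epsilon> s))" for \<epsilon>
    by (rule continuous_on_compose2[OF loc_bounded_deriv_continuous_on[OF F, of UNIV] qc]) auto
  have q_eq: "q \<epsilon> t = q0 + \<epsilon> *\<^sub>R \<delta>q0 + integral {0..t} (\<lambda>s. F (q \<epsilon> s) + (w s + \<epsilon> *\<^sub>R dw s))"
    if t: "t \<in> {0..T}" for \<epsilon> t
  proof -
    have "(\<lambda>s. F (q \<epsilon> s) + (w s + \<epsilon> *\<^sub>R dw s)) absolutely_integrable_on {0..T}"
      by (intro set_integral_add(1) absolutely_integrable_scaleR_left w dw
          absolutely_integrable_continuous_real Fq)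
    then have "(\<lambda>s. F (q \<epsilon> s) + (w s + \<epsilon> *\<^sub>R dw s)) absolutely_integrable_on {0..t}"
      by (rule absolutely_integrable_on_subinterval) (use t in auto)
    moreover have "dyn K (q \<epsilon> s) (u s + \<epsilon> *\<^sub>R \<delta>u s) = F (q \<epsilon> s) + (w s + \<epsilon> *\<^sub>R dw s)" for s
      by (simp add: dyn w_def dw_def)
    ultimately show ?thesis
      using assms(14)[of \<epsilon>] t set_lebesgue_integral_eq_integral(2)
      by (simp add: controlled_solution_def)
  qed
  have ac: "abs_continuous_on_Icc 0 T \<delta>q" and dq0: "\<delta>q 0 = \<delta>q0"
    and der: "AE t in lebesgue. t \<in> {0..T} \<longrightarrow>
        (\<delta>q has_vector_derivative (F' (q 0 t) (\<delta>q t) + dw t)) (at t within {0..T})"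
    using assms(16) by (auto simp: linearized_solution_def dq du dw_def)
  \<comment> \<open>Absolute continuity makes \<delta>q the integral of its almost everywhere
    derivative; it is applied on every \<open>{0..t}\<close>, where the derivative within the
    smaller interval is the same vector.\<close>
  have dq_int: "((\<lambda>s. F' (q 0 s) (\<delta>q s) + dw s) has_integral (\<delta>q t - \<delta>q0)) {0..t}"
    if t: "t \<in> {0..T}" for t
  proof -
    have "AE s in lebesgue. s \<in> {0..t} \<longrightarrow>
        (\<delta>q has_vector_derivative (F' (q 0 s) (\<delta>q s) + dw s)) (at s within {0..t})"
      using der by eventually_elim (use t in \<open>auto intro: has_vector_derivative_within_subset\<close>)
    then show ?thesis
      using abs_continuous_has_integral[OF abs_continuous_on_Icc_subset[OF ac]] t dq0 by auto
  qed
  have dq_eq: "\<delta>q t = \<delta>q0 + integral {0..t} (\<lambda>s. F' (q 0 s) (\<delta>q s) + dw s)" if "t \<in> {0..T}" for t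
    using integral_unique[OF dq_int[OF that]] by simp
  have dqc: "continuous_on {0..T} \<delta>q"
  proof -
    have "continuous_on {0..T} (\<lambda>t. \<delta>q0 + integral {0..t} (\<lambda>s. F' (q 0 s) (\<delta>q s) + dw s))"
      using dq_int[of T] Tpos by (intro continuous_intros indefinite_integral_continuous_1) auto
    then show ?thesis using dq_eq by (subst continuous_on_cong[OF refl]) auto
  qed
  interpret perturbed_flow F F' w dw T q q0 \<delta>q0 \<delta>q
    by unfold_locales (use Tpos F w dw qc q_eq dqc dq_eq in auto)
  obtain \<K>' where \<K>: "loc_bounded_deriv \<K> \<K>'" "continuous_on UNIV \<K>'"
    using C1_imp_loc_bounded_deriv[OF assms(9)] by blast
  obtain E' where E': "\<And>x. (E has_derivative blinfun_apply (E' x)) (at x)"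
    using assms(11) unfolding C1_def by blast
  have "\<exists>g'. (g k has_derivative g') (at x)" if "k \<in> {1..M}" for k x
    using assms(10)[OF that] unfolding C1_def by blast
  then obtain g' where g': "\<And>k x. k \<in> {1..M} \<Longrightarrow> (g k has_derivative g' k x) (at x)"
    by metis
  have q00: "q 0 0 = q0" using q_eq[of 0 0] Tpos by simp
  let ?c = "\<lambda>s. grad (\<lambda>q'. cost \<K> q' (u s)) (q 0 s)"
  let ?cu = "\<lambda>s. grad (\<lambda>u'. cost \<K> (q 0 s) u') (u s)"
  let ?d = "\<lambda>s. cost_q \<K> (q 0 s) (u s) (\<delta>q s) + cost_u \<K> (q 0 s) (u s) (\<delta>u s)"
  have cq: "cost_q \<K> (q 0 s) (u s) h = ?c s \<bullet> h" for s h
  proof -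
    note d = cost_has_derivative_q[OF loc_bounded_deriv_has_derivative[OF \<K>(1)]]
    show ?thesis unfolding cost_q_def grad_inner[OF d] frechet_derivative_at[OF d, symmetric] by simp
  qed
  have cu: "cost_u \<K> (q 0 s) (u s) h = ?cu s \<bullet> h" for s h
    unfolding cost_u_def grad_inner[OF cost_has_derivative_u]
      frechet_derivative_at[OF cost_has_derivative_u, symmetric] by simp
  have cai: "?c absolutely_integrable_on {0..T}"
    by (rule cost_grad_q_absolutely_integrable[OF \<K> qc assms(12)])
  have cqai: "(\<lambda>s. ?c s \<bullet> \<delta>q s) absolutely_integrable_on {0..T}"
    by (rule absolutely_integrable_inner_continuous(2)[OF dqc cai])
  have cuai: "(\<lambda>s. ?cu s \<bullet> \<delta>u s) absolutely_integrable_on {0..T}"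
    using cost_u_absolutely_integrable[OF \<K> qc[of 0] assms(12,13)] by (simp add: cu)
  have LINTd: "(LINT s:{0..T}|lebesgue. ?d s) = integral {0..T} ?d"
    unfolding cq cu by (intro set_lebesgue_integral_eq_integral(2) set_integral_add(1) cqai cuai)

  show ?thesis
  proof (rule conjI)
    obtain C \<delta> where C: "C \<ge> 0" "\<delta> > 0" "C * \<delta> \<le> 1"
      "\<And>\<epsilon> t. \<bar>\<epsilon>\<bar> < \<delta> \<Longrightarrow> t \<in> {0..T} \<Longrightarrow> norm (q \<epsilon> t - q 0 t) \<le> C * \<bar>\<epsilon>\<bar>"
      by (rule flow_lipschitz) (rule that)
    have 1: "((\<lambda>\<epsilon>. E (q0 + \<epsilon> *\<^sub>R \<delta>q0)) has_vector_derivative grad E q0 \<bullet> \<delta>q0) (at 0)"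
      unfolding grad_inner[OF E'] by (rule has_vector_derivative_line[OF E'])
    have 2: "((\<lambda>\<epsilon>. LINT s:{0..T}|lebesgue. cost \<K> (q \<epsilon> s) (u s + \<epsilon> *\<^sub>R \<delta>u s)) has_vector_derivative
        (LINT s:{0..T}|lebesgue. ?d s)) (at 0)"
      unfolding LINTd set_lebesgue_integral_eq_integral(2)[OF cost_absolutely_integrable[OF \<K> qc assms(12,13)]]
      by (rule cost_integral_derivative[OF \<K> qc assms(12,13) C flow_differentiable])
    have 3: "((\<lambda>\<epsilon>. g k (q \<epsilon> (t k))) has_vector_derivative grad (g k) (q 0 (t k)) \<bullet> \<delta>q (t k)) (at 0)"
      if k: "k \<in> {1..M}" for k
      unfolding grad_inner[OF g'[OF k]]
      by (rule has_vector_derivative_compose_derivative[OF g'[OF k] flow_differentiable[OF tk[OF k]]])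
    have "(J has_vector_derivative grad E q0 \<bullet> \<delta>q0 + (LINT s:{0..T}|lebesgue. ?d s)
            + (\<Sum>k=1..M. grad (g k) (q 0 (t k)) \<bullet> \<delta>q (t k))) (at 0)"
      unfolding assms(15)[abs_def]
      by (intro has_vector_derivative_add has_vector_derivative_sum 1 2 3)
    then show "((\<lambda>\<epsilon>. (J \<epsilon> - J 0) / \<epsilon>) \<longlongrightarrow> grad E q0 \<bullet> \<delta>q0 + (LINT s:{0..T}|lebesgue. ?d s)
            + (\<Sum>k=1..M. grad (g k) (q 0 (t k)) \<bullet> \<delta>q (t k))) (at 0)"
      unfolding has_vector_derivative_iff_quotient by simp
  next
    have bv: "bounded_variation_on_Icc 0 T P" and PT: "P T = 0"
      and hd: "has_differential 0 T P (\<lambda>B.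
         - (LINT s:B|lebesgue. adjoint (F' (q 0 s)) (P s)) - (LINT s:B|lebesgue. ?c s)
         - (\<Sum>k=1..M. vector_dirac (grad (g k) (q 0 (t k))) (t k) B))"
      using assms(17) by (auto simp: adjoint_solution_def dq)
    have Pm: "P \<in> borel_measurable (lebesgue_on {0..T})" and Pb: "bounded (P ` {0..T})"
      using bounded_variation_measurable[OF bv] bounded_variation_imp_bounded[OF bv] Tpos by auto
    note Pin = absolutely_integrable_inner_bounded(2)[OF Pm _ Pb]
    have linF: "linear (blinfun_apply (F' x))" for x
      by (intro bounded_linear.linear blinfun.bounded_linear_right)
    define A where "A s = adjoint (F' (q 0 s)) (P s)" for s
    have A: "A s \<bullet> h = F' (q 0 s) h \<bullet> P s" for s h
      unfolding A_def using adjoint_works[OF linF, of h] by (simp add: inner_commute)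
    \<comment> \<open>In coordinates \<open>A\<close> pairs the bounded measurable function
      \<open>P\<close> with the derivative of \<open>F\<close> along the trajectory in a constant
      direction, so its integrability reduces to that of these pairings.\<close>
    have Aai: "A absolutely_integrable_on {0..T}"
    proof -
      have "A s = (\<Sum>b\<in>Basis. (F' (q 0 s) b \<bullet> P s) *\<^sub>R b)" for s
        unfolding A[symmetric] by (rule euclidean_representation[symmetric])
      then have "A = (\<lambda>s. \<Sum>b\<in>Basis. (F' (q 0 s) b \<bullet> P s) *\<^sub>R b)" by (rule ext)
      then show ?thesis
        by (simp only:) (intro absolutely_integrable_sum absolutely_integrable_scaleR_right Pin
            F'_along_int continuous_on_const finite_Basis; simp)
    qed
    \<comment> \<open>\<open>- a\<close> is the density of the part of \<open>dP\<close> without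
      atoms.\<close>
    define a where "a s = A s + ?c s" for s
    have aai: "a absolutely_integrable_on {0..T}"
      unfolding a_def by (intro set_integral_add(1) Aai cai)
    have bai: "(\<lambda>s. F' (q 0 s) (\<delta>q s) + dw s) absolutely_integrable_on {0..T}"
      by (intro set_integral_add(1) F'_along_int dqc dw)
    obtain Z where Z: "negligible Z"
      "P 0 = integral {0..T} a + (\<Sum>k\<in>{1..M}. grad (g k) (q 0 (t k)))"
      "\<And>s. s \<in> {0..T} - Z \<Longrightarrow>
        P s = integral {s..T} a + (\<Sum>k\<in>{1..M}. if s < t k then grad (g k) (q 0 (t k)) else 0)"
    proof (rule bounded_variation_differential_representation[OF bv PT Tpos hd, of a "{1..M}" t "\<lambda>k. grad (g k) (q 0 (t k))"])
      show "a integrable_on {0..T}" by (rule set_lebesgue_integral_eq_integral(1)[OF aai])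
      fix s assume s: "s \<in> {0..T}"
      have i: "A absolutely_integrable_on {0..s}" "?c absolutely_integrable_on {0..s}"
        by (intro sub_abs_integrable[OF _ s] Aai cai)+
      have "integral {0..s} a = (LINT r:{0..s}|lebesgue. A r) + (LINT r:{0..s}|lebesgue. ?c r)"
        unfolding a_def set_lebesgue_integral_eq_integral(2)[OF i(1)] set_lebesgue_integral_eq_integral(2)[OF i(2)]
        by (intro Henstock_Kurzweil_Integration.integral_add set_lebesgue_integral_eq_integral(1) i)
      then show "- (LINT r:{0..s}|lebesgue. adjoint (F' (q 0 r)) (P r)) - (LINT r:{0..s}|lebesgue. ?c r)
         - (\<Sum>k=1..M. vector_dirac (grad (g k) (q 0 (t k))) (t k) {0..s}) =
        - integral {0..s} a - (\<Sum>k=1..M. vector_dirac (grad (g k) (q 0 (t k))) (t k) {0..s})"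
        by (simp add: A_def)
    qed (use tk that in auto)
    have dual: "integral {0..T} (\<lambda>s. a s \<bullet> \<delta>q s) + (\<Sum>k\<in>{1..M}. grad (g k) (q 0 (t k)) \<bullet> \<delta>q (t k))
        = P 0 \<bullet> \<delta>q0 + integral {0..T} (\<lambda>s. (F' (q 0 s) (\<delta>q s) + dw s) \<bullet> P s)"
      by (rule adjoint_duality[OF aai bai dq_eq _ tk Z(3,1,2)]) auto
    \<comment> \<open>The transpose of the inclusion of controls extracts the momentum component of
      \<open>P\<close>.\<close>
    have adj_u: "adjoint (dyn_u K (q 0 s) (u s)) (P s) \<bullet> h = (0, h) \<bullet> P s" for s h
      unfolding du using adjoint_works[OF bounded_linear.linear[OF lin0], of h "P s"] by (simp add: inner_commute)
    have aqai: "(\<lambda>s. a s \<bullet> \<delta>q s) absolutely_integrable_on {0..T}"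
      by (rule absolutely_integrable_inner_continuous(2)[OF dqc aai])
    have bPai: "(\<lambda>s. (F' (q 0 s) (\<delta>q s) + dw s) \<bullet> P s) absolutely_integrable_on {0..T}"
      by (rule Pin[OF _ bai]) simp
    have dwPai: "(\<lambda>s. dw s \<bullet> P s) absolutely_integrable_on {0..T}"
      by (rule Pin[OF _ dw]) simp
    note hk = set_lebesgue_integral_eq_integral(1)
    have "integral {0..T} ?d - integral {0..T} (\<lambda>s. a s \<bullet> \<delta>q s)
        = integral {0..T} (\<lambda>s. ?d s - a s \<bullet> \<delta>q s)"
      unfolding cq cu by (intro Henstock_Kurzweil_Integration.integral_diff[symmetric] hk set_integral_add(1) cqai cuai aqai)
    \<comment> \<open>The gradient of the cost in the state cancels against its copy in
      \<open>a\<close>, and \<open>A s \<bullet> \<delta>q s\<close> is the pairing of the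
      linearised field with \<open>P s\<close>. Adding and subtracting
      \<open>dw s \<bullet> P s\<close> completes this to the derivative of \<delta>q, the pairing
      that occurs in \<open>dual\<close>.\<close>
    also have "\<dots> = integral {0..T} (\<lambda>s. (?cu s \<bullet> \<delta>u s + dw s \<bullet> P s) - (F' (q 0 s) (\<delta>q s) + dw s) \<bullet> P s)"
      by (intro Henstock_Kurzweil_Integration.integral_cong) (simp add: cq cu a_def inner_add_left A)
    also have "\<dots> = integral {0..T} (\<lambda>s. ?cu s \<bullet> \<delta>u s + dw s \<bullet> P s)
        - integral {0..T} (\<lambda>s. (F' (q 0 s) (\<delta>q s) + dw s) \<bullet> P s)"
      by (intro Henstock_Kurzweil_Integration.integral_diff hk set_integral_add(1) cuai dwPai bPai)
    finally have main: "integral {0..T} ?d + (\<Sum>k=1..M. grad (g k) (q 0 (t k)) \<bullet> \<delta>q (t k))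
        = P 0 \<bullet> \<delta>q0 + integral {0..T} (\<lambda>s. ?cu s \<bullet> \<delta>u s + dw s \<bullet> P s)"
      using dual by simp
    have "(LINT s:{0..T}|lebesgue. (?cu s + adjoint (dyn_u K (q 0 s) (u s)) (P s)) \<bullet> \<delta>u s)
        = (LINT s:{0..T}|lebesgue. ?cu s \<bullet> \<delta>u s + dw s \<bullet> P s)"
      unfolding inner_add_left adj_u dw_def ..
    also have "\<dots> = integral {0..T} (\<lambda>s. ?cu s \<bullet> \<delta>u s + dw s \<bullet> P s)"
      by (intro set_lebesgue_integral_eq_integral(2) set_integral_add(1) cuai dwPai)
    finally show "grad E q0 \<bullet> \<delta>q0 + (LINT s:{0..T}|lebesgue. ?d s)
            + (\<Sum>k=1..M. grad (g k) (q 0 (t k)) \<bullet> \<delta>q (t k))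
         = (grad E q0 + P 0) \<bullet> \<delta>q0
            + (LINT s:{0..T}|lebesgue. (?cu s + adjoint (dyn_u K (q 0 s) (u s)) (P s)) \<bullet> \<delta>u s)"
      unfolding LINTd using main by (simp add: inner_add_left)
  qed
qed

end
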